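(* Let $n\ge 2$ and $p=\lfloor n/2\rfloor$. Define two-sided ideals of $\mathcal{V}_n$ by $I_0=\mathcal{V}_n$, $I_r=(e_1e_3e_5\cdots e_{2r-1})$ for $1\le r\le p$, and $I_{p+1}=\{0\}$. (1) For $1\le r\le p$, the ideal $I_r$ consists of all elements of $\mathcal{V}_n$ whose diagrams contain at most $n-2r$ through strands (i.e. the linear combinations of normal diagrams having at most $n-2r$ through strands). It can be generated, as a two-sided ideal, by any element of the form $e_{i_1}e_{i_2}\cdots e_{i_r}$ such that $|i_j-i_k|>1$ for all $j\ne k$ in $\{1,\dots,r\}$. (2) There is a filtration of $\mathcal{V}_n$ given by $$0=I_{p+1}\subsetneq I_p=(e_1e_3\cdots e_{2p-1})\subsetneq I_{p-1}=(e_1e_3\cdots e_{2p-3})\subsetneq\cdots\subsetneq I_1=(e_1)\subsetneq I_0=\mathcal{V}_n.$$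
   Context: For $n\ge 1$, the degenerate affine periplectic Brauer algebra $\mathcal{V}_n$ is the unital associative $\mathbb{C}$-algebra with generators $s_i,e_i$ ($1\le i\le n-1$) and $y_j$ ($1\le j\le n$) and relations (for all indices for which the expressions make sense): $s_i^2=1$; $s_is_j=s_js_i$, $s_ie_j=e_js_i$, $e_ie_j=e_je_i$ if $|i-j|>1$; $s_is_{i+1}s_i=s_{i+1}s_is_{i+1}$; $y_iy_j=y_jy_i$; $e_iy_j=y_je_i$ and $s_iy_j=y_js_i$ if $j\ne i,i+1$; $e_{i+1}e_ie_{i+1}=-e_{i+1}$; $e_ie_{i+1}e_i=-e_i$; $e_is_i=e_i$; $s_ie_i=-e_i$; $s_ie_{i+1}e_i=s_{i+1}e_i$; $s_{i+1}e_ie_{i+1}=-s_ie_{i+1}$; $e_{i+1}e_is_{i+1}=e_{i+1}s_i$; $e_ie_{i+1}s_i=-e_is_{i+1}$; $e_i^2=0$; $s_iy_i-y_{i+1}s_i=-e_i-1$; $y_is_i-s_iy_{i+1}=e_i-1$; $e_i(y_i-y_{i+1})=-e_i$; $(y_i-y_{i+1})e_i=e_i$. Diagrams. A Brauer diagram is a perfect matching of $2n$ points, $n$ on a bottom line and $n$ on a top line. Pairs joining a bottom point and a top point are through strands, pairs of top points are cups, pairs of bottom points are caps. The generator $s_i$ corresponds to the diagram crossing strands $i$ and $i+1$; $e_i$ corresponds to the diagram with a cup joining top points $i,i+1$, a cap joining bottom points $i,i+1$, and all other strands vertical. A product $ab$ is obtained by stacking $a$ on top of $b$; a product producing a closed loop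 is $0$. For each Brauer diagram $d$ fix a monomial in the $s_i,e_i$ whose stacked diagram is $d$ with no closed loop arising; the resulting element of $\mathcal{V}_n$, also denoted $d$, is nonzero and independent of choices up to sign. A normal diagram is an element $y_1^{a_1}\cdots y_n^{a_n}\,d\,y_1^{b_1}\cdots y_n^{b_n}$ with $d$ a Brauer diagram, $a_j,b_j\ge0$, where $a_j=0$ unless the $j$-th top point is the right end of a cup or the top end of a through strand, and $b_j=0$ unless the $j$-th bottom point is the left end of a cap; its through strands are those of $d$. It is known that the normal diagrams form a $\mathbb{C}$-basis of $\mathcal{V}_n$. *)

theory Defs
  imports
    Complex_Main
    "HOL-Library.Poly_Mapping"
    "HOL-Library.Disjoint_Sets"
    "HOL-Algebra.QuotRing"
begin

section \<open>The free algebra on the generators\<close>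

datatype gen = Cross nat | CupCap nat | Dot nat
  \<comment> \<open>the letters \<open>s\<^sub>i\<close>, \<open>e\<^sub>i\<close>, \<open>y\<^sub>j\<close>\<close>

text \<open>
  Words get their own type, so that the additive monoid structure required by the
  convolution product on \<open>\<Rightarrow>\<^sub>0\<close> does not become a global instance for lists. The monoid
  operation is concatenation; it is written \<open>+\<close> although it is not commutative.
\<close>

datatype word = Word (letters: "gen list")

instantiation word :: monoid_add
begin

definition zero_word :: word where "zero_word = Word []"

definition plus_word :: "word \<Rightarrow> word \<Rightarrow> word" where
  "plus_word u v = Word (letters u @ letters v)"

instance by standard (simp_all add: zero_word_def plus_word_def)

end

type_synonym free_alg = "word \<Rightarrow>\<^sub>0 complex"

fun gen_ok :: "nat \<Rightarrow> gen \<Rightarrow> bool" where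
  "gen_ok n (Cross i) \<longleftrightarrow> 1 \<le> i \<and> i < n"
| "gen_ok n (CupCap i) \<longleftrightarrow> 1 \<le> i \<and> i < n"
| "gen_ok n (Dot j) \<longleftrightarrow> 1 \<le> j \<and> j \<le> n"

definition free_algebra :: "nat \<Rightarrow> free_alg ring" where
  "free_algebra n =
     \<lparr>carrier = {f. \<forall>w \<in> Poly_Mapping.keys f. \<forall>g \<in> set (letters w). gen_ok n g},
      monoid.mult = (*), one = 1, ring.zero = 0, add = (+)\<rparr>"

definition free_word :: "gen list \<Rightarrow> free_alg" where
  "free_word w = Poly_Mapping.single (Word w) 1"

abbreviation free_s :: "nat \<Rightarrow> free_alg" where "free_s i \<equiv> free_word [Cross i]"
abbreviation free_e :: "nat \<Rightarrow> free_alg" where "free_e i \<equiv> free_word [CupCap i]"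
abbreviation free_y :: "nat \<Rightarrow> free_alg" where "free_y j \<equiv> free_word [Dot j]"


section \<open>The degenerate affine periplectic Brauer algebra\<close>

inductive_set relations :: "nat \<Rightarrow> (free_alg \<times> free_alg) set" for n :: nat where
  ss: "\<lbrakk>1 \<le> i; i < n\<rbrakk> \<Longrightarrow> (free_s i * free_s i, 1) \<in> relations n"
| ss_comm: "\<lbrakk>1 \<le> i; i < n; 1 \<le> j; j < n; \<bar>int i - int j\<bar> > 1\<rbrakk> \<Longrightarrow>
    (free_s i * free_s j, free_s j * free_s i) \<in> relations n"
| se_comm: "\<lbrakk>1 \<le> i; i < n; 1 \<le> j; j < n; \<bar>int i - int j\<bar> > 1\<rbrakk> \<Longrightarrow>
    (free_s i * free_e j, free_e j * free_s i) \<in> relations n"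
| ee_comm: "\<lbrakk>1 \<le> i; i < n; 1 \<le> j; j < n; \<bar>int i - int j\<bar> > 1\<rbrakk> \<Longrightarrow>
    (free_e i * free_e j, free_e j * free_e i) \<in> relations n"
| braid: "\<lbrakk>1 \<le> i; i + 1 < n\<rbrakk> \<Longrightarrow>
    (free_s i * free_s (i+1) * free_s i, free_s (i+1) * free_s i * free_s (i+1)) \<in> relations n"
| yy_comm: "\<lbrakk>1 \<le> i; i \<le> n; 1 \<le> j; j \<le> n\<rbrakk> \<Longrightarrow>
    (free_y i * free_y j, free_y j * free_y i) \<in> relations n"
| ey_comm: "\<lbrakk>1 \<le> i; i < n; 1 \<le> j; j \<le> n; j \<noteq> i; j \<noteq> i + 1\<rbrakk> \<Longrightarrow>
    (free_e i * free_y j, free_y j * free_e i) \<in> relations n"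
| sy_comm: "\<lbrakk>1 \<le> i; i < n; 1 \<le> j; j \<le> n; j \<noteq> i; j \<noteq> i + 1\<rbrakk> \<Longrightarrow>
    (free_s i * free_y j, free_y j * free_s i) \<in> relations n"
| eee_up: "\<lbrakk>1 \<le> i; i + 1 < n\<rbrakk> \<Longrightarrow>
    (free_e (i+1) * free_e i * free_e (i+1), - free_e (i+1)) \<in> relations n"
| eee_down: "\<lbrakk>1 \<le> i; i + 1 < n\<rbrakk> \<Longrightarrow>
    (free_e i * free_e (i+1) * free_e i, - free_e i) \<in> relations n"
| es: "\<lbrakk>1 \<le> i; i < n\<rbrakk> \<Longrightarrow> (free_e i * free_s i, free_e i) \<in> relations n"
| se: "\<lbrakk>1 \<le> i; i < n\<rbrakk> \<Longrightarrow> (free_s i * free_e i, - free_e i) \<in> relations n"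
| see_down: "\<lbrakk>1 \<le> i; i + 1 < n\<rbrakk> \<Longrightarrow>
    (free_s i * free_e (i+1) * free_e i, free_s (i+1) * free_e i) \<in> relations n"
| see_up: "\<lbrakk>1 \<le> i; i + 1 < n\<rbrakk> \<Longrightarrow>
    (free_s (i+1) * free_e i * free_e (i+1), - (free_s i * free_e (i+1))) \<in> relations n"
| ees_up: "\<lbrakk>1 \<le> i; i + 1 < n\<rbrakk> \<Longrightarrow>
    (free_e (i+1) * free_e i * free_s (i+1), free_e (i+1) * free_s i) \<in> relations n"
| ees_down: "\<lbrakk>1 \<le> i; i + 1 < n\<rbrakk> \<Longrightarrow>
    (free_e i * free_e (i+1) * free_s i, - (free_e i * free_s (i+1))) \<in> relations n"
| ee: "\<lbrakk>1 \<le> i; i < n\<rbrakk> \<Longrightarrow> (free_e i * free_e i, 0) \<in> relations n"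
| sy: "\<lbrakk>1 \<le> i; i < n\<rbrakk> \<Longrightarrow>
    (free_s i * free_y i - free_y (i+1) * free_s i, - free_e i - 1) \<in> relations n"
| ys: "\<lbrakk>1 \<le> i; i < n\<rbrakk> \<Longrightarrow>
    (free_y i * free_s i - free_s i * free_y (i+1), free_e i - 1) \<in> relations n"
| ey: "\<lbrakk>1 \<le> i; i < n\<rbrakk> \<Longrightarrow>
    (free_e i * (free_y i - free_y (i+1)), - free_e i) \<in> relations n"
| ye: "\<lbrakk>1 \<le> i; i < n\<rbrakk> \<Longrightarrow>
    ((free_y i - free_y (i+1)) * free_e i, free_e i) \<in> relations n"

definition relation_ideal :: "nat \<Rightarrow> free_alg set" where
  "relation_ideal n = Idl\<^bsub>free_algebra n\<^esub> {l - r | l r. (l, r) \<in> relations n}"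

definition VV :: "nat \<Rightarrow> free_alg set ring" where
  "VV n = free_algebra n Quot relation_ideal n"

definition VV_class :: "nat \<Rightarrow> free_alg \<Rightarrow> free_alg set" where
  "VV_class n f = relation_ideal n +>\<^bsub>free_algebra n\<^esub> f"

text \<open>The product in \<open>VV n\<close> of the generators listed in \<open>w\<close>, from left to right:\<close>

definition VV_word :: "nat \<Rightarrow> gen list \<Rightarrow> free_alg set" where
  "VV_word n w = VV_class n (free_word w)"

definition VV_scalar :: "nat \<Rightarrow> complex \<Rightarrow> free_alg set" where
  "VV_scalar n c = VV_class n (Poly_Mapping.single 0 c)"

definition linear_combinations :: "nat \<Rightarrow> free_alg set set \<Rightarrow> free_alg set set" where
  "linear_combinations n N =
     {finsum (VV n) (\<lambda>x. VV_scalar n (c x) \<otimes>\<^bsub>VV n\<^esub> x) F | F c. finite F \<and> F \<subseteq> N}"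


section \<open>Brauer diagrams\<close>

datatype point = Top nat | Bot nat

definition points :: "nat \<Rightarrow> point set" where
  "points n = Top ` {1..n} \<union> Bot ` {1..n}"

definition brauer_diagram :: "nat \<Rightarrow> point set set \<Rightarrow> bool" where
  "brauer_diagram n d \<longleftrightarrow> partition_on (points n) d \<and> (\<forall>b\<in>d. card b = 2)"

definition through_strands :: "point set set \<Rightarrow> point set set" where
  "through_strands d = {b \<in> d. \<exists>i j. b = {Bot i, Top j}}"

definition verticals :: "nat set \<Rightarrow> point set set" where
  "verticals J = (\<lambda>j. {Bot j, Top j}) ` J"

definition id_diagram :: "nat \<Rightarrow> point set set" where
  "id_diagram n = verticals {1..n}"

definition cross_diagram :: "nat \<Rightarrow> nat \<Rightarrow> point set set" where
  "cross_diagram n i =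
     {{Bot i, Top (i+1)}, {Bot (i+1), Top i}} \<union> verticals ({1..n} - {i, i+1})"

definition cupcap_diagram :: "nat \<Rightarrow> nat \<Rightarrow> point set set" where
  "cupcap_diagram n i =
     {{Top i, Top (i+1)}, {Bot i, Bot (i+1)}} \<union> verticals ({1..n} - {i, i+1})"

text \<open>
  Stacking \<open>a\<close> on top of \<open>b\<close> gives a graph on three lines of points, in which the bottom
  line of \<open>a\<close> is identified with the top line of \<open>b\<close>. Two outer points are joined in the
  stacked diagram iff they lie in the same connected component, and a closed loop is a
  component consisting of middle points only.
\<close>

datatype vertex = Upper nat | Middle nat | Lower nat

fun place_above :: "point \<Rightarrow> vertex" where
  "place_above (Top j) = Upper j"
| "place_above (Bot j) = Middle j"

fun place_below :: "point \<Rightarrow> vertex" where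
  "place_below (Top j) = Middle j"
| "place_below (Bot j) = Lower j"

fun place_outer :: "point \<Rightarrow> vertex" where
  "place_outer (Top j) = Upper j"
| "place_outer (Bot j) = Lower j"

definition stack_edges :: "point set set \<Rightarrow> point set set \<Rightarrow> (vertex \<times> vertex) set" where
  "stack_edges a b =
     {(place_above u, place_above v) | u v. {u, v} \<in> a} \<union>
     {(place_below u, place_below v) | u v. {u, v} \<in> b}"

definition stack :: "nat \<Rightarrow> point set set \<Rightarrow> point set set \<Rightarrow> point set set" where
  "stack n a b =
     {{u, v} | u v. u \<in> points n \<and> v \<in> points n \<and> u \<noteq> v \<and>
        (place_outer u, place_outer v) \<in> (stack_edges a b)\<^sup>*}"

definition loop_free :: "nat \<Rightarrow> point set set \<Rightarrow> point set set \<Rightarrow> bool" where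
  "loop_free n a b \<longleftrightarrow>
     (\<forall>j\<in>{1..n}. \<exists>u\<in>points n. (Middle j, place_outer u) \<in> (stack_edges a b)\<^sup>*)"

text \<open>
  \<open>word_diagram n w d\<close>: the word \<open>w\<close> uses only crossings and cup-caps, and stacking the
  corresponding diagrams gives \<open>d\<close> without any closed loop arising.
\<close>

inductive word_diagram :: "nat \<Rightarrow> gen list \<Rightarrow> point set set \<Rightarrow> bool" for n :: nat where
  empty: "word_diagram n [] (id_diagram n)"
| cross: "\<lbrakk>1 \<le> i; i < n; word_diagram n w d; loop_free n (cross_diagram n i) d\<rbrakk> \<Longrightarrow>
    word_diagram n (Cross i # w) (stack n (cross_diagram n i) d)"
| cupcap: "\<lbrakk>1 \<le> i; i < n; word_diagram n w d; loop_free n (cupcap_diagram n i) d\<rbrakk> \<Longrightarrow>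
    word_diagram n (CupCap i # w) (stack n (cupcap_diagram n i) d)"

definition monomial_choice :: "nat \<Rightarrow> (point set set \<Rightarrow> gen list) \<Rightarrow> bool" where
  "monomial_choice n m \<longleftrightarrow> (\<forall>d. brauer_diagram n d \<longrightarrow> word_diagram n (m d) d)"


section \<open>Normal diagrams\<close>

definition top_dot_allowed :: "point set set \<Rightarrow> nat \<Rightarrow> bool" where
  "top_dot_allowed d j \<longleftrightarrow>
     (\<exists>i<j. {Top i, Top j} \<in> d) \<or> (\<exists>i. {Bot i, Top j} \<in> d)"

definition bot_dot_allowed :: "point set set \<Rightarrow> nat \<Rightarrow> bool" where
  "bot_dot_allowed d j \<longleftrightarrow> (\<exists>k>j. {Bot j, Bot k} \<in> d)"

definition dots :: "nat \<Rightarrow> (nat \<Rightarrow> nat) \<Rightarrow> gen list" where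
  "dots n a = concat (map (\<lambda>j. replicate (a j) (Dot j)) [1..<n+1])"

text \<open>The normal diagrams with at most \<open>k\<close> through strands, for the monomials fixed by \<open>m\<close>:\<close>

definition normal_diagrams ::
    "nat \<Rightarrow> (point set set \<Rightarrow> gen list) \<Rightarrow> nat \<Rightarrow> free_alg set set" where
  "normal_diagrams n m k =
     {VV_word n (dots n a @ m d @ dots n b) | a d b.
        brauer_diagram n d \<and> card (through_strands d) \<le> k \<and>
        (\<forall>j\<in>{1..n}. \<not> top_dot_allowed d j \<longrightarrow> a j = 0) \<and>
        (\<forall>j\<in>{1..n}. \<not> bot_dot_allowed d j \<longrightarrow> b j = 0)}"


section \<open>The chain of ideals\<close>

definition e_product :: "nat \<Rightarrow> nat list \<Rightarrow> free_alg set" where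
  "e_product n js = VV_word n (map CupCap js)"

definition odd_e_product :: "nat \<Rightarrow> nat \<Rightarrow> free_alg set" where
  "odd_e_product n r = e_product n (map (\<lambda>k. 2 * k + 1) [0..<r])"

definition II :: "nat \<Rightarrow> nat \<Rightarrow> free_alg set set" where
  "II n r =
     (if r = 0 then carrier (VV n)
      else if r \<le> n div 2 then Idl\<^bsub>VV n\<^esub> {odd_e_product n r}
      else {\<zero>\<^bsub>VV n\<^esub>})"


section \<open>Well-definedness\<close>

lemma free_algebra_simps [simp]:
  "f \<otimes>\<^bsub>free_algebra n\<^esub> g = f * g" "\<one>\<^bsub>free_algebra n\<^esub> = 1"
  "f \<oplus>\<^bsub>free_algebra n\<^esub> g = f + g" "\<zero>\<^bsub>free_algebra n\<^esub> = 0"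
  by (simp_all add: free_algebra_def)

lemma carrier_free_algebra:
  "f \<in> carrier (free_algebra n) \<longleftrightarrow>
     (\<forall>w \<in> Poly_Mapping.keys f. \<forall>g \<in> set (letters w). gen_ok n g)"
  by (simp add: free_algebra_def)

lemma free_add_closed:
  "\<lbrakk>f \<in> carrier (free_algebra n); g \<in> carrier (free_algebra n)\<rbrakk> \<Longrightarrow>
     f + g \<in> carrier (free_algebra n)"
  using keys_add[of f g] by (auto simp: carrier_free_algebra)

lemma free_minus_closed:
  "f \<in> carrier (free_algebra n) \<Longrightarrow> - f \<in> carrier (free_algebra n)"
  by (simp add: carrier_free_algebra)

lemma free_diff_closed:
  "\<lbrakk>f \<in> carrier (free_algebra n); g \<in> carrier (free_algebra n)\<rbrakk> \<Longrightarrow>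
     f - g \<in> carrier (free_algebra n)"
  using keys_diff[of f g] by (auto simp: carrier_free_algebra)

lemma free_mult_closed:
  assumes "f \<in> carrier (free_algebra n)" and "g \<in> carrier (free_algebra n)"
  shows "f * g \<in> carrier (free_algebra n)"
  unfolding carrier_free_algebra
proof (intro ballI)
  fix w x assume "w \<in> Poly_Mapping.keys (f * g)" and x: "x \<in> set (letters w)"
  then obtain u v where uv: "u \<in> Poly_Mapping.keys f" "v \<in> Poly_Mapping.keys g" "w = u + v"
    using keys_mult[of f g] by blast
  then have "x \<in> set (letters u) \<or> x \<in> set (letters v)"
    using x by (simp add: plus_word_def)
  then show "gen_ok n x"
    using assms uv unfolding carrier_free_algebra by blast
qed

lemma free_zero_closed: "0 \<in> carrier (free_algebra n)"
  by (simp add: carrier_free_algebra)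

lemma free_single_closed:
  "\<forall>g \<in> set (letters w). gen_ok n g \<Longrightarrow> Poly_Mapping.single w c \<in> carrier (free_algebra n)"
  by (auto simp: carrier_free_algebra split: if_splits)

lemma free_one_closed: "1 \<in> carrier (free_algebra n)"
  by (simp add: carrier_free_algebra zero_word_def)

lemma free_word_closed:
  "\<forall>g \<in> set w. gen_ok n g \<Longrightarrow> free_word w \<in> carrier (free_algebra n)"
  unfolding free_word_def by (rule free_single_closed) simp

lemma ring_free_algebra: "ring (free_algebra n)"
proof (rule ringI)
  show "abelian_group (free_algebra n)"
  proof (rule abelian_groupI)
    fix x assume "x \<in> carrier (free_algebra n)"
    then show "\<exists>y\<in>carrier (free_algebra n). y \<oplus>\<^bsub>free_algebra n\<^esub> x = \<zero>\<^bsub>free_algebra n\<^esub>"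
      by (intro bexI[of _ "- x"]) (simp_all add: free_minus_closed)
  qed (simp_all add: free_add_closed free_zero_closed add_ac)
  show "monoid (free_algebra n)"
    by (rule monoidI) (simp_all add: free_mult_closed free_one_closed mult.assoc)
qed (simp_all add: distrib_left distrib_right)

lemma relations_closed:
  "(l, r) \<in> relations n \<Longrightarrow> l \<in> carrier (free_algebra n) \<and> r \<in> carrier (free_algebra n)"
  by (erule relations.cases)
    (auto intro!: free_mult_closed free_minus_closed free_diff_closed free_zero_closed
      free_one_closed free_word_closed)

lemma ideal_relation_ideal: "ideal (relation_ideal n) (free_algebra n)"
  unfolding relation_ideal_def
  by (rule ring.genideal_ideal[OF ring_free_algebra])
    (use relations_closed free_diff_closed in blast)

lemma ring_VV: "ring (VV n)"
  unfolding VV_def by (rule ideal.quotient_is_ring[OF ideal_relation_ideal])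

lemma VV_class_hom: "VV_class n \<in> ring_hom (free_algebra n) (VV n)"
  using ideal.rcos_ring_hom[OF ideal_relation_ideal, of n]
  by (simp add: VV_def VV_class_def[abs_def])

lemma VV_word_closed: "\<forall>g \<in> set w. gen_ok n g \<Longrightarrow> VV_word n w \<in> carrier (VV n)"
  unfolding VV_word_def by (rule ring_hom_closed[OF VV_class_hom free_word_closed])

lemma VV_word_append:
  assumes "\<forall>g \<in> set u. gen_ok n g" and "\<forall>g \<in> set v. gen_ok n g"
  shows "VV_word n (u @ v) = VV_word n u \<otimes>\<^bsub>VV n\<^esub> VV_word n v"
proof -
  have "free_word (u @ v) = free_word u \<otimes>\<^bsub>free_algebra n\<^esub> free_word v"
    by (simp add: free_word_def mult_single plus_word_def)
  moreover have "VV_class n (free_word u \<otimes>\<^bsub>free_algebra n\<^esub> free_word v) =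
      VV_class n (free_word u) \<otimes>\<^bsub>VV n\<^esub> VV_class n (free_word v)"
    by (rule ring_hom_mult[OF VV_class_hom free_word_closed free_word_closed]) (use assms in auto)
  ultimately show ?thesis
    unfolding VV_word_def by simp
qed

end

theory Submission
  imports Defs "HOL-Combinatorics.Permutations"
begin

text \<open>
  Up to sign, words in the \<open>s\<^sub>i\<close> and \<open>e\<^sub>i\<close> obey relations symmetric under reversal. With
  \<open>E\<^sub>r = e\<^sub>1 e\<^sub>3 \<cdots> e\<^sub>2\<^sub>r\<^sub>-\<^sub>1\<close>, each such word is zero or \<open>\<plusminus> \<sigma> E\<^sub>r \<tau>\<close> for permutations \<open>\<sigma>\<close>, \<open>\<tau>\<close>: multiplying by
  \<open>e\<^sub>i\<close> produces a loop, permutes the strands, or raises \<open>r\<close> by one. The diagram of \<open>\<sigma> E\<^sub>r \<tau>\<close>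
  determines this element up to sign, so a word without loops depends, up to sign, only on
  its diagram.

  A dot slides along a strand modulo words with at least as many cups and fewer dots, and
  \<open>e\<^sub>i f e\<^sub>i = 0\<close> for every polynomial \<open>f\<close> in the dots. Hence the span of all
  \<open>f \<sigma> E\<^sub>q \<tau> g\<close> with \<open>q \<ge> r\<close> is a two-sided ideal, and its elements reduce to normal diagrams.

  For strictness, the algebra acts on the \<open>n\<close>-th tensor power of a superspace of dimension
  \<open>1|1\<close>, the dots acting by Jucys-Murphy elements. On the part of weight \<open>n - 2r\<close> the
  element \<open>E\<^sub>r\<^sub>+\<^sub>1\<close> acts by zero, since it requires \<open>r + 1\<close> cancelling pairs, while \<open>E\<^sub>r\<close> does not.
\<close>

section \<open>Words in the crossings and permutations\<close>

text \<open>Signs are the obstacle. The relations are not symmetric under reversal if signs are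
  kept: \<open>e_i s_i = e_i\<close> but \<open>s_i e_i = - e_i\<close>. Spans and ideals do not see
  a sign, so words are compared only up to sign, and a separate predicate \<open>Z\<close> records
  the words that vanish. For dots this is too coarse, because differences of words occur; there the
  sign common to both terms of a difference is factored out. The delicate product is
  \<open>e_i f t\<close>, where \<open>f\<close> consists of dots and \<open>t\<close> is free of
  dots. A dot of \<open>f\<close> away from \<open>i\<close> and \<open>i + 1\<close> passes
  \<open>e_i\<close>, and one at \<open>i\<close> is slid along its strand in \<open>t\<close>. It
  comes back to \<open>e_i\<close> only if this strand is a cup joining \<open>i\<close> and
  \<open>i + 1\<close>; but then \<open>t\<close> begins with \<open>e_i\<close> up to sign, and
  \<open>e_i f e_i = 0\<close> applies. The Jucys-Murphy elements are forced: once
  \<open>y_1\<close> acts by 0, the relation between \<open>s_i\<close>, \<open>y_i\<close> and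
  \<open>y_(i+1)\<close> determines all other dots.\<close>

declare One_nat_def [simp del]

abbreviation pinv :: "(nat \<Rightarrow> nat) \<Rightarrow> nat \<Rightarrow> nat" where "pinv \<equiv> inv_into UNIV"

text \<open>The bound \<open>m\<close> is kept apart from the size \<open>n\<close> of the algebra,
  so that inductions can run along the chain of symmetric groups on \<open>{1..m}\<close>.\<close>

definition cross_word :: "nat \<Rightarrow> gen list \<Rightarrow> bool" where
  "cross_word m u \<longleftrightarrow> (\<forall>g\<in>set u. \<exists>i. g = Cross i \<and> 1 \<le> i \<and> i < m)"

fun gen_perm :: "gen \<Rightarrow> nat \<Rightarrow> nat" where
  "gen_perm (Cross i) = transpose i (i + 1)"
| "gen_perm _ = id"

fun word_perm :: "gen list \<Rightarrow> nat \<Rightarrow> nat" where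
  "word_perm [] = id"
| "word_perm (g # w) = gen_perm g \<circ> word_perm w"

lemma word_perm_append [simp]: "word_perm (u @ v) = word_perm u \<circ> word_perm v"
  by (induction u) auto

text \<open>The cycle that sends \<open>m\<close> to \<open>k\<close> and raises the points from
  \<open>k\<close> to \<open>m - 1\<close> by one. For varying \<open>k\<close> these cycles
  represent the left cosets of the symmetric group on \<open>{1..m-1}\<close> in the one on
  \<open>{1..m}\<close>.\<close>

definition ups :: "nat \<Rightarrow> nat \<Rightarrow> gen list" where
  "ups k m = map Cross [k..<m]"

lemma cross_word_simps [simp]:
  "cross_word m []"
  "cross_word m (g # u) \<longleftrightarrow> (\<exists>i. g = Cross i \<and> 1 \<le> i \<and> i < m) \<and> cross_word m u"
  "cross_word m (u @ v) \<longleftrightarrow> cross_word m u \<and> cross_word m v"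
  "cross_word m (rev u) \<longleftrightarrow> cross_word m u"
  by (auto simp: cross_word_def)

lemma cross_word_mono: "cross_word m u \<Longrightarrow> m \<le> m' \<Longrightarrow> cross_word m' u"
  by (fastforce simp: cross_word_def)

lemma cross_word_ups: "1 \<le> k \<Longrightarrow> cross_word m (ups k m)"
  by (auto simp: cross_word_def ups_def)

lemma ups_simps: "ups m m = []" "k < m \<Longrightarrow> ups k m = Cross k # ups (k + 1) m"
  by (auto simp: ups_def upt_conv_Cons One_nat_def)

lemma ups_append: "k \<le> l \<Longrightarrow> l \<le> m \<Longrightarrow> ups k m = ups k l @ ups l m"
  unfolding ups_def by (metis le_Suc_ex map_append upt_add_eq_append)

lemma word_perm_permutes: "cross_word m u \<Longrightarrow> word_perm u permutes {1..m}"
proof (induction u)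
  case (Cons g u)
  then obtain i where "g = Cross i" "1 \<le> i" "i < m" by auto
  then show ?case using Cons
    using permutes_compose[of "word_perm u" "{1..m}" "transpose i (i + 1)"]
    by (auto simp: permutes_swap_id comp_def)
qed (simp add: permutes_id)

lemma word_perm_ups:
  "k \<le> m \<Longrightarrow> word_perm (ups k m) j = (if j = m then k else if k \<le> j \<and> j < m then j + 1 else j)"
proof (induction "m - k" arbitrary: k)
  case (Suc d)
  then have "k < m" by simp
  then show ?case using Suc(1)[of "k + 1"] Suc(2) by (auto simp: ups_simps transpose_def)
qed (auto simp: ups_simps)

lemma word_perm_rev:
  "cross_word m u \<Longrightarrow> word_perm (rev u) \<circ> word_perm u = id"
  "cross_word m u \<Longrightarrow> word_perm u \<circ> word_perm (rev u) = id"
proof (induction u)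
  case (Cons g u)
  { case 1 with Cons obtain i where g: "g = Cross i" "1 \<le> i" "i < m" and c: "cross_word m u" by auto
    have "word_perm (rev (g # u)) \<circ> word_perm (g # u)
        = word_perm (rev u) \<circ> (gen_perm g \<circ> gen_perm g) \<circ> word_perm u"
      by (simp add: comp_assoc)
    also have "\<dots> = id" using Cons.IH(1)[OF c] g by (simp add: comp_def fun_eq_iff)
    finally show ?case .
  }
  { case 2 with Cons obtain i where g: "g = Cross i" "1 \<le> i" "i < m" and c: "cross_word m u" by auto
    have "word_perm (g # u) \<circ> word_perm (rev (g # u))
        = gen_perm g \<circ> (word_perm u \<circ> word_perm (rev u)) \<circ> gen_perm g"
      by (simp add: comp_assoc)
    also have "\<dots> = id" using Cons.IH(2)[OF c] g by (simp add: comp_def fun_eq_iff)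
    finally show ?case .
  }
qed simp_all

text \<open>Divided by the cycle \<open>ups\<close> that sends the largest point to its image, a
  permutation fixes that point, and induction applies.\<close>

lemma ex_cross_word: "\<pi> permutes {1..m} \<Longrightarrow> \<exists>u. cross_word m u \<and> word_perm u = \<pi>"
proof (induction m arbitrary: \<pi>)
  case 0
  then show ?case by (intro exI[of _ "[]"]) auto
next
  case (Suc m)
  let ?k = "\<pi> (Suc m)"
  let ?c = "word_perm (ups ?k (Suc m))"
  have k: "1 \<le> ?k" "?k \<le> Suc m" using permutes_in_image[OF Suc.prems, of "Suc m"] by auto
  have c: "?c permutes {1..Suc m}" by (rule word_perm_permutes[OF cross_word_ups[OF k(1)]])
  have cm: "?c (Suc m) = ?k" using word_perm_ups[OF k(2)] by simp
  have "pinv ?c \<circ> \<pi> permutes {1..Suc m}"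
    using permutes_compose[OF Suc.prems permutes_inv[OF c]] .
  moreover have "(pinv ?c \<circ> \<pi>) (Suc m) = Suc m"
    using cm permutes_inverses(2)[OF c] by (metis comp_apply)
  ultimately have "pinv ?c \<circ> \<pi> permutes {1..m}"
    by (auto intro: permutes_superset simp: le_Suc_eq)
  then obtain v where v: "cross_word m v" "word_perm v = pinv ?c \<circ> \<pi>" using Suc.IH by blast
  have "word_perm (ups ?k (Suc m) @ v) = \<pi>"
    using v permutes_inv_o(1)[OF c] by (simp add: comp_assoc[symmetric])
  moreover have "cross_word (Suc m) (ups ?k (Suc m) @ v)"
    using v k cross_word_mono[of m v "Suc m"] cross_word_ups by auto
  ultimately show ?case by blast
qed

text \<open>Source of all auxiliary permutations below: a few strands are prescribed, and the
  remaining ones are filled in arbitrarily.\<close>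

lemma permutes_extend:
  assumes "finite S" "A \<subseteq> S" "inj_on f A" "f ` A \<subseteq> S"
  shows "\<exists>\<rho>. \<rho> permutes S \<and> (\<forall>x\<in>A. \<rho> x = f x)"
proof -
  have "card (S - A) = card (S - f ` A)"
    using assms by (simp add: card_Diff_subset finite_subset card_image)
  then obtain g where g: "bij_betw g (S - A) (S - f ` A)"
    using assms(1) finite_same_card_bij by blast
  let ?\<rho> = "\<lambda>x. if x \<in> A then f x else if x \<in> S then g x else x"
  have "bij_betw ?\<rho> A (f ` A)" using assms(3) by (auto simp: bij_betw_def inj_on_def)
  moreover have "bij_betw ?\<rho> (S - A) (S - f ` A)"
    using g by (rule iffD1[OF bij_betw_cong, rotated]) auto
  ultimately have "bij_betw ?\<rho> (A \<union> (S - A)) (f ` A \<union> (S - f ` A))"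
    by (rule bij_betw_combine) auto
  then have "bij_betw ?\<rho> S S" using assms by (simp add: Un_absorb1)
  then have "?\<rho> permutes S" using assms(2) by (auto intro!: bij_imp_permutes)
  then show ?thesis by (intro exI[of _ ?\<rho>]) auto
qed

section \<open>Congruences on words and the Coxeter presentation of the symmetric group\<close>

locale word_congruence =
  fixes eqv :: "gen list \<Rightarrow> gen list \<Rightarrow> bool" (infix "\<approx>" 50)
  assumes refl [simp, intro]: "u \<approx> u"
    and sym: "u \<approx> v \<Longrightarrow> v \<approx> u"
    and trans [trans]: "u \<approx> v \<Longrightarrow> v \<approx> w \<Longrightarrow> u \<approx> w"
    and cong: "u \<approx> v \<Longrightarrow> a @ u @ b \<approx> a @ v @ b"
begin

lemma cong_append: "u \<approx> u' \<Longrightarrow> v \<approx> v' \<Longrightarrow> u @ v \<approx> u' @ v'"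
  using cong[of u u' "[]" v] cong[of v v' u' "[]"] by (auto intro: trans)

lemma cong_left: "u \<approx> v \<Longrightarrow> a @ u \<approx> a @ v"
  by (rule cong_append) auto

lemma cong_right: "u \<approx> v \<Longrightarrow> u @ b \<approx> v @ b"
  by (rule cong_append) auto

lemma cong_Cons: "u \<approx> v \<Longrightarrow> g # u \<approx> g # v"
  using cong_left[of u v "[g]"] by simp

lemma commute_word: "(\<And>g. g \<in> set w \<Longrightarrow> [x, g] \<approx> [g, x]) \<Longrightarrow> x # w \<approx> w @ [x]"
proof (induction w)
  case (Cons g w)
  have "x # g # w \<approx> g # x # w" using cong_right[OF Cons.prems[of g], of w] by simp
  also have "\<dots> \<approx> g # w @ [x]" using Cons by (auto intro: cong_Cons)
  finally show ?case by simp
qed simp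

end

text \<open>The congruence is a parameter because the lemmas are applied to several relations:
  equality up to sign in the algebra, its mirror image under reversal, and the conjunction of a
  congruence with equality of permutations.\<close>

locale coxeter_words = word_congruence +
  fixes n :: nat
  assumes ss: "1 \<le> i \<Longrightarrow> i < n \<Longrightarrow> [Cross i, Cross i] \<approx> []"
    and ss_comm: "1 \<le> i \<Longrightarrow> i + 1 < j \<Longrightarrow> j < n \<Longrightarrow> [Cross i, Cross j] \<approx> [Cross j, Cross i]"
    and braid: "1 \<le> i \<Longrightarrow> i + 1 < n \<Longrightarrow>
      [Cross i, Cross (i + 1), Cross i] \<approx> [Cross (i + 1), Cross i, Cross (i + 1)]"
begin

lemma cross_cancel: "1 \<le> i \<Longrightarrow> i < n \<Longrightarrow> Cross i # Cross i # w \<approx> w"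
  using cong_right[OF ss, of i w] by simp

lemma cross_rev: "cross_word n u \<Longrightarrow> u @ rev u \<approx> []" "cross_word n u \<Longrightarrow> rev u @ u \<approx> []"
proof (induction u)
  case (Cons g u)
  { case 1 with Cons obtain i where g: "g = Cross i" "1 \<le> i" "i < n" and c: "cross_word n u" by auto
    have "[g] @ (u @ rev u) @ [g] \<approx> [g] @ [] @ [g]" using Cons.IH(1)[OF c] by (rule cong)
    with g ss show ?case by (auto intro: trans) }
  { case 2 with Cons obtain i where g: "g = Cross i" "1 \<le> i" "i < n" and c: "cross_word n u" by auto
    have "rev u @ [g, g] @ u \<approx> rev u @ [] @ u" using g ss by (intro cong) auto
    with Cons.IH(2)[OF c] show ?case by (auto intro: trans) }
qed auto

text \<open>The letter \<open>s_i\<close> commutes with the letters of the cycle below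
  \<open>i - 1\<close>; one braid move on \<open>s_(i-1) s_i\<close> then turns it into
  \<open>s_(i-1)\<close>, which commutes with the remaining letters.\<close>

lemma cross_ups_shift:
  assumes "1 \<le> k" "k < i" "i < m" "m \<le> n"
  shows "Cross i # ups k m \<approx> ups k m @ [Cross (i - 1)]"
proof -
  obtain j where j: "i = j + 1" "k \<le> j" using assms by (cases i) auto
  have split: "ups k m = ups k j @ [Cross j, Cross (j + 1)] @ ups (j + 2) m"
    using j assms ups_append[of k j m] ups_simps(2)[of j m] ups_simps(2)[of "j + 1" m] by (simp add: One_nat_def)
  have "Cross i # ups k j \<approx> ups k j @ [Cross i]"
    using assms j by (intro commute_word) (auto simp: ups_def intro!: sym[OF ss_comm])
  from cong_right[OF this, of "[Cross j, Cross (j + 1)] @ ups (j + 2) m"]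
  have "Cross i # ups k m \<approx> ups k j @ [Cross (j + 1), Cross j, Cross (j + 1)] @ ups (j + 2) m"
    using split j by simp
  also have "\<dots> \<approx> ups k j @ [Cross j, Cross (j + 1), Cross j] @ ups (j + 2) m"
    using assms j by (intro cong sym[OF braid]) auto
  also have "\<dots> = (ups k j @ [Cross j, Cross (j + 1)]) @ (Cross j # ups (j + 2) m)" by simp
  also have "\<dots> \<approx> (ups k j @ [Cross j, Cross (j + 1)]) @ (ups (j + 2) m @ [Cross j])"
    using assms j by (intro cong_left commute_word) (auto simp: ups_def intro!: ss_comm)
  also have "\<dots> = ups k m @ [Cross (i - 1)]" using split j by simp
  finally show ?thesis .
qed

text \<open>Coset enumeration. Multiplied by \<open>s_i\<close> from the left, the representative
  \<open>ups k m\<close> becomes \<open>ups (k - 1) m\<close> or \<open>ups (k + 1) m\<close>, or it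
  stays and \<open>s_i\<close> or \<open>s_(i-1)\<close> comes out on its right, as a generator of
  the smaller group.\<close>

lemma cross_sweep:
  assumes "cross_word m u" "1 \<le> m" "m \<le> n"
  shows "\<exists>k v. 1 \<le> k \<and> k \<le> m \<and> cross_word (m - 1) v \<and> u \<approx> ups k m @ v"
  using assms(1)
proof (induction u)
  case Nil
  then show ?case using assms by (intro exI[of _ m] exI[of _ "[]"]) (simp add: ups_simps)
next
  case (Cons g u)
  then obtain i where g: "g = Cross i" "1 \<le> i" "i < m" by auto
  from Cons obtain k v where kv: "1 \<le> k" "k \<le> m" "cross_word (m - 1) v" "u \<approx> ups k m @ v" by auto
  have u: "g # u \<approx> Cross i # ups k m @ v" using kv g by (auto intro: cong_Cons)
  consider "i + 1 < k" | "i + 1 = k" | "i = k" | "k < i" by linarith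
  then show ?case
  proof cases
    case 1
    have "Cross i # ups k m \<approx> ups k m @ [Cross i]"
      using 1 g assms by (intro commute_word) (auto simp: ups_def intro!: ss_comm)
    from cong_right[OF this, of v] have "g # u \<approx> ups k m @ (Cross i # v)" using u trans by simp
    then show ?thesis using kv g 1 by (intro exI[of _ k] exI[of _ "Cross i # v"]) auto
  next
    case 2
    have "g # u \<approx> ups i m @ v" using u ups_simps(2)[OF g(3)] 2 by simp
    with kv(3) g(2,3) show ?thesis by (metis less_imp_le)
  next
    case 3
    have "Cross k # Cross k # ups (k + 1) m @ v \<approx> ups (k + 1) m @ v"
      using 3 g assms kv by (intro cross_cancel) auto
    then have "g # u \<approx> ups (k + 1) m @ v"
      using trans[OF u] ups_simps(2)[of k m] 3 g by simp
    moreover have "1 \<le> k + 1" "k + 1 \<le> m" using 3 g by auto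
    ultimately show ?thesis using kv(3) by blast
  next
    case 4
    have "g # u \<approx> ups k m @ (Cross (i - 1) # v)"
      using trans[OF u] cong_right[OF cross_ups_shift[of k i m], of v] 4 kv g assms by simp
    then show ?thesis using kv g 4 by (intro exI[of _ k] exI[of _ "Cross (i - 1) # v"]) auto
  qed
qed

text \<open>Permutations satisfy the Coxeter relations too, so the conjunction is again an instance.
  Everything shown for the congruence thus comes with the matching equation of permutations, without
  a second induction.\<close>

lemma coxeter_words_perm: "coxeter_words (\<lambda>u v. u \<approx> v \<and> word_perm u = word_perm v) n"
proof unfold_locales
  fix i assume "1 \<le> i" "i < n"
  then show "[Cross i, Cross i] \<approx> [] \<and> word_perm [Cross i, Cross i] = word_perm []"
    using ss by simp
next
  fix i j assume *: "1 \<le> i" "i + 1 < j" "j < n"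
  then show "[Cross i, Cross j] \<approx> [Cross j, Cross i]
      \<and> word_perm [Cross i, Cross j] = word_perm [Cross j, Cross i]"
    using ss_comm[OF *] by (auto simp: transpose_def fun_eq_iff)
next
  fix i assume *: "1 \<le> i" "i + 1 < n"
  then show "[Cross i, Cross (i + 1), Cross i] \<approx> [Cross (i + 1), Cross i, Cross (i + 1)]
     \<and> word_perm [Cross i, Cross (i + 1), Cross i] = word_perm [Cross (i + 1), Cross i, Cross (i + 1)]"
    using braid[OF *] by (auto simp: transpose_def fun_eq_iff)
qed (auto intro: sym trans cong)

lemma cross_sweep_perm:
  assumes "cross_word m u" "1 \<le> m" "m \<le> n"
  obtains k v where "1 \<le> k" "k \<le> m" "cross_word (m - 1) v" "u \<approx> ups k m @ v"
    "word_perm u = word_perm (ups k m) \<circ> word_perm v" "word_perm u m = k"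
proof -
  from coxeter_words.cross_sweep[OF coxeter_words_perm assms]
  obtain k v where kv: "1 \<le> k" "k \<le> m" "cross_word (m - 1) v" "u \<approx> ups k m @ v"
    "word_perm u = word_perm (ups k m) \<circ> word_perm v" by auto
  have "word_perm v m = m"
    using permutes_not_in[OF word_perm_permutes[OF kv(3)], of m] assms by auto
  then have "word_perm u m = k" using kv word_perm_ups[OF kv(2)] by simp
  with kv that show ?thesis by blast
qed

text \<open>Completeness of the Coxeter presentation: the image of the largest point determines the
  coset representative, which cancels and leaves words of the smaller group.\<close>

lemma cross_words_eqv_aux:
  "m \<le> n \<Longrightarrow> cross_word m u \<Longrightarrow> cross_word m u' \<Longrightarrow> word_perm u = word_perm u' \<Longrightarrow> u \<approx> u'"
proof (induction m arbitrary: u u')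
  case 0
  then show ?case by (cases u; cases u') auto
next
  case (Suc m)
  from cross_sweep_perm[OF Suc.prems(2)] Suc.prems obtain k v
    where k: "1 \<le> k" "k \<le> Suc m" "cross_word m v" "u \<approx> ups k (Suc m) @ v"
     "word_perm u = word_perm (ups k (Suc m)) \<circ> word_perm v" "word_perm u (Suc m) = k" by auto
  from cross_sweep_perm[OF Suc.prems(3)] Suc.prems obtain k' v'
    where k': "1 \<le> k'" "k' \<le> Suc m" "cross_word m v'" "u' \<approx> ups k' (Suc m) @ v'"
     "word_perm u' = word_perm (ups k' (Suc m)) \<circ> word_perm v'" "word_perm u' (Suc m) = k'" by auto
  have [simp]: "k' = k" using k(6) k'(6) Suc.prems(4) by metis
  have "word_perm (ups k (Suc m)) \<circ> word_perm v = word_perm (ups k (Suc m)) \<circ> word_perm v'"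
    using k(5) k'(5) Suc.prems(4) \<open>k' = k\<close> by metis
  moreover have "inj (word_perm (ups k (Suc m)))"
    using word_perm_permutes[OF cross_word_ups[OF k(1)]] permutes_inj by blast
  ultimately have "word_perm v = word_perm v'" by (auto simp: inj_eq fun_eq_iff)
  then have "v \<approx> v'" using Suc k k' by auto
  then have "ups k (Suc m) @ v \<approx> ups k (Suc m) @ v'" by (rule cong_left)
  with k k' show ?case by (metis \<open>k' = k\<close> trans sym)
qed

lemma cross_words_eqv:
  "cross_word n u \<Longrightarrow> cross_word n u' \<Longrightarrow> word_perm u = word_perm u' \<Longrightarrow> u \<approx> u'"
  using cross_words_eqv_aux[of n] by blast

text \<open>The coset representative \<open>ups k m\<close> has \<open>k\<close> as the image of
  \<open>m\<close>. Since 1 and 2 are fixed, \<open>k\<close> is at least 3 as long as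
  \<open>m\<close> is, so only letters from \<open>s_3\<close> on occur. Such words commute with
  \<open>e_1\<close>.\<close>

lemma cross_word_fixing:
  assumes "m \<le> n" "cross_word m u" "word_perm u 1 = 1" "word_perm u 2 = 2"
  shows "\<exists>v. cross_word n v \<and> (\<forall>i. Cross i \<in> set v \<longrightarrow> 3 \<le> i) \<and> u \<approx> v"
  using assms
proof (induction m arbitrary: u)
  case 0
  then have "u = []" by (cases u) auto
  then show ?case by (intro exI[of _ "[]"]) auto
next
  case (Suc m)
  show ?case
  proof (cases "m < 2")
    case True
    have p: "word_perm u permutes {1..Suc m}" using Suc.prems word_perm_permutes by blast
    have "word_perm u j = j" for j
    proof (cases "j \<in> {1..Suc m}")
      case j: True
      with True have "j = 1 \<or> j = 2" by auto
      then show ?thesis using Suc.prems by auto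
    qed (use permutes_not_in[OF p] in auto)
    then have "word_perm u = word_perm []" by auto
    then have "u \<approx> []" using Suc.prems cross_words_eqv_aux[of "Suc m" u "[]"] by auto
    then show ?thesis by (intro exI[of _ "[]"]) auto
  next
    case False
    from cross_sweep_perm[OF Suc.prems(2)] Suc.prems obtain k v
    where k: "1 \<le> k" "k \<le> Suc m" "cross_word m v" "u \<approx> ups k (Suc m) @ v"
     "word_perm u = word_perm (ups k (Suc m)) \<circ> word_perm v" "word_perm u (Suc m) = k" by auto
    have p: "inj (word_perm u)" using Suc.prems word_perm_permutes permutes_inj by blast
    have "k \<noteq> 1" "k \<noteq> 2" using k Suc.prems False injD[OF p, of "Suc m" 1] injD[OF p, of "Suc m" 2] by auto
    then have k3: "3 \<le> k" using k by simp
    have up: "word_perm (ups k (Suc m)) j = j" if "j < 3" for j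
      using word_perm_ups[OF k(2)] that k3 k by auto
    have inj: "inj (word_perm (ups k (Suc m)))"
      using word_perm_permutes[OF cross_word_ups[OF k(1)]] permutes_inj by blast
    have "word_perm (ups k (Suc m)) (word_perm v 1) = 1" "word_perm (ups k (Suc m)) (word_perm v 2) = 2"
      using k(5) Suc.prems by auto
    then have "word_perm v 1 = 1" "word_perm v 2 = 2"
      using up[of 1] up[of 2] injD[OF inj, of "word_perm v 1" 1] injD[OF inj, of "word_perm v 2" 2] by simp_all
    then obtain v' where v': "cross_word n v'" "\<forall>i. Cross i \<in> set v' \<longrightarrow> 3 \<le> i" "v \<approx> v'"
      using Suc.IH[of v] Suc.prems k by auto
    have "u \<approx> ups k (Suc m) @ v'" using k(4) v' cong_left trans by blast
    moreover have "cross_word n (ups k (Suc m) @ v')"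
      using v' k Suc.prems cross_word_mono[OF cross_word_ups[of k "Suc m"]] by auto
    moreover have "\<forall>i. Cross i \<in> set (ups k (Suc m) @ v') \<longrightarrow> 3 \<le> i" using v' k3 by (auto simp: ups_def)
    ultimately show ?thesis by blast
  qed
qed

end

section \<open>The sign-free calculus of crossings and cup-caps\<close>

declare add_2_eq_Suc [simp del] add_2_eq_Suc' [simp del]

context word_congruence begin

lemma commute_mset:
  "mset u = mset v \<Longrightarrow> (\<And>x y. x \<in> set u \<Longrightarrow> y \<in> set u \<Longrightarrow> [x, y] \<approx> [y, x]) \<Longrightarrow> u \<approx> v"
proof (induction u arbitrary: v)
  case (Cons x u)
  then have "x \<in> set v" by (metis list.set_intros(1) mset_eq_setD)
  then obtain v1 v2 where v: "v = v1 @ x # v2" by (auto simp: in_set_conv_decomp)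
  have "mset u = mset (v1 @ v2)" using Cons.prems(1) v by simp
  moreover have "set v = set (x # u)" using Cons.prems(1) by (metis mset_eq_setD)
  ultimately have "x # u \<approx> x # v1 @ v2" using Cons by (auto intro: cong_Cons)
  also have "\<dots> \<approx> v1 @ [x] @ v2"
    using cong_right[OF commute_word[of v1 x], of v2] Cons.prems(2) \<open>set v = set (x # u)\<close> v by auto
  finally show ?case using v by simp
qed simp

end

definition perm_word :: "nat \<Rightarrow> (nat \<Rightarrow> nat) \<Rightarrow> gen list" where
  "perm_word n \<pi> = (SOME u. cross_word n u \<and> word_perm u = \<pi>)"

lemma perm_word:
  assumes "\<pi> permutes {1..n}"
  shows "cross_word n (perm_word n \<pi>)" "word_perm (perm_word n \<pi>) = \<pi>"
  using someI_ex[OF ex_cross_word[OF assms]] by (auto simp: perm_word_def)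

definition cup_word :: "nat \<Rightarrow> gen list" where
  "cup_word r = map (\<lambda>k. CupCap (2 * k + 1)) [0..<r]"

lemma cup_word_simps [simp]: "cup_word 0 = []" "cup_word (Suc r) = cup_word r @ [CupCap (2 * r + 1)]"
  by (auto simp: cup_word_def)

text \<open>The other end of an arc of the diagram of \<open>cup_word r\<close>; points on both
  lines are counted from 1, so arcs start at odd points.\<close>

definition mate :: "nat \<Rightarrow> nat" where
  "mate j = (if odd j then j + 1 else j - 1)"

lemma mate_simps [simp]: "mate (2 * k + 1) = 2 * k + 2" "mate (2 * k + 2) = 2 * k + 1"
  by (auto simp: mate_def)

lemma mate_cases:
  assumes "1 \<le> j" "j \<le> 2 * r"
  obtains k where "k < r" "j = 2 * k + 1" "mate j = 2 * k + 2"
    | k where "k < r" "j = 2 * k + 2" "mate j = 2 * k + 1"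
proof (cases "odd j")
  case True
  then obtain k where "j = 2 * k + 1" by (auto elim: oddE)
  with that(1) assms show ?thesis by auto
next
  case False
  then obtain k where "j = 2 * k" by (auto elim: evenE)
  then obtain k' where "j = 2 * k' + 2" using assms by (cases k) auto
  with that(2)[of k'] assms show ?thesis by auto
qed

lemma mate_pair: "1 \<le> j \<Longrightarrow> j \<le> 2 * r \<Longrightarrow> \<exists>k<r. {j, mate j} = {2 * k + 1, 2 * k + 2}"
  by (erule (1) mate_cases) (auto simp: insert_commute)

lemma mate_props:
  assumes "1 \<le> j" "j \<le> 2 * r"
  shows "mate (mate j) = j" "1 \<le> mate j" "mate j \<le> 2 * r" "mate j \<noteq> j"
  using assms by (auto elim!: mate_cases)

definition three_cycle :: "nat \<Rightarrow> nat \<Rightarrow> nat \<Rightarrow> nat \<Rightarrow> nat" where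
  "three_cycle c a b = transpose c a \<circ> transpose a b"

lemma three_cycle:
  assumes "a \<noteq> b" "a \<noteq> c" "b \<noteq> c"
  shows "three_cycle c a b x = (if x = c then a else if x = a then b else if x = b then c else x)"
  using assms by (auto simp: three_cycle_def transpose_def)

lemma three_cycle_permutes:
  "c \<in> S \<Longrightarrow> a \<in> S \<Longrightarrow> b \<in> S \<Longrightarrow> three_cycle c a b permutes S"
  unfolding three_cycle_def by (intro permutes_compose permutes_swap_id)

text \<open>The relations without dots, stripped of their signs. Since \<open>e_i e_i = 0\<close>
  equates a word with no other word, vanishing is expressed by the predicate \<open>Z\<close>, which
  is closed under the congruence and under multiplication.\<close>

locale brauer_words = coxeter_words +
  fixes Z :: "gen list \<Rightarrow> bool"
  assumes se_comm: "\<lbrakk>1 \<le> i; i < n; 1 \<le> j; j < n; i + 1 < j \<or> j + 1 < i\<rbrakk> \<Longrightarrow>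
      [Cross i, CupCap j] \<approx> [CupCap j, Cross i]"
    and ee_comm: "\<lbrakk>1 \<le> i; i + 1 < j; j < n\<rbrakk> \<Longrightarrow> [CupCap i, CupCap j] \<approx> [CupCap j, CupCap i]"
    and es: "\<lbrakk>1 \<le> i; i < n\<rbrakk> \<Longrightarrow> [CupCap i, Cross i] \<approx> [CupCap i]"
    and se: "\<lbrakk>1 \<le> i; i < n\<rbrakk> \<Longrightarrow> [Cross i, CupCap i] \<approx> [CupCap i]"
    and see_down: "\<lbrakk>1 \<le> i; i + 1 < n\<rbrakk> \<Longrightarrow>
      [Cross i, CupCap (i + 1), CupCap i] \<approx> [Cross (i + 1), CupCap i]"
    and see_up: "\<lbrakk>1 \<le> i; i + 1 < n\<rbrakk> \<Longrightarrow>
      [Cross (i + 1), CupCap i, CupCap (i + 1)] \<approx> [Cross i, CupCap (i + 1)]"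
    and ees_up: "\<lbrakk>1 \<le> i; i + 1 < n\<rbrakk> \<Longrightarrow>
      [CupCap (i + 1), CupCap i, Cross (i + 1)] \<approx> [CupCap (i + 1), Cross i]"
    and ees_down: "\<lbrakk>1 \<le> i; i + 1 < n\<rbrakk> \<Longrightarrow>
      [CupCap i, CupCap (i + 1), Cross i] \<approx> [CupCap i, Cross (i + 1)]"
    and Z_ee: "\<lbrakk>1 \<le> i; i < n\<rbrakk> \<Longrightarrow> Z [CupCap i, CupCap i]"
    and Z_eqv: "u \<approx> v \<Longrightarrow> Z u \<Longrightarrow> Z v"
    and Z_cong: "Z u \<Longrightarrow> Z (a @ u @ b)"
begin

abbreviation P :: "(nat \<Rightarrow> nat) \<Rightarrow> gen list" where "P \<equiv> perm_word n"
abbreviation perm :: "(nat \<Rightarrow> nat) \<Rightarrow> bool" where "perm \<pi> \<equiv> \<pi> permutes {1..n}"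

text \<open>Without signs, reversal exchanges \<open>es\<close> with \<open>se\<close>,
  \<open>see_down\<close> with \<open>ees_down\<close> and \<open>see_up\<close> with
  \<open>ees_up\<close>. Every result on left multiplication hence has a mirror image.\<close>

lemma brauer_words_rev: "brauer_words (\<lambda>u v. rev u \<approx> rev v) n (\<lambda>u. Z (rev u))"
proof unfold_locales
  fix i j assume *: "1 \<le> i" "i < n" "1 \<le> j" "j < n" "i + 1 < j \<or> j + 1 < i"
  from sym[OF se_comm[OF *]]
  show "rev [Cross i, CupCap j] \<approx> rev [CupCap j, Cross i]" by simp
qed (auto intro: sym trans sym[OF ss_comm] sym[OF ee_comm] cong Z_cong Z_eqv
    ss braid es se see_down see_up ees_up ees_down Z_ee)

lemma P_eqv: "cross_word n u \<Longrightarrow> word_perm u = \<pi> \<Longrightarrow> u \<approx> P \<pi>"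
  using cross_words_eqv[of u "P \<pi>"] perm_word[of \<pi> n] word_perm_permutes[of n u] by auto

lemma P_comp: "perm \<sigma> \<Longrightarrow> perm \<rho> \<Longrightarrow> P \<sigma> @ P \<rho> \<approx> P (\<sigma> \<circ> \<rho>)"
  using perm_word[of \<sigma> n] perm_word[of \<rho> n] by (auto intro!: P_eqv)

lemma P_id: "P id \<approx> []"
  by (rule sym, rule P_eqv) auto

lemma P_inv: "perm \<sigma> \<Longrightarrow> P \<sigma> @ P (pinv \<sigma>) \<approx> []" "perm \<sigma> \<Longrightarrow> P (pinv \<sigma>) @ P \<sigma> \<approx> []"
  using P_comp[of \<sigma> "pinv \<sigma>"] P_comp[of "pinv \<sigma>" \<sigma>] P_id permutes_inv[of \<sigma>]
  by (auto simp: permutes_inv_o intro: trans)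

lemma cross_P: "perm \<sigma> \<Longrightarrow> 1 \<le> i \<Longrightarrow> i < n \<Longrightarrow> Cross i # P \<sigma> \<approx> P (transpose i (i + 1) \<circ> \<sigma>)"
  using perm_word[of \<sigma> n] by (auto intro!: P_eqv)

lemma P_cross: "perm \<sigma> \<Longrightarrow> 1 \<le> i \<Longrightarrow> i < n \<Longrightarrow> P \<sigma> @ [Cross i] \<approx> P (\<sigma> \<circ> transpose i (i + 1))"
  using perm_word[of \<sigma> n] by (auto intro!: P_eqv)

section \<open>Cup-caps conjugated by permutations\<close>

lemma ee_left: "1 \<le> i \<Longrightarrow> i + 1 < n \<Longrightarrow> [CupCap (i + 1), CupCap i] \<approx> [Cross i, Cross (i + 1), CupCap i]"
  using sym[OF cross_cancel[of i "[CupCap (i + 1), CupCap i]"]] cong_Cons[OF see_down[of i], of "Cross i"]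
  by (auto intro: trans)

lemma ee_right: "1 \<le> i \<Longrightarrow> i + 1 < n \<Longrightarrow> [CupCap (i + 1), CupCap i] \<approx> [CupCap (i + 1), Cross i, Cross (i + 1)]"
  using cong_left[OF sym[OF ss[of "i + 1"]], of "[CupCap (i + 1), CupCap i]"]
    cong_right[OF ees_up[of i], of "[Cross (i + 1)]"]
  by (auto intro: trans)

text \<open>Both sides are equal to \<open>e_(i+1) e_i\<close> up to sign, by \<open>ee_left\<close>
  and \<open>ee_right\<close>. This moves a cup-cap to the neighbouring position by crossings
  alone.\<close>

lemma e_shift: "1 \<le> i \<Longrightarrow> i + 1 < n \<Longrightarrow>
    [CupCap (i + 1), Cross i, Cross (i + 1)] \<approx> [Cross i, Cross (i + 1), CupCap i]"
  using ee_left ee_right sym trans by blast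

text \<open>Iterating \<open>e_shift\<close> carries \<open>e_a\<close> down to \<open>e_1\<close>;
  the recorded images of 1 and 2 say that the permutation takes these two strands to
  \<open>a\<close> and \<open>a + 1\<close> in order.\<close>

lemma ex_shift_word:
  "1 \<le> a \<Longrightarrow> a < n \<Longrightarrow> \<exists>w. cross_word n w \<and> word_perm w 1 = a \<and> word_perm w 2 = a + 1 \<and>
     CupCap a # w \<approx> w @ [CupCap 1]"
proof (induction a rule: nat_induct_at_least)
  case base
  then show ?case by (intro exI[of _ "[]"]) auto
next
  case (Suc a)
  then obtain w where w: "cross_word n w" "word_perm w 1 = a" "word_perm w 2 = a + 1"
     "CupCap a # w \<approx> w @ [CupCap 1]" by auto
  let ?w = "[Cross a, Cross (a + 1)] @ w"
  have "CupCap (a + 1) # ?w \<approx> [Cross a, Cross (a + 1)] @ CupCap a # w"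
    using cong_right[OF e_shift[of a], of w] Suc by simp
  also have "\<dots> \<approx> ?w @ [CupCap 1]" using cong_left[OF w(4), of "[Cross a, Cross (a + 1)]"] by simp
  finally have "CupCap (Suc a) # ?w \<approx> ?w @ [CupCap 1]" by (simp add: One_nat_def)
  moreover have "word_perm ?w 1 = Suc a" "word_perm ?w 2 = Suc a + 1" using w by (auto simp: transpose_def)
  ultimately show ?case using w Suc by (intro exI[of _ ?w]) auto
qed

lemma fixing_commute:
  assumes "cross_word n u" "word_perm u 1 = 1" "word_perm u 2 = 2" "1 < n"
  shows "CupCap 1 # u \<approx> u @ [CupCap 1]"
proof -
  obtain v where v: "cross_word n v" "\<forall>i. Cross i \<in> set v \<longrightarrow> 3 \<le> i" "u \<approx> v"
    using cross_word_fixing[of n u] assms by auto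
  have "CupCap 1 # v \<approx> v @ [CupCap 1]"
  proof (rule commute_word)
    fix g assume "g \<in> set v"
    with v(1) obtain i where i: "g = Cross i" "i < n" by (auto simp: cross_word_def)
    then have "3 \<le> i" using v(2) \<open>g \<in> set v\<close> by auto
    with i show "[CupCap 1, g] \<approx> [g, CupCap 1]" using sym[OF se_comm[of i 1]] assms by auto
  qed
  then show ?thesis
    using cong_Cons[OF v(3), of "CupCap 1"] cong_right[OF sym[OF v(3)], of "[CupCap 1]"] trans by metis
qed

text \<open>The shift words \<open>w\<close> and \<open>v\<close> reduce both cup-caps to
  \<open>e_1\<close>. Then \<open>rev v @ P \<rho> @ w\<close> stands for a permutation that fixes 1
  and 2, which commutes with \<open>e_1\<close>.\<close>

lemma naturality_aux:
  assumes "perm \<rho>" "1 \<le> a" "a < n" "1 \<le> i" "i < n" "\<rho> a = i" "\<rho> (a + 1) = i + 1"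
  shows "CupCap i # P \<rho> \<approx> P \<rho> @ [CupCap a]"
proof -
  obtain w where w: "cross_word n w" "word_perm w 1 = a" "word_perm w 2 = a + 1"
     "CupCap a # w \<approx> w @ [CupCap 1]" using ex_shift_word[of a] assms by auto
  obtain v where v: "cross_word n v" "word_perm v 1 = i" "word_perm v 2 = i + 1"
     "CupCap i # v \<approx> v @ [CupCap 1]" using ex_shift_word[of i] assms by auto
  let ?u = "rev v @ P \<rho> @ w"
  have vi: "word_perm (rev v) i = 1" "word_perm (rev v) (i + 1) = 2"
    using word_perm_rev(1)[OF v(1)] v(2,3) by (metis comp_apply id_apply)+
  have "CupCap 1 # ?u \<approx> ?u @ [CupCap 1]"
    using w v vi perm_word[OF assms(1)] assms by (intro fixing_commute) auto
  then have u: "[CupCap 1] @ ?u \<approx> ?u @ [CupCap 1]" by simp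
  have vv: "v @ rev v \<approx> []" and ww: "w @ rev w \<approx> []" using cross_rev(1) w v by auto
  have pv: "P \<rho> \<approx> v @ ?u @ rev w"
    using cong_append[OF sym[OF vv], of "P \<rho>" "P \<rho> @ w @ rev w"]
      cong_left[OF sym[OF ww], of "P \<rho>"] by simp
  have "[CupCap i] @ P \<rho> \<approx> [CupCap i] @ v @ ?u @ rev w" by (rule cong_left[OF pv])
  also have "\<dots> \<approx> v @ ([CupCap 1] @ ?u) @ rev w"
    using cong_right[OF v(4), of "?u @ rev w"] by simp
  also have "\<dots> \<approx> v @ (?u @ [CupCap 1]) @ rev w" by (rule cong[OF u])
  also have "\<dots> = (v @ rev v) @ P \<rho> @ (w @ [CupCap 1]) @ rev w" by simp
  also have "\<dots> \<approx> [] @ P \<rho> @ ([CupCap a] @ w) @ rev w"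
    using sym[OF w(4)] by (intro cong_append[OF vv] cong) simp
  also have "\<dots> \<approx> P \<rho> @ [CupCap a]"
    using cong_left[OF ww, of "P \<rho> @ [CupCap a]"] by simp
  finally show ?thesis by simp
qed

text \<open>If \<open>\<rho>\<close> reverses the two strands, one more crossing restores the order
  and is absorbed by the cup-cap. The equation \<open>b = a + 1\<close> is a separate premise, so
  that points written as \<open>2 * k + 2\<close> can be inserted directly.\<close>

lemma naturality:
  assumes "perm \<rho>" "{\<rho> a, \<rho> b} = {i, i + 1}" "1 \<le> a" "a < n" "1 \<le> i" "i < n" "b = a + 1"
  shows "CupCap i # P \<rho> \<approx> P \<rho> @ [CupCap a]"
proof (cases "\<rho> a = i")
  case True
  then have "\<rho> (a + 1) = i + 1" using assms(2,7) by (auto simp: doubleton_eq_iff)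
  with True show ?thesis using assms naturality_aux[of \<rho> a i] by simp
next
  case False
  then have sw: "\<rho> a = i + 1" "\<rho> (a + 1) = i" using assms(2,7) by (auto simp: doubleton_eq_iff)
  let ?\<rho> = "\<rho> \<circ> transpose a (a + 1)"
  have p: "perm ?\<rho>" using assms by (intro permutes_compose permutes_swap_id) simp_all
  have r: "P \<rho> \<approx> P ?\<rho> @ [Cross a]"
  proof -
    have "?\<rho> \<circ> transpose a (a + 1) = \<rho>" by (simp add: comp_assoc)
    then show ?thesis using sym[OF P_cross[OF p assms(3,4)]] by simp
  qed
  have "CupCap i # P ?\<rho> \<approx> P ?\<rho> @ [CupCap a]"
    using p sw assms(3-6) by (intro naturality_aux) auto
  then have 1: "[CupCap i] @ P ?\<rho> \<approx> P ?\<rho> @ [CupCap a]" by simp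
  have "[CupCap i] @ P \<rho> \<approx> [CupCap i] @ P ?\<rho> @ [Cross a]" by (rule cong_left[OF r])
  also have "\<dots> \<approx> P ?\<rho> @ [CupCap a, Cross a]" using cong_right[OF 1, of "[Cross a]"] by simp
  also have "\<dots> \<approx> P ?\<rho> @ [Cross a, CupCap a]"
    using trans[OF es sym[OF se]] assms(3,4) by (intro cong_left) simp
  also have "\<dots> \<approx> P \<rho> @ [CupCap a]" using cong_right[OF sym[OF r], of "[CupCap a]"] by simp
  finally show ?thesis by simp
qed

lemma e_commute: "\<lbrakk>1 \<le> i; i < n; 1 \<le> j; j < n; i + 1 < j \<or> j + 1 < i \<or> i = j\<rbrakk> \<Longrightarrow>
    [CupCap i, CupCap j] \<approx> [CupCap j, CupCap i]"
  using ee_comm[of i j] sym[OF ee_comm[of j i]] by auto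

lemma cup_commute:
  "2 * r \<le> n \<Longrightarrow> x \<in> set (cup_word r) \<Longrightarrow> y \<in> set (cup_word r) \<Longrightarrow> [x, y] \<approx> [y, x]"
  by (auto simp: cup_word_def intro!: e_commute)

lemma cup_mset: "2 * r \<le> n \<Longrightarrow> mset u = mset (cup_word r) \<Longrightarrow> u \<approx> cup_word r"
  using commute_mset[of u "cup_word r"] cup_commute[of r] by (metis mset_eq_setD)

lemma cup_split:
  assumes "2 * r \<le> n" "k < r"
  shows "\<exists>w. cup_word r \<approx> CupCap (2 * k + 1) # w"
proof -
  have "CupCap (2 * k + 1) \<in> set (cup_word r)" using assms by (auto simp: cup_word_def)
  then obtain u v where uv: "cup_word r = u @ CupCap (2 * k + 1) # v" by (auto simp: in_set_conv_decomp)
  have "CupCap (2 * k + 1) # u @ v \<approx> cup_word r" by (rule cup_mset) (use assms uv in auto)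
  then show ?thesis using sym by blast
qed

lemma cup_split_two:
  assumes "2 * r \<le> n" "k < r" "l < r" "k \<noteq> l"
  shows "\<exists>w. cup_word r \<approx> w @ [CupCap (2 * k + 1), CupCap (2 * l + 1)]"
proof -
  let ?A = "{#CupCap (2 * k + 1), CupCap (2 * l + 1)#}"
  have "set_mset ?A \<subseteq> set (cup_word r)" using assms by (auto simp: cup_word_def)
  then have "?A \<subseteq># mset (cup_word r)"
    using assms(4) by (intro mset_subset_eqI) (auto simp: count_eq_zero_iff Suc_le_eq)
  moreover obtain w where "mset w = mset (cup_word r) - ?A" using ex_mset by blast
  ultimately have "mset w + ?A = mset (cup_word r)" by (metis subset_mset.diff_add)
  then have "mset (w @ [CupCap (2 * k + 1), CupCap (2 * l + 1)]) = mset (cup_word r)" by simp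
  then show ?thesis using cup_mset[OF assms(1)] sym by blast
qed

lemma P_cup_fix:
  assumes "perm \<rho>" "2 * r \<le> n" "\<forall>j\<in>{1..2 * r}. \<rho> j = j"
  shows "P \<rho> @ cup_word r \<approx> cup_word r @ P \<rho>"
  using assms(2,3)
proof (induction r)
  case (Suc r)
  then have IH: "P \<rho> @ cup_word r \<approx> cup_word r @ P \<rho>" by simp
  have "P \<rho> @ [CupCap (2 * r + 1)] \<approx> CupCap (2 * r + 1) # P \<rho>"
    using Suc.prems by (intro sym[OF naturality[OF assms(1) _ _ _ _ _ HOL.refl]]) auto
  from cong_left[OF this, of "cup_word r"] cong_right[OF IH, of "[CupCap (2 * r + 1)]"]
  show ?case by (auto intro: trans)
qed simp

section \<open>Left multiplication of a normal form by a cup-cap\<close>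

lemma left_loop:
  assumes "perm \<sigma>" "2 * r \<le> n" "1 \<le> i" "i < n" "k < r" "{\<sigma> (2 * k + 1), \<sigma> (2 * k + 2)} = {i, i + 1}"
  shows "Z (CupCap i # P \<sigma> @ cup_word r @ w)"
proof -
  obtain v where v: "cup_word r \<approx> CupCap (2 * k + 1) # v" using cup_split assms by blast
  \<comment> \<open>The cup-cap passes \<open>\<sigma>\<close> and meets its own copy in
    \<open>cup_word r\<close>; their product is the closed loop.\<close>
  have "CupCap i # P \<sigma> \<approx> P \<sigma> @ [CupCap (2 * k + 1)]" 
    by (rule naturality[OF assms(1,6)]) (use assms in simp_all)
  from cong_append[OF this cong_right[OF v, of w]]
  have "CupCap i # P \<sigma> @ cup_word r @ w \<approx> P \<sigma> @ [CupCap (2 * k + 1), CupCap (2 * k + 1)] @ v @ w"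
    by simp
  moreover have "Z (P \<sigma> @ [CupCap (2 * k + 1), CupCap (2 * k + 1)] @ v @ w)"
    using assms by (intro Z_cong Z_ee) auto
  ultimately show ?thesis by (rule Z_eqv[OF sym])
qed

text \<open>At least one of the two strands joined, the one at \<open>a\<close>, belongs to a cup.
  The new cup joins \<open>\<sigma> a\<close> and \<open>\<sigma> b\<close>, and the other end of
  the old cup takes over the strand of \<open>b\<close>. This is the three-cycle on
  \<open>mate a\<close>, \<open>a\<close>, \<open>b\<close>, and no cup is gained. In a model on
  three strands it is the identity \<open>e_2 e_1 = s_1 s_2 e_1\<close> up to sign.\<close>

lemma left_slide:
  assumes "perm \<sigma>" "2 * r \<le> n" "1 \<le> i" "i < n" "1 \<le> a" "a \<le> 2 * r" "1 \<le> b" "b \<le> n"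
    "b \<noteq> a" "b \<noteq> mate a" "{\<sigma> a, \<sigma> b} = {i, i + 1}"
  shows "CupCap i # P \<sigma> @ cup_word r \<approx> P (\<sigma> \<circ> three_cycle (mate a) a b) @ cup_word r"
proof -
  let ?c = "mate a" and ?\<gamma> = "three_cycle (mate a) a b"
  note m = mate_props[OF assms(5,6)]
  have "card {a, b, mate a} \<le> card {1..n}" using assms m by (intro card_mono) auto
  then have n3: "3 \<le> n" using assms m by auto
  obtain k where k: "k < r" "{?c, a} = {2 * k + 1, 2 * k + 2}"
    using mate_pair[OF assms(5,6)] by (metis insert_commute)
  \<comment> \<open>The permutation \<open>\<rho>\<close> takes 1, 2, 3 to the cup
    \<open>mate a\<close>, \<open>a\<close> and the strand \<open>b\<close>: the cup becomes
    \<open>e_1\<close>, and the cup-cap applied becomes \<open>e_2\<close>.\<close>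
  define f where "f x = (if x = 1 then ?c else if x = 2 then a else b)" for x :: nat
  have "\<exists>\<rho>. perm \<rho> \<and> (\<forall>x\<in>{1..3}. \<rho> x = f x)"
    using assms m n3 by (intro permutes_extend) (auto simp: f_def inj_on_def)
  then obtain \<rho> where \<rho>: "perm \<rho>" "\<rho> 1 = ?c" "\<rho> 2 = a" "\<rho> 3 = b"
    by (auto simp: f_def)
  have \<gamma>: "perm ?\<gamma>" using assms m by (intro three_cycle_permutes) auto
  have conj: "?\<gamma> \<circ> \<rho> = \<rho> \<circ> transpose 1 2 \<circ> transpose 2 3"
  proof
    fix x
    have inj: "\<rho> x = \<rho> y \<longleftrightarrow> x = y" for y using permutes_inj[OF \<rho>(1)] by (auto dest: injD)
    show "(?\<gamma> \<circ> \<rho>) x = (\<rho> \<circ> transpose 1 2 \<circ> transpose 2 3) x"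
      using three_cycle[of a b ?c "\<rho> x"] assms m \<rho> inj[of 1] inj[of 2] inj[of 3]
      by (auto simp: transpose_def)
  qed
  have p: "perm (\<sigma> \<circ> \<rho>)" using assms \<rho> permutes_compose by blast
  have ga: "P ?\<gamma> @ P \<rho> \<approx> P \<rho> @ [Cross 1, Cross 2]"
  proof -
    have "P ?\<gamma> @ P \<rho> \<approx> P (\<rho> \<circ> transpose 1 2 \<circ> transpose 2 3)"
      using P_comp[OF \<gamma> \<rho>(1)] conj by simp
    moreover have "P \<rho> @ [Cross 1, Cross 2] \<approx> P (\<rho> \<circ> transpose 1 2 \<circ> transpose 2 3)"
      using perm_word[OF \<rho>(1)] n3 by (intro P_eqv) (auto simp: comp_assoc)
    ultimately show ?thesis using sym trans by blast
  qed
  obtain v where v: "cup_word r \<approx> CupCap (2 * k + 1) # v" using cup_split assms k by blast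
  have nat1: "CupCap (2 * k + 1) # P \<rho> \<approx> P \<rho> @ [CupCap 1]"
    by (rule naturality[OF \<rho>(1), of _ 2]) (use k assms \<rho> in \<open>simp_all add: add.commute\<close>)
  have nat2: "CupCap i # P (\<sigma> \<circ> \<rho>) \<approx> P (\<sigma> \<circ> \<rho>) @ [CupCap 2]"
    by (rule naturality[OF p, of _ 3]) (use assms(3,4,11) \<rho> n3 in simp_all)
  have e21: "[CupCap 2, CupCap 1] \<approx> [Cross 1, Cross 2, CupCap 1]"
    using ee_left[of 1] n3 by simp
  have core: "[CupCap i] @ P \<sigma> @ [CupCap (2 * k + 1)] \<approx> P \<sigma> @ P ?\<gamma> @ [CupCap (2 * k + 1)]"
  proof -
    have e: "[CupCap (2 * k + 1)] \<approx> P \<rho> @ [CupCap 1] @ P (pinv \<rho>)"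
      using cong_left[OF sym[OF P_inv(1)[OF \<rho>(1)]], of "[CupCap (2 * k + 1)]"]
        cong_right[OF nat1, of "P (pinv \<rho>)"] trans by simp
    have "[CupCap i] @ P \<sigma> @ [CupCap (2 * k + 1)] \<approx> [CupCap i] @ P \<sigma> @ P \<rho> @ [CupCap 1] @ P (pinv \<rho>)"
      using cong_left[OF e, of "[CupCap i] @ P \<sigma>"] by simp
    also have "\<dots> \<approx> [CupCap i] @ P (\<sigma> \<circ> \<rho>) @ [CupCap 1] @ P (pinv \<rho>)"
      using cong[OF P_comp[OF assms(1) \<rho>(1)], of "[CupCap i]" "[CupCap 1] @ P (pinv \<rho>)"] by simp
    also have "\<dots> \<approx> P (\<sigma> \<circ> \<rho>) @ [CupCap 2, CupCap 1] @ P (pinv \<rho>)"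
      using cong_right[OF nat2, of "[CupCap 1] @ P (pinv \<rho>)"] by simp
    also have "\<dots> \<approx> P (\<sigma> \<circ> \<rho>) @ [Cross 1, Cross 2, CupCap 1] @ P (pinv \<rho>)" by (rule cong[OF e21])
    also have "\<dots> \<approx> P \<sigma> @ (P \<rho> @ [Cross 1, Cross 2]) @ [CupCap 1] @ P (pinv \<rho>)"
      using cong_right[OF sym[OF P_comp[OF assms(1) \<rho>(1)]], of "[Cross 1, Cross 2, CupCap 1] @ P (pinv \<rho>)"] by simp
    also have "\<dots> \<approx> P \<sigma> @ (P ?\<gamma> @ P \<rho>) @ [CupCap 1] @ P (pinv \<rho>)" by (rule cong[OF sym[OF ga]])
    also have "\<dots> = (P \<sigma> @ P ?\<gamma>) @ P \<rho> @ [CupCap 1] @ P (pinv \<rho>)" by simp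
    also have "\<dots> \<approx> (P \<sigma> @ P ?\<gamma>) @ [CupCap (2 * k + 1)]" by (rule cong_left[OF sym[OF e]])
    finally show ?thesis by simp
  qed
  have "CupCap i # P \<sigma> @ cup_word r \<approx> ([CupCap i] @ P \<sigma> @ [CupCap (2 * k + 1)]) @ v"
    using cong_left[OF v, of "CupCap i # P \<sigma>"] by simp
  also have "\<dots> \<approx> (P \<sigma> @ P ?\<gamma> @ [CupCap (2 * k + 1)]) @ v" by (rule cong_right[OF core])
  also have "\<dots> \<approx> (P \<sigma> @ P ?\<gamma>) @ cup_word r"
    using cong_left[OF sym[OF v], of "P \<sigma> @ P ?\<gamma>"] by simp
  also have "\<dots> \<approx> P (\<sigma> \<circ> ?\<gamma>) @ cup_word r" by (rule cong_right[OF P_comp[OF assms(1) \<gamma>]])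
  finally show ?thesis .
qed

text \<open>The case of two through strands. The permutation \<open>\<rho>\<close> moves them next
  to the cups already present, where the cup-cap becomes the factor \<open>e_(2r+1)\<close>; its
  inverse fixes the first \<open>2 * r\<close> points and therefore passes through
  \<open>cup_word r\<close> to the right.\<close>

lemma left_new:
  assumes "perm \<sigma>" "perm \<rho>" "2 * r + 2 \<le> n" "1 \<le> i" "i < n" "\<forall>j\<in>{1..2 * r}. \<rho> j = j"
    "{\<sigma> (\<rho> (2 * r + 1)), \<sigma> (\<rho> (2 * r + 2))} = {i, i + 1}"
  shows "CupCap i # P \<sigma> @ cup_word r \<approx> P (\<sigma> \<circ> \<rho>) @ cup_word (r + 1) @ P (pinv \<rho>)"
proof -
  have p: "perm (\<sigma> \<circ> \<rho>)" using assms permutes_compose by blast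
  have pp: "P \<sigma> \<approx> P (\<sigma> \<circ> \<rho>) @ P (pinv \<rho>)"
    using sym[OF P_comp[OF p permutes_inv[OF assms(2)]]] permutes_inv_o(1)[OF assms(2)]
    by (simp add: comp_assoc)
  have fixinv: "\<forall>j\<in>{1..2 * r}. pinv \<rho> j = j"
    using assms(6) permutes_inverses(2)[OF assms(2)] by metis
  have "CupCap i # P \<sigma> @ cup_word r \<approx> CupCap i # P (\<sigma> \<circ> \<rho>) @ P (pinv \<rho>) @ cup_word r"
    using cong[OF pp, of "[CupCap i]" "cup_word r"] by simp
  also have "\<dots> \<approx> CupCap i # P (\<sigma> \<circ> \<rho>) @ cup_word r @ P (pinv \<rho>)"
    using cong_left[OF P_cup_fix[OF permutes_inv[OF assms(2)] _ fixinv], of "CupCap i # P (\<sigma> \<circ> \<rho>)"] assms by simp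
  also have "\<dots> \<approx> P (\<sigma> \<circ> \<rho>) @ [CupCap (2 * r + 1)] @ cup_word r @ P (pinv \<rho>)"
    using cong_right[OF naturality[OF p, of "2 * r + 1" "2 * r + 2" i], of "cup_word r @ P (pinv \<rho>)"]
      assms(3-5,7) by (simp add: add.commute)
  also have "\<dots> = P (\<sigma> \<circ> \<rho>) @ (CupCap (2 * r + 1) # cup_word r) @ P (pinv \<rho>)" by simp
  also have "\<dots> \<approx> P (\<sigma> \<circ> \<rho>) @ cup_word (r + 1) @ P (pinv \<rho>)"
    by (rule cong, rule cup_mset) (use assms(3) in \<open>simp_all add: Suc_eq_plus1[symmetric] del: Suc_eq_plus1\<close>)
  finally show ?thesis .
qed

section \<open>Permutations that preserve the arcs\<close>

lemma P_cup_commute: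
  assumes "perm \<alpha>" "2 * r \<le> n" "\<forall>j\<in>{1..2 * r}. \<alpha> j \<le> 2 * r \<and> \<alpha> (mate j) = mate (\<alpha> j)"
  shows "P \<alpha> @ cup_word r \<approx> cup_word r @ P \<alpha>"
proof -
  have "\<exists>l<r. {\<alpha> (2 * k + 1), \<alpha> (2 * k + 2)} = {2 * l + 1, 2 * l + 2}" if "k < r" for k
  proof -
    let ?j = "\<alpha> (2 * k + 1)"
    have j: "?j \<le> 2 * r" "\<alpha> (2 * k + 2) = mate ?j" using assms(3)[rule_format, of "2 * k + 1"] that by auto
    have "1 \<le> ?j" using permutes_in_image[OF assms(1), of "2 * k + 1"] that assms(2) by simp
    then show ?thesis using mate_pair[OF _ j(1)] j(2) by simp
  qed
  \<comment> \<open>\<open>\<alpha>\<close> permutes the arcs, the arc \<open>k\<close> going to the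
    arc \<open>l k\<close>. The factors come out of \<open>\<alpha>\<close> in a permuted order, and
    they commute.\<close>
  then obtain l where l: "\<And>k. k < r \<Longrightarrow> l k < r \<and> {\<alpha> (2 * k + 1), \<alpha> (2 * k + 2)} = {2 * l k + 1, 2 * l k + 2}"
    by metis
  have inj: "inj_on l {..<r}"
  proof (rule inj_onI)
    fix x y assume "x \<in> {..<r}" "y \<in> {..<r}" "l x = l y"
    then have "\<alpha> ` {2 * x + 1, 2 * x + 2} = \<alpha> ` {2 * y + 1, 2 * y + 2}" using l[of x] l[of y] by simp
    then have "{2 * x + 1, 2 * x + 2} = {2 * y + 1, 2 * y + 2}"
      by (simp only: inj_image_eq_iff[OF permutes_inj[OF assms(1)]])
    then show "x = y" by (auto simp: doubleton_eq_iff)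
  qed
  then have im: "l ` {..<r} = {..<r}" using l by (intro endo_inj_surj) auto
  have "m \<le> r \<Longrightarrow> P \<alpha> @ cup_word m \<approx> map (\<lambda>k. CupCap (2 * l k + 1)) [0..<m] @ P \<alpha>" for m
  proof (induction m)
    case (Suc m)
    then have IH: "P \<alpha> @ cup_word m \<approx> map (\<lambda>k. CupCap (2 * l k + 1)) [0..<m] @ P \<alpha>" by simp
    have "CupCap (2 * l m + 1) # P \<alpha> \<approx> P \<alpha> @ [CupCap (2 * m + 1)]"
      by (rule naturality[OF assms(1), of _ "2 * m + 2"]) (use assms(2) l[of m] Suc.prems in \<open>simp_all add: add.commute\<close>)
    note nat = this
    have "P \<alpha> @ cup_word m @ [CupCap (2 * m + 1)]
        \<approx> map (\<lambda>k. CupCap (2 * l k + 1)) [0..<m] @ P \<alpha> @ [CupCap (2 * m + 1)]"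
      using cong_right[OF IH, of "[CupCap (2 * m + 1)]"] by simp
    also have "\<dots> \<approx> map (\<lambda>k. CupCap (2 * l k + 1)) [0..<m] @ CupCap (2 * l m + 1) # P \<alpha>"
      by (rule cong_left[OF sym[OF nat]])
    finally show ?case by simp
  qed simp
  from this[of r] have 1: "P \<alpha> @ cup_word r \<approx> map (\<lambda>k. CupCap (2 * l k + 1)) [0..<r] @ P \<alpha>" by simp
  have "mset (map l [0..<r]) = mset [0..<r]"
    using inj im by (metis atLeast0LessThan image_mset_mset_set mset_map mset_upt)
  then have "mset (map (\<lambda>k. CupCap (2 * l k + 1)) [0..<r]) = mset (cup_word r)"
    unfolding cup_word_def by (metis (no_types, lifting) image_mset.compositionality mset_map comp_def image_mset_cong)
  then have "map (\<lambda>k. CupCap (2 * l k + 1)) [0..<r] \<approx> cup_word r" by (rule cup_mset[OF assms(2)])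
  with 1 show ?thesis using cong_right trans by blast
qed

lemma cup_flip: "2 * r \<le> n \<Longrightarrow> k < r \<Longrightarrow> cup_word r @ [Cross (2 * k + 1)] \<approx> cup_word r"
proof -
  assume *: "2 * r \<le> n" "k < r"
  interpret R: brauer_words "\<lambda>u v. rev u \<approx> rev v" n "\<lambda>u. Z (rev u)" by (rule brauer_words_rev)
  obtain u v where uv: "cup_word r = u @ CupCap (2 * k + 1) # v"
  proof -
    have "CupCap (2 * k + 1) \<in> set (cup_word r)" using * by (auto simp: cup_word_def)
    then show ?thesis using that by (auto simp: in_set_conv_decomp)
  qed
  have c: "cup_word r \<approx> (u @ v) @ [CupCap (2 * k + 1)]" by (rule sym, rule cup_mset) (use * uv in auto)
  have "cup_word r @ [Cross (2 * k + 1)] \<approx> (u @ v) @ [CupCap (2 * k + 1), Cross (2 * k + 1)]"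
    using cong_right[OF c, of "[Cross (2 * k + 1)]"] by simp
  also have "\<dots> \<approx> (u @ v) @ [CupCap (2 * k + 1)]" using * by (intro cong_left es) auto
  finally show ?thesis using sym[OF c] trans by blast
qed

text \<open>The word \<open>s_2 s_1 s_3 s_2\<close> exchanges the pairs \<open>{1, 2}\<close> and
  \<open>{3, 4}\<close>, that is, two neighbouring caps, which leaves the diagram unchanged.\<close>

lemma double_swap:
  assumes "3 < n"
  shows "[CupCap 1, CupCap 3, Cross 2, Cross 1, Cross 3, Cross 2] \<approx> [CupCap 1, CupCap 3]"
proof -
  have 13: "[CupCap 1, CupCap 3] \<approx> [CupCap 3, CupCap 1]" using assms by (intro e_commute) auto
  have a: "[CupCap 1, Cross 2] \<approx> [CupCap 1, CupCap 2, Cross 1]"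
    using sym[OF ees_down[of 1]] assms by simp
  have b: "[CupCap 3, CupCap 2, Cross 3] \<approx> [CupCap 3, Cross 2]" using ees_up[of 2] assms by simp
  have "[CupCap 1, CupCap 3, Cross 2, Cross 1, Cross 3, Cross 2]
     \<approx> [CupCap 3] @ [CupCap 1, Cross 2] @ [Cross 1, Cross 3, Cross 2]"
    using cong_right[OF 13, of "[Cross 2, Cross 1, Cross 3, Cross 2]"] by simp
  also have "\<dots> \<approx> [CupCap 3] @ [CupCap 1, CupCap 2, Cross 1] @ [Cross 1, Cross 3, Cross 2]"
    by (rule cong[OF a])
  also have "\<dots> = [CupCap 3, CupCap 1, CupCap 2] @ [Cross 1, Cross 1] @ [Cross 3, Cross 2]" by simp
  also have "\<dots> \<approx> [CupCap 3, CupCap 1, CupCap 2] @ [] @ [Cross 3, Cross 2]"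
    using assms by (intro cong ss) auto
  also have "\<dots> \<approx> [CupCap 1] @ [CupCap 3, CupCap 2, Cross 3] @ [Cross 2]"
    using cong_right[OF sym[OF 13], of "[CupCap 2, Cross 3, Cross 2]"] by simp
  also have "\<dots> \<approx> [CupCap 1] @ [CupCap 3, Cross 2] @ [Cross 2]" by (rule cong[OF b])
  also have "\<dots> = [CupCap 1, CupCap 3] @ [Cross 2, Cross 2]" by simp
  also have "\<dots> \<approx> [CupCap 1, CupCap 3] @ []" using assms by (intro cong_left ss) auto
  finally show ?thesis by simp
qed

text \<open>A permutation \<open>\<rho>\<close> that takes 1, 2, 3, 4 to the ends of the two caps
  reduces the exchange to \<open>double_swap\<close>.\<close>

lemma cup_swap:
  assumes "2 * r \<le> n" "k < r" "l < r" "k \<noteq> l"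
  shows "cup_word r @ P (transpose (2 * k + 1) (2 * l + 1) \<circ> transpose (2 * k + 2) (2 * l + 2)) \<approx> cup_word r"
proof -
  let ?\<delta> = "transpose (2 * k + 1) (2 * l + 1) \<circ> transpose (2 * k + 2) (2 * l + 2)"
  let ?s = "[Cross 2, Cross 1, Cross 3, Cross 2]"
  have n4: "3 < n" using assms by auto
  define f where "f x = (if x = 1 then 2 * k + 1 else if x = 2 then 2 * k + 2 else if x = 3 then 2 * l + 1 else 2 * l + 2)"
    for x :: nat
  have "\<exists>\<rho>. perm \<rho> \<and> (\<forall>x\<in>{1..4}. \<rho> x = f x)"
  proof (rule permutes_extend)
    show "inj_on f {1..4}" using assms unfolding inj_on_def f_def by auto
  qed (use assms n4 in \<open>auto simp: f_def\<close>)
  then obtain \<rho> where \<rho>: "perm \<rho>" "\<rho> 1 = 2 * k + 1" "\<rho> 2 = 2 * k + 2" "\<rho> 3 = 2 * l + 1" "\<rho> 4 = 2 * l + 2"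
    by (auto simp: f_def)
  have \<delta>: "perm ?\<delta>" using assms by (intro permutes_compose permutes_swap_id) auto
  have conj: "?\<delta> \<circ> \<rho> = \<rho> \<circ> word_perm ?s"
  proof
    fix x
    have inj: "\<rho> x = \<rho> y \<longleftrightarrow> x = y" for y using permutes_inj[OF \<rho>(1)] by (auto dest: injD)
    have neq: "2 * k + 1 \<noteq> 2 * l + 2" "2 * l + 1 \<noteq> 2 * k + 2" by presburger+
    show "(?\<delta> \<circ> \<rho>) x = (\<rho> \<circ> word_perm ?s) x"
    proof (cases "x \<in> {1, 2, 3, 4}")
      case True
      then show ?thesis using \<rho> assms neq by (auto simp: transpose_def)
    next
      case False
      then have "\<rho> x \<noteq> 2 * k + 1" "\<rho> x \<noteq> 2 * k + 2" "\<rho> x \<noteq> 2 * l + 1" "\<rho> x \<noteq> 2 * l + 2"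
        using inj[of 1] inj[of 2] inj[of 3] inj[of 4] \<rho> by auto
      then show ?thesis using False by (auto simp: transpose_def)
    qed
  qed
  have pd: "P ?\<delta> \<approx> P \<rho> @ ?s @ P (pinv \<rho>)"
  proof (rule sym, rule P_eqv)
    show "cross_word n (P \<rho> @ ?s @ P (pinv \<rho>))"
      using n4 perm_word(1)[OF \<rho>(1)] perm_word(1)[OF permutes_inv[OF \<rho>(1)]] by auto
    have "word_perm (P \<rho> @ ?s @ P (pinv \<rho>)) = \<rho> \<circ> word_perm ?s \<circ> pinv \<rho>"
      using perm_word(2)[OF \<rho>(1)] perm_word(2)[OF permutes_inv[OF \<rho>(1)]] by (simp add: comp_assoc)
    also have "\<dots> = ?\<delta>" unfolding conj[symmetric] using permutes_inv_o(1)[OF \<rho>(1)] by (simp add: comp_assoc)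
    finally show "word_perm (P \<rho> @ ?s @ P (pinv \<rho>)) = ?\<delta>" .
  qed
  have "CupCap (2 * l + 1) # P \<rho> \<approx> P \<rho> @ [CupCap 3]"
    by (rule naturality[OF \<rho>(1), of _ 4]) (use \<rho> assms n4 in \<open>simp_all add: add.commute\<close>)
  moreover have "CupCap (2 * k + 1) # P \<rho> \<approx> P \<rho> @ [CupCap 1]"
    by (rule naturality[OF \<rho>(1), of _ 2]) (use \<rho> assms n4 in \<open>simp_all add: add.commute\<close>)
  ultimately have nat: "[CupCap (2 * k + 1), CupCap (2 * l + 1)] @ P \<rho> \<approx> P \<rho> @ [CupCap 1, CupCap 3]"
    using cong_Cons[of "CupCap (2 * l + 1) # P \<rho>" "P \<rho> @ [CupCap 3]" "CupCap (2 * k + 1)"]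
      cong_right[of "CupCap (2 * k + 1) # P \<rho>" "P \<rho> @ [CupCap 1]" "[CupCap 3]"] by (auto intro: trans)
  let ?e = "[CupCap (2 * k + 1), CupCap (2 * l + 1)]"
  have "?e @ P ?\<delta> \<approx> ?e @ P \<rho> @ ?s @ P (pinv \<rho>)" by (rule cong_left[OF pd])
  also have "\<dots> \<approx> P \<rho> @ ([CupCap 1, CupCap 3] @ ?s) @ P (pinv \<rho>)"
    using cong_right[OF nat, of "?s @ P (pinv \<rho>)"] by simp
  also have "\<dots> \<approx> P \<rho> @ [CupCap 1, CupCap 3] @ P (pinv \<rho>)" using double_swap[OF n4] by (intro cong) simp
  also have "\<dots> \<approx> ?e @ P \<rho> @ P (pinv \<rho>)"
    using cong_right[OF sym[OF nat], of "P (pinv \<rho>)"] by simp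
  also have "\<dots> \<approx> ?e" using cong_left[OF P_inv(1)[OF \<rho>(1)], of ?e] by simp
  finally have e: "?e @ P ?\<delta> \<approx> ?e" .
  obtain w where w: "cup_word r \<approx> w @ ?e" using cup_split_two[OF assms] by auto
  have "cup_word r @ P ?\<delta> \<approx> w @ ?e @ P ?\<delta>" using cong_right[OF w, of "P ?\<delta>"] by simp
  also have "\<dots> \<approx> w @ ?e" by (rule cong_left[OF e])
  also have "\<dots> \<approx> cup_word r" by (rule sym[OF w])
  finally show ?thesis .
qed

text \<open>The permutations compatible with \<open>mate\<close> are generated by the flips of
  single caps (\<open>cup_flip\<close>) and the exchanges of two caps (\<open>cup_swap\<close>). The
  induction first arranges that the last pair is preserved, then that it is fixed pointwise.\<close>

lemma cup_absorb:
  assumes "perm \<beta>" "m \<le> r" "2 * r \<le> n" "\<forall>j>2 * m. \<beta> j = j" "\<forall>j\<in>{1..2 * m}. \<beta> (mate j) = mate (\<beta> j)"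
  shows "cup_word r @ P \<beta> \<approx> cup_word r"
  using assms
proof (induction m arbitrary: \<beta>)
  case 0
  then have "\<beta> = id" using permutes_not_in[of \<beta> "{1..n}" 0] by (auto simp: fun_eq_iff) (metis gr0I)
  then show ?case using cong_left[OF P_id, of "cup_word r"] by (simp only: append_Nil2)
next
  case (Suc m)
  note \<beta> = Suc.prems(1)
  have inj: "\<beta> x = \<beta> y \<longleftrightarrow> x = y" for x y using permutes_inj[OF \<beta>] by (auto dest: injD)
  have bound: "\<beta> j \<in> {1..2 * m + 2}" if "j \<in> {1..2 * m + 2}" for j
  proof -
    have "\<beta> j \<in> {1..n}" using that Suc.prems permutes_in_image[OF \<beta>, of j] by auto
    moreover have "\<not> 2 * Suc m < \<beta> j" using Suc.prems(4) inj that by (metis atLeastAtMost_iff add_2_eq_Suc' mult_Suc_right not_less add.commute)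
    ultimately show ?thesis by auto
  qed
  have step: "cup_word r @ P \<beta>' \<approx> cup_word r"
    if \<beta>': "perm \<beta>'" "\<forall>j>2 * m + 2. \<beta>' j = j" "\<forall>j\<in>{1..2 * m + 2}. \<beta>' (mate j) = mate (\<beta>' j)"
      "\<beta>' (2 * m + 1) \<in> {2 * m + 1, 2 * m + 2}" for \<beta>'
  proof (cases "\<beta>' (2 * m + 1) = 2 * m + 1")
    case True
    then have "\<beta>' (2 * m + 2) = 2 * m + 2" using \<beta>'(3)[rule_format, of "2 * m + 1"] by simp
    then have "\<forall>j>2 * m. \<beta>' j = j" using True \<beta>'(2)
      by (metis add_2_eq_Suc' Suc_lessI add.commute plus_1_eq_Suc)
    then show ?thesis using Suc.IH[of \<beta>'] \<beta>' Suc.prems by auto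
  next
    case False
    then have b1: "\<beta>' (2 * m + 1) = 2 * m + 2" using \<beta>' by simp
    then have b2: "\<beta>' (2 * m + 2) = 2 * m + 1" using \<beta>'(3)[rule_format, of "2 * m + 1"] by simp
    let ?t = "transpose (2 * m + 1) (2 * m + 2)"
    let ?b = "?t \<circ> \<beta>'"
    have inj': "\<beta>' x = \<beta>' y \<longleftrightarrow> x = y" for x y using permutes_inj[OF \<beta>'(1)] by (auto dest: injD)
    have t: "perm ?t" using Suc.prems by (intro permutes_swap_id) auto
    have b: "perm ?b" using permutes_compose[OF \<beta>'(1) t] .
    have "\<forall>j>2 * m. ?b j = j"
    proof (intro allI impI)
      fix j assume "2 * m < j"
      then consider "j = 2 * m + 1" | "j = 2 * m + 2" | "2 * m + 2 < j" by linarith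
      then show "?b j = j" using b1 b2 \<beta>'(2) by cases auto
    qed
    moreover have "\<forall>j\<in>{1..2 * m}. ?b (mate j) = mate (?b j)"
    proof
      fix j assume j: "j \<in> {1..2 * m}"
      have "\<beta>' j \<noteq> 2 * m + 1" "\<beta>' j \<noteq> 2 * m + 2" using inj'[of j "2 * m + 1"] inj'[of j "2 * m + 2"] b1 b2 j by auto
      moreover have "\<beta>' (mate j) \<noteq> 2 * m + 1" "\<beta>' (mate j) \<noteq> 2 * m + 2"
        using inj'[of "mate j" "2 * m + 1"] inj'[of "mate j" "2 * m + 2"] b1 b2 j mate_props(3)[of j m] by auto
      ultimately show "?b (mate j) = mate (?b j)" using \<beta>'(3) j by (auto simp: transpose_def)
    qed
    ultimately have "cup_word r @ P ?b \<approx> cup_word r"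
      using Suc.IH[OF b] Suc.prems(2,3) by (simp only: Suc_leD)
    moreover have "cup_word r @ Cross (2 * m + 1) # P ?b \<approx> cup_word r @ P \<beta>'"
    proof -
      have "?t \<circ> ?b = \<beta>'" by (simp add: comp_assoc[symmetric])
      then show ?thesis using cross_P[OF b, of "2 * m + 1"] Suc.prems by (intro cong_left) (simp add: add.commute)
    qed
    moreover have "cup_word r @ Cross (2 * m + 1) # P ?b \<approx> cup_word r @ P ?b"
      using cong_right[OF cup_flip[of r m], of "P ?b"] Suc.prems by simp
    ultimately show ?thesis using sym trans by blast
  qed
  let ?c = "\<beta> (2 * m + 1)"
  have c: "1 \<le> ?c" "?c \<le> 2 * Suc m" using bound[of "2 * m + 1"] by auto
  have prems: "\<forall>j>2 * m + 2. \<beta> j = j" "\<forall>j\<in>{1..2 * m + 2}. \<beta> (mate j) = mate (\<beta> j)"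
    using Suc.prems by auto
  show ?case
  proof (cases "2 * m + 1 \<le> ?c")
    case True
    then have "?c = 2 * m + 1 \<or> ?c = 2 * m + 2" using c by arith
    then show ?thesis using step[OF \<beta> prems] by blast
  next
    case False
    \<comment> \<open>The last pair goes to a lower pair \<open>k\<close>; the exchange
      \<open>?\<delta>\<close> of the pairs \<open>k\<close> and \<open>m\<close>, itself absorbed,
      brings it back.\<close>
    obtain k where k: "k < m" "?c \<in> {2 * k + 1, 2 * k + 2}"
    proof -
      have "?c \<le> 2 * m" using False by simp
      then show ?thesis using mate_pair[OF c(1)] that by blast
    qed
    let ?\<delta> = "transpose (2 * k + 1) (2 * m + 1) \<circ> transpose (2 * k + 2) (2 * m + 2)"
    have neq: "2 * k + 1 \<noteq> 2 * m + 2" "2 * m + 1 \<noteq> 2 * k + 2" by presburger+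
    have \<delta>: "perm ?\<delta>" using k Suc.prems by (intro permutes_compose permutes_swap_id) auto
    have \<delta>mate: "?\<delta> (mate j) = mate (?\<delta> j)" if j: "j \<in> {1..2 * m + 2}" for j
    proof -
      have eq: "2 * x + 1 = 2 * y + 1 \<longleftrightarrow> x = y" "2 * x + 2 = 2 * y + 2 \<longleftrightarrow> x = y"
        "2 * x + 1 \<noteq> 2 * y + 2" "2 * y + 2 \<noteq> 2 * x + 1" for x y :: nat by presburger+
      have d: "?\<delta> (2 * x + 1) = 2 * (transpose k m x) + 1" "?\<delta> (2 * x + 2) = 2 * (transpose k m x) + 2" for x
        by (auto simp: transpose_def eq simp del: One_nat_def add_2_eq_Suc')
      have "1 \<le> j" "j \<le> 2 * (m + 1)" using j by auto
      from mate_pair[OF this] obtain x where "j = 2 * x + 1 \<or> j = 2 * x + 2" by blast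
      then show ?thesis using d[of x] mate_simps by metis
    qed
    have "perm (?\<delta> \<circ> \<beta>)" using permutes_compose[OF \<beta> \<delta>] .
    moreover have "\<forall>j>2 * m + 2. (?\<delta> \<circ> \<beta>) j = j" using prems k by (auto simp: transpose_def)
    moreover have "\<forall>j\<in>{1..2 * m + 2}. (?\<delta> \<circ> \<beta>) (mate j) = mate ((?\<delta> \<circ> \<beta>) j)"
    proof
      fix j assume j: "j \<in> {1..2 * m + 2}"
      then show "(?\<delta> \<circ> \<beta>) (mate j) = mate ((?\<delta> \<circ> \<beta>) j)"
        using prems(2) \<delta>mate[OF bound[OF j]] by simp
    qed
    moreover have "(?\<delta> \<circ> \<beta>) (2 * m + 1) \<in> {2 * m + 1, 2 * m + 2}"
      using k neq by (auto simp: transpose_def)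
    ultimately have "cup_word r @ P (?\<delta> \<circ> \<beta>) \<approx> cup_word r" by (rule step)
    moreover have "cup_word r @ P ?\<delta> @ P \<beta> \<approx> cup_word r @ P (?\<delta> \<circ> \<beta>)"
      using P_comp[OF \<delta> \<beta>] by (rule cong_left)
    moreover have "cup_word r @ P ?\<delta> @ P \<beta> \<approx> cup_word r @ P \<beta>"
      using cong_right[OF cup_swap[of r k m], of "P \<beta>"] k Suc.prems by simp
    ultimately show ?thesis using sym trans by blast
  qed
qed

end

section \<open>Stacking diagrams\<close>

text \<open>Diagrams are handled as fixed-point-free involutions (\<open>pairing\<close>) that send
  each point to the other end of its strand. Stacking a generator then becomes an operation on
  functions.\<close>

definition diagram_of :: "nat \<Rightarrow> (point \<Rightarrow> point) \<Rightarrow> point set set" where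
  "diagram_of n f = (\<lambda>P. {P, f P}) ` points n"

definition pairing :: "nat \<Rightarrow> (point \<Rightarrow> point) \<Rightarrow> bool" where
  "pairing n f \<longleftrightarrow> (\<forall>P\<in>points n. f P \<in> points n \<and> f (f P) = P \<and> f P \<noteq> P)"

lemma points_simps [simp]:
  "Top j \<in> points n \<longleftrightarrow> 1 \<le> j \<and> j \<le> n" "Bot j \<in> points n \<longleftrightarrow> 1 \<le> j \<and> j \<le> n"
  by (auto simp: points_def)

lemma pairingD:
  assumes "pairing n f" "P \<in> points n"
  shows "f P \<in> points n" "f (f P) = P" "f P \<noteq> P"
  using assms by (auto simp: pairing_def)

lemma in_diagram_of:
  assumes "pairing n f"
  shows "{P, Q} \<in> diagram_of n f \<longleftrightarrow> P \<in> points n \<and> Q = f P"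
  using assms by (auto simp: diagram_of_def pairing_def doubleton_eq_iff)

lemma diagram_of_cong: "(\<And>P. P \<in> points n \<Longrightarrow> f P = g P) \<Longrightarrow> diagram_of n f = diagram_of n g"
  by (auto simp: diagram_of_def)

lemma diagram_of_inj:
  assumes "pairing n f" "pairing n g" "diagram_of n f = diagram_of n g" "P \<in> points n"
  shows "f P = g P"
  using in_diagram_of[OF assms(1), of P "f P"] in_diagram_of[OF assms(2), of P "f P"] assms(3,4) by simp

lemma brauer_diagram_of:
  assumes "pairing n f"
  shows "brauer_diagram n (diagram_of n f)"
  unfolding brauer_diagram_def
proof (intro conjI partition_onI)
  show "\<Union> (diagram_of n f) = points n"
    using pairingD[OF assms] by (auto simp: diagram_of_def)
  show "disjnt p q" if pq: "p \<in> diagram_of n f" "q \<in> diagram_of n f" "p \<noteq> q" for p q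
  proof -
    obtain P Q where PQ: "P \<in> points n" "Q \<in> points n" "p = {P, f P}" "q = {Q, f Q}"
      using pq(1,2) unfolding diagram_of_def by blast
    have "{R, f R} = {x, f x}" if "R \<in> points n" "x \<in> {R, f R}" for R x
      using that pairingD(2)[OF assms that(1)] by (auto simp: insert_commute)
    then have "x \<in> p \<Longrightarrow> x \<in> q \<Longrightarrow> p = q" for x using PQ by metis
    then show ?thesis using pq(3) unfolding disjnt_def by blast
  qed
  show "{} \<notin> diagram_of n f" by (auto simp: diagram_of_def)
  show "\<forall>b\<in>diagram_of n f. card b = 2"
    using pairingD(3)[OF assms] by (auto simp: diagram_of_def eq_commute[of "f _"])
qed

lemma stack_edges_diagram_of:
  assumes "pairing n f"
  shows "(x, y) \<in> stack_edges a (diagram_of n f) \<longleftrightarrow>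
     (\<exists>u v. {u, v} \<in> a \<and> x = place_above u \<and> y = place_above v) \<or>
     (\<exists>P\<in>points n. x = place_below P \<and> y = place_below (f P))"
  by (auto simp: stack_edges_def in_diagram_of[OF assms])

lemma stack_edges_sym: "(x, y) \<in> stack_edges a b \<Longrightarrow> (y, x) \<in> stack_edges a b"
  unfolding stack_edges_def by (auto simp: insert_commute; metis insert_commute)

lemma label_constant:
  assumes "\<And>x y. (x, y) \<in> E \<Longrightarrow> l x = l y" "(x, y) \<in> E\<^sup>*"
  shows "l x = l y"
  using assms(2) by (induction rule: rtrancl_induct) (use assms(1) in auto)

text \<open>Paths show that \<open>P\<close> and \<open>f P\<close> are connected. That nothing else
  is connected to them is certified by a labelling \<open>l\<close> of the vertices: it is constant
  along edges, and on outer points it determines the strand.\<close>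

lemma stack_eqI:
  assumes f: "pairing n f"
    and conn: "\<And>P. P \<in> points n \<Longrightarrow> (place_outer P, place_outer (f P)) \<in> (stack_edges a b)\<^sup>*"
    and edge: "\<And>x y. (x, y) \<in> stack_edges a b \<Longrightarrow> l x = l y"
    and label: "\<And>P. P \<in> points n \<Longrightarrow> l (place_outer P) = {P, f P}"
  shows "stack n a b = diagram_of n f"
proof (intro equalityI subsetI)
  fix x assume "x \<in> stack n a b"
  then obtain u v where uv: "x = {u, v}" "u \<in> points n" "v \<in> points n" "u \<noteq> v"
     "(place_outer u, place_outer v) \<in> (stack_edges a b)\<^sup>*" by (auto simp: stack_def)
  have "l (place_outer u) = l (place_outer v)" by (rule label_constant[OF edge uv(5)])
  then have "{u, f u} = {v, f v}" using label uv by simp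
  then have "v = f u" using uv(4) by auto
  with uv show "x \<in> diagram_of n f" by (auto simp: diagram_of_def)
next
  fix x assume "x \<in> diagram_of n f"
  then obtain P where "P \<in> points n" "x = {P, f P}" by (auto simp: diagram_of_def)
  then show "x \<in> stack n a b" using conn[of P] pairingD(1,3)[OF f, of P] unfolding stack_def
    by (intro CollectI exI[of _ P] exI[of _ "f P"]) auto
qed

section \<open>The effect of one generator on a pairing\<close>

definition surgery :: "(point \<Rightarrow> point) \<Rightarrow> point \<Rightarrow> point \<Rightarrow> point \<Rightarrow> point" where
  "surgery f A B P = (if P = A then B else if P = B then A
     else if P = f A then f B else if P = f B then f A else f P)"

lemma surgery_commute: "pairing n f \<Longrightarrow> A \<in> points n \<Longrightarrow> B \<in> points n \<Longrightarrow> surgery f A B = surgery f B A"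
  by (auto simp: surgery_def fun_eq_iff)

lemma pairing_surgery:
  assumes "pairing n f" "A \<in> points n" "B \<in> points n" "A \<noteq> B" "f A \<noteq> B"
  shows "pairing n (surgery f A B)"
  unfolding pairing_def
proof (intro ballI)
  fix P assume P: "P \<in> points n"
  have inj: "f Q = f R \<longleftrightarrow> Q = R" "f Q = R \<longleftrightarrow> Q = f R" if "Q \<in> points n" "R \<in> points n" for Q R
    using that pairingD(2)[OF assms(1)] by metis+
  note D = pairingD[OF assms(1)]
  have A: "f A \<noteq> A" "f A \<in> points n" "f (f A) = A" and B: "f B \<noteq> B" "f B \<in> points n" "f (f B) = B" "f B \<noteq> A"
    and PP: "f P \<noteq> P" "f P \<in> points n" "f (f P) = P"
    and ABn: "f A \<noteq> f B" "f P = f A \<longleftrightarrow> P = A" "f P = f B \<longleftrightarrow> P = B" "f P = A \<longleftrightarrow> P = f A" "f P = B \<longleftrightarrow> P = f B"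
    using assms P D inj by auto
  consider "P = A" | "P = B" | "P = f A" "P \<noteq> B" "P \<noteq> A" | "P = f B" "P \<noteq> B" "P \<noteq> A"
    | "P \<noteq> A" "P \<noteq> B" "P \<noteq> f A" "P \<noteq> f B" by blast
  then show "surgery f A B P \<in> points n \<and> surgery f A B (surgery f A B P) = P \<and> surgery f A B P \<noteq> P"
    by cases (use assms A B PP ABn in \<open>auto simp: surgery_def\<close>)
qed

fun relabel :: "(nat \<Rightarrow> nat) \<Rightarrow> (nat \<Rightarrow> nat) \<Rightarrow> point \<Rightarrow> point" where
  "relabel p q (Top j) = Top (p j)"
| "relabel p q (Bot j) = Bot (q j)"

lemma relabel_comp: "relabel p q (relabel p' q' P) = relabel (p \<circ> p') (q \<circ> q') P"
  by (cases P) auto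

lemma relabel_id: "relabel id id P = P"
  by (cases P) auto

lemma relabel_points:
  "p permutes {1..n} \<Longrightarrow> q permutes {1..n} \<Longrightarrow> relabel p q P \<in> points n \<longleftrightarrow> P \<in> points n"
  using permutes_in_image[of p "{1..n}"] permutes_in_image[of q "{1..n}"] by (cases P) auto

lemma relabel_inverse:
  assumes "p permutes S" "q permutes S"
  shows "relabel p q (relabel (pinv p) (pinv q) P) = P" "relabel (pinv p) (pinv q) (relabel p q P) = P"
  using permutes_inv_o[OF assms(1)] permutes_inv_o[OF assms(2)] by (auto simp: relabel_comp relabel_id)

lemma stack_cross:
  assumes f: "pairing n f" and i: "1 \<le> i" "i < n"
  defines "sw \<equiv> relabel (transpose i (i + 1)) id"
  shows "stack n (cross_diagram n i) (diagram_of n f) = diagram_of n (sw \<circ> f \<circ> sw)"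
    "pairing n (sw \<circ> f \<circ> sw)"
proof -
  let ?t = "transpose i (i + 1)"
  let ?E = "stack_edges (cross_diagram n i) (diagram_of n f)"
  have t: "?t permutes {1..n}" using i by (intro permutes_swap_id) auto
  have sw: "sw (sw P) = P" "sw P \<in> points n \<longleftrightarrow> P \<in> points n" for P
    unfolding sw_def relabel_points[OF t permutes_id] by (simp_all add: relabel_comp relabel_id)
  show pf: "pairing n (sw \<circ> f \<circ> sw)"
    unfolding pairing_def
  proof
    fix P assume "P \<in> points n"
    then have P: "sw P \<in> points n" using sw by simp
    have "sw (f (sw P)) = P \<Longrightarrow> f (sw P) = sw P" by (metis sw(1))
    then show "(sw \<circ> f \<circ> sw) P \<in> points n \<and> (sw \<circ> f \<circ> sw) ((sw \<circ> f \<circ> sw) P) = P \<and> (sw \<circ> f \<circ> sw) P \<noteq> P"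
      using pairingD[OF f P] sw by auto
  qed
  have cross: "cross_diagram n i = (\<lambda>j. {Bot j, Top (?t j)}) ` {1..n}"
  proof -
    have "{1..n} = insert i (insert (i + 1) ({1..n} - {i, i + 1}))" using i by auto
    from arg_cong[OF this, of "image (\<lambda>j. {Bot j, Top (?t j)})"]
    have "(\<lambda>j. {Bot j, Top (?t j)}) ` {1..n} = insert {Bot i, Top (?t i)} (insert {Bot (i + 1), Top (?t (i + 1))}
       ((\<lambda>j. {Bot j, Top (?t j)}) ` ({1..n} - {i, i + 1})))" by (simp only: image_insert)
    also have "(\<lambda>j. {Bot j, Top (?t j)}) ` ({1..n} - {i, i + 1}) = verticals ({1..n} - {i, i + 1})"
      unfolding verticals_def by (intro image_cong) (auto simp: transpose_def)
    finally show ?thesis by (simp add: cross_diagram_def)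
  qed
  \<comment> \<open>Each vertex is labelled by the two ends of the strand through it. A middle
    vertex sits below the crossing, so its points are transported by \<open>sw\<close>.\<close>
  define l where "l x = (case x of Upper j \<Rightarrow> {Top j, sw (f (sw (Top j)))}
     | Middle j \<Rightarrow> {sw (Top j), sw (f (Top j))} | Lower j \<Rightarrow> {Bot j, sw (f (sw (Bot j)))})" for x
  have lb: "l (place_below P) = {sw P, sw (f P)}" for P by (cases P) (auto simp: l_def sw_def)
  have up: "(place_outer P, place_below (sw P)) \<in> ?E\<^sup>*" "(place_below (sw P), place_outer P) \<in> ?E\<^sup>*"
    if "P \<in> points n" for P
  proof -
    show "(place_outer P, place_below (sw P)) \<in> ?E\<^sup>*"
    proof (cases P)
      case (Top j)
      then have "?t j \<in> {1..n}" using that permutes_in_image[OF t, of j] by auto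
      then have "{Bot (?t j), Top j} \<in> cross_diagram n i" unfolding cross by force
      then have "{Top j, Bot (?t j)} \<in> cross_diagram n i" by (simp add: insert_commute)
      then have "(place_above (Top j), place_above (Bot (?t j))) \<in> ?E" unfolding stack_edges_def by blast
      then show ?thesis using Top by (auto simp: sw_def)
    qed (auto simp: sw_def)
    then show "(place_below (sw P), place_outer P) \<in> ?E\<^sup>*"
      using stack_edges_sym by (metis (no_types, lifting) sym_def sym_rtrancl)
  qed
  show "stack n (cross_diagram n i) (diagram_of n f) = diagram_of n (sw \<circ> f \<circ> sw)"
  proof (rule stack_eqI[OF pf, where l = l])
    fix P assume P: "P \<in> points n"
    have "(place_below (sw P), place_below (f (sw P))) \<in> ?E"
      using P sw by (auto simp: stack_edges_diagram_of[OF f])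
    moreover have "(place_below (f (sw P)), place_outer (sw (f (sw P)))) \<in> ?E\<^sup>*"
      using up(2)[of "sw (f (sw P))"] sw pairingD(1)[OF f] P by simp
    ultimately show "(place_outer P, place_outer ((sw \<circ> f \<circ> sw) P)) \<in> ?E\<^sup>*"
      using up(1)[OF P] by simp
    show "l (place_outer P) = {P, (sw \<circ> f \<circ> sw) P}"
      by (cases P) (auto simp: l_def)
  next
    fix x y assume "(x, y) \<in> ?E"
    then consider u v where "{u, v} \<in> cross_diagram n i" "x = place_above u" "y = place_above v"
      | P where "P \<in> points n" "x = place_below P" "y = place_below (f P)"
      unfolding stack_edges_diagram_of[OF f] by blast
    then show "l x = l y"
    proof cases
      case 1
      then obtain j where "{u, v} = {Bot j, Top (?t j)}" unfolding cross by auto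
      then have "(u = Bot j \<and> v = Top (?t j)) \<or> (v = Bot j \<and> u = Top (?t j))" by (auto simp: doubleton_eq_iff)
      then show ?thesis using 1 by (auto simp: l_def sw_def)
    next
      case 2
      then show ?thesis using lb pairingD(2)[OF f] by (simp add: insert_commute)
    qed
  qed
qed

text \<open>The cup creates a strand between the top points \<open>i\<close> and
  \<open>i + 1\<close>, and the cap links the strands of \<open>f\<close> that ended there, so their
  other ends become partners: this is \<open>surgery\<close>. The premise on
  \<open>f (Top i)\<close> excludes the closed loop.\<close>

lemma stack_cupcap:
  assumes f: "pairing n f" and i: "1 \<le> i" "i < n" and nl: "f (Top i) \<noteq> Top (i + 1)"
  defines "g \<equiv> surgery f (Top i) (Top (i + 1))"
  shows "stack n (cupcap_diagram n i) (diagram_of n f) = diagram_of n g" "pairing n g"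
proof -
  let ?E = "stack_edges (cupcap_diagram n i) (diagram_of n f)"
  let ?A = "Top i" and ?B = "Top (i + 1)"
  have AB: "?A \<in> points n" "?B \<in> points n" "?A \<noteq> ?B" using i by auto
  show pg: "pairing n g" unfolding g_def by (rule pairing_surgery[OF f AB nl])
  note D = pairingD[OF f]
  have fB: "f ?B \<noteq> ?A" using D(2)[OF AB(2)] nl by auto
  \<comment> \<open>The middle points \<open>i\<close> and \<open>i + 1\<close> lie on the strand
    produced by the cap; every other middle point continues the upper point above it.\<close>
  define l where "l x = (case x of Upper j \<Rightarrow> {Top j, g (Top j)}
     | Middle j \<Rightarrow> (if j = i \<or> j = i + 1 then {f ?A, f ?B} else {Top j, g (Top j)}) | Lower j \<Rightarrow> {Bot j, g (Bot j)})" for x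
  have fn: "f ?A \<noteq> ?A" "f ?B \<noteq> ?B" "f ?A \<noteq> f ?B" using D(2,3) AB by metis+
  have gA: "g (f ?A) = f ?B" "g (f ?B) = f ?A" "g ?A = ?B" "g ?B = ?A"
    unfolding g_def surgery_def using fn nl fB by auto
  have lb: "l (place_below P) = {P, g P}" if "P \<noteq> ?A" "P \<noteq> ?B" for P
    using that by (cases P) (auto simp: l_def)
  have lb2: "l (place_below ?A) = {f ?A, f ?B}" "l (place_below ?B) = {f ?A, f ?B}" by (auto simp: l_def)
  have vert: "(Upper j, Middle j) \<in> ?E" "(Middle j, Upper j) \<in> ?E" if "1 \<le> j" "j \<le> n" "j \<noteq> i" "j \<noteq> i + 1" for j
  proof -
    have "{Bot j, Top j} \<in> cupcap_diagram n i" using that by (auto simp: cupcap_diagram_def verticals_def)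
    then have "(place_above (Bot j), place_above (Top j)) \<in> ?E" unfolding stack_edges_def by blast
    then show "(Middle j, Upper j) \<in> ?E" by simp
    then show "(Upper j, Middle j) \<in> ?E" by (rule stack_edges_sym)
  qed
  have cup: "(Upper i, Upper (i + 1)) \<in> ?E"
  proof -
    have "{Top i, Top (i + 1)} \<in> cupcap_diagram n i" by (auto simp: cupcap_diagram_def)
    then have "(place_above (Top i), place_above (Top (i + 1))) \<in> ?E" unfolding stack_edges_def by blast
    then show ?thesis by simp
  qed
  have cap: "(Middle i, Middle (i + 1)) \<in> ?E"
  proof -
    have "{Bot i, Bot (i + 1)} \<in> cupcap_diagram n i" by (auto simp: cupcap_diagram_def)
    then have "(place_above (Bot i), place_above (Bot (i + 1))) \<in> ?E" unfolding stack_edges_def by blast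
    then show ?thesis by simp
  qed
  have low: "(place_below P, place_below (f P)) \<in> ?E" if "P \<in> points n" for P
    using that by (auto simp: stack_edges_diagram_of[OF f])
  have sym: "(y, x) \<in> ?E\<^sup>*" if "(x, y) \<in> ?E\<^sup>*" for x y
    using that stack_edges_sym by (metis (no_types, lifting) sym_def sym_rtrancl)
  have up: "(place_outer P, place_below P) \<in> ?E\<^sup>*" if "P \<in> points n" "P \<noteq> ?A" "P \<noteq> ?B" for P
    using that vert by (cases P) auto
  have fAfB: "(place_outer (f ?A), place_outer (f ?B)) \<in> ?E\<^sup>*"
  proof -
    have "(place_outer (f ?A), place_below (f ?A)) \<in> ?E\<^sup>*" using up D(1)[OF AB(1)] fn nl by auto
    also have "(place_below (f ?A), place_below ?A) \<in> ?E\<^sup>*" using low[of "f ?A"] D(1,2)[OF AB(1)] by auto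
    also have "(place_below ?A, place_below ?B) \<in> ?E\<^sup>*" using cap by auto
    also have "(place_below ?B, place_below (f ?B)) \<in> ?E\<^sup>*" using low[OF AB(2)] by auto
    also have "(place_below (f ?B), place_outer (f ?B)) \<in> ?E\<^sup>*" using sym[OF up] D(1)[OF AB(2)] fn fB by auto
    finally show ?thesis .
  qed
  show "stack n (cupcap_diagram n i) (diagram_of n f) = diagram_of n g"
  proof (rule stack_eqI[OF pg, where l = l])
    fix P assume P: "P \<in> points n"
    consider "P = ?A" | "P = ?B" | "P = f ?A" "P \<noteq> ?A" "P \<noteq> ?B" | "P = f ?B" "P \<noteq> ?A" "P \<noteq> ?B"
      | "P \<noteq> ?A" "P \<noteq> ?B" "P \<noteq> f ?A" "P \<noteq> f ?B" by blast
    then show "(place_outer P, place_outer (g P)) \<in> ?E\<^sup>*"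
    proof cases
      case 1
      then show ?thesis using cup gA by auto
    next
      case 2
      then show ?thesis using stack_edges_sym[OF cup] gA by auto
    next
      case 3
      then show ?thesis using fAfB gA by auto
    next
      case 4
      then show ?thesis using sym[OF fAfB] gA by auto
    next
      case 5
      then have g: "g P = f P" by (auto simp: g_def surgery_def)
      have "f P \<noteq> ?A" "f P \<noteq> ?B" using 5 D(2)[OF P] by auto
      then have "(place_below (f P), place_outer (f P)) \<in> ?E\<^sup>*" using sym[OF up] D(1)[OF P] by auto
      then show ?thesis using up[OF P 5(1,2)] low[OF P] g by (metis (no_types, lifting) rtrancl.rtrancl_into_rtrancl rtrancl_trans)
    qed
    show "l (place_outer P) = {P, g P}" by (cases P) (auto simp: l_def)
  next
    fix x y assume "(x, y) \<in> ?E"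
    then consider u v where "{u, v} \<in> cupcap_diagram n i" "x = place_above u" "y = place_above v"
      | P where "P \<in> points n" "x = place_below P" "y = place_below (f P)"
      unfolding stack_edges_diagram_of[OF f] by blast
    then show "l x = l y"
    proof cases
      case 1
      then consider "{u, v} = {Top i, Top (i + 1)}" | "{u, v} = {Bot i, Bot (i + 1)}"
        | j where "j \<noteq> i" "j \<noteq> i + 1" "{u, v} = {Bot j, Top j}"
        by (auto simp: cupcap_diagram_def verticals_def)
      then show ?thesis
        using 1(2,3) gA by cases (auto simp: doubleton_eq_iff l_def)
    next
      case 2
      have e: "{f P, g (f P)} = {P, g P}" if "f P \<noteq> ?A" "f P \<noteq> ?B" "P \<noteq> ?A" "P \<noteq> ?B"
      proof -
        have "P \<noteq> f ?A" "P \<noteq> f ?B" using that D(2) AB by metis+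
        then have "g P = f P" using that by (auto simp: g_def surgery_def)
        moreover have "f P \<noteq> f ?A" "f P \<noteq> f ?B" using that D(2) AB 2(1) by metis+
        ultimately show ?thesis using that D(2)[OF 2(1)] by (auto simp: g_def surgery_def)
      qed
      consider "P = ?A" | "P = ?B" | "f P = ?A" "P \<noteq> ?A" "P \<noteq> ?B" | "f P = ?B" "P \<noteq> ?A" "P \<noteq> ?B"
        | "f P \<noteq> ?A" "f P \<noteq> ?B" "P \<noteq> ?A" "P \<noteq> ?B" by blast
      then show ?thesis
      proof cases
        case 3
        then have "P = f ?A" using D(2)[OF 2(1)] by simp
        then show ?thesis using 2 3 lb[of P] lb2 gA by simp
      next
        case 4
        then have "P = f ?B" using D(2)[OF 2(1)] by simp
        then show ?thesis using 2 4 lb[of P] lb2 gA by (simp add: insert_commute)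
      qed (use 2 lb lb2 gA fn nl fB e in \<open>auto simp: insert_commute\<close>)
    qed
  qed
qed

text \<open>The middle points \<open>i\<close> and \<open>i + 1\<close> then form a connected
  component of their own, without outer points.\<close>

lemma not_loop_free:
  assumes f: "pairing n f" and i: "1 \<le> i" "i < n" and l: "f (Top i) = Top (i + 1)"
  shows "\<not> loop_free n (cupcap_diagram n i) (diagram_of n f)"
proof
  let ?E = "stack_edges (cupcap_diagram n i) (diagram_of n f)"
  let ?S = "{Middle i, Middle (i + 1)}"
  have l': "f (Top (i + 1)) = Top i" using pairingD(2)[OF f, of "Top i"] i l by simp
  have pb: "place_below P \<in> ?S \<longleftrightarrow> P \<in> {Top i, Top (i + 1)}" for P by (cases P) auto
  assume "loop_free n (cupcap_diagram n i) (diagram_of n f)"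
  then have "\<exists>u\<in>points n. (Middle i, place_outer u) \<in> ?E\<^sup>*" using i by (simp add: loop_free_def)
  then obtain u where u: "(Middle i, place_outer u) \<in> ?E\<^sup>*" by blast
  have "(Middle i \<in> ?S) = (place_outer u \<in> ?S)"
  proof (rule label_constant[OF _ u])
    fix x y assume "(x, y) \<in> ?E"
    then consider u v where "{u, v} \<in> cupcap_diagram n i" "x = place_above u" "y = place_above v"
      | P where "P \<in> points n" "x = place_below P" "y = place_below (f P)"
      unfolding stack_edges_diagram_of[OF f] by blast
    then show "(x \<in> ?S) = (y \<in> ?S)"
    proof cases
      case 1
      then consider "{u, v} = {Top i, Top (i + 1)}" | "{u, v} = {Bot i, Bot (i + 1)}"
        | j where "j \<noteq> i" "j \<noteq> i + 1" "{u, v} = {Bot j, Top j}"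
        by (auto simp: cupcap_diagram_def verticals_def)
      then show ?thesis using 1(2,3) by cases (auto simp: doubleton_eq_iff)
    next
      case 2
      have "f P \<in> {Top i, Top (i + 1)} \<longleftrightarrow> P \<in> {Top i, Top (i + 1)}"
        using l l' pairingD(2)[OF f 2(1)] by auto
      then show ?thesis using 2 pb by simp
    qed
  qed
  then show False by (cases u) auto
qed

section \<open>The diagrams of normal words\<close>

fun base_pairing :: "nat \<Rightarrow> point \<Rightarrow> point" where
  "base_pairing r (Top j) = (if j \<le> 2 * r then Top (mate j) else Bot j)"
| "base_pairing r (Bot j) = (if j \<le> 2 * r then Bot (mate j) else Top j)"

text \<open>The pairing of the diagram of \<open>normal_word n \<sigma> r \<tau>\<close>. The
  inverse of \<open>\<tau>\<close> occurs because a strand of the lower permutation runs from the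
  bottom point \<open>x\<close> up to \<open>\<tau> x\<close>.\<close>

definition word_pairing :: "(nat \<Rightarrow> nat) \<Rightarrow> nat \<Rightarrow> (nat \<Rightarrow> nat) \<Rightarrow> point \<Rightarrow> point" where
  "word_pairing \<sigma> r \<tau> P = relabel \<sigma> (pinv \<tau>) (base_pairing r (relabel (pinv \<sigma>) \<tau> P))"

lemma pairing_base: "2 * r \<le> n \<Longrightarrow> pairing n (base_pairing r)"
  unfolding pairing_def
proof
  fix P assume "2 * r \<le> n" "P \<in> points n"
  then show "base_pairing r P \<in> points n \<and> base_pairing r (base_pairing r P) = P \<and> base_pairing r P \<noteq> P"
  proof (cases P)
    case (Top j)
    then show ?thesis using mate_props[of j r] \<open>P \<in> points n\<close> \<open>2 * r \<le> n\<close> by (cases "j \<le> 2 * r") auto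
  next
    case (Bot j)
    then show ?thesis using mate_props[of j r] \<open>P \<in> points n\<close> \<open>2 * r \<le> n\<close> by (cases "j \<le> 2 * r") auto
  qed
qed

lemma word_pairing_relabel:
  assumes "\<sigma> permutes {1..n}" "\<tau> permutes {1..n}"
  shows "word_pairing \<sigma> r \<tau> (relabel \<sigma> (pinv \<tau>) P) = relabel \<sigma> (pinv \<tau>) (base_pairing r P)"
  unfolding word_pairing_def
  using relabel_inverse(2)[OF assms(1) permutes_inv[OF assms(2)]] permutes_inv_inv[OF assms(2)] by simp

lemma relabel_obtain:
  assumes "\<sigma> permutes {1..n}" "\<tau> permutes {1..n}" "P \<in> points n"
  obtains Q where "Q \<in> points n" "P = relabel \<sigma> (pinv \<tau>) Q"
  using relabel_inverse(1)[OF assms(1) permutes_inv[OF assms(2)], of P]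
    relabel_points[OF permutes_inv[OF assms(1)] permutes_inv[OF permutes_inv[OF assms(2)]], of P] assms(3)
  by metis

lemma relabel_inj:
  assumes "\<sigma> permutes {1..n}" "\<tau> permutes {1..n}"
  shows "relabel \<sigma> (pinv \<tau>) P = relabel \<sigma> (pinv \<tau>) Q \<longleftrightarrow> P = Q"
  using relabel_inverse(2)[OF assms(1) permutes_inv[OF assms(2)]] by metis

lemma pairing_word:
  assumes "\<sigma> permutes {1..n}" "\<tau> permutes {1..n}" "2 * r \<le> n"
  shows "pairing n (word_pairing \<sigma> r \<tau>)"
  unfolding pairing_def
proof
  fix P assume "P \<in> points n"
  then obtain Q where Q: "Q \<in> points n" "P = relabel \<sigma> (pinv \<tau>) Q" using relabel_obtain assms by blast
  note b = pairingD[OF pairing_base[OF assms(3)] Q(1)]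
  show "word_pairing \<sigma> r \<tau> P \<in> points n \<and> word_pairing \<sigma> r \<tau> (word_pairing \<sigma> r \<tau> P) = P \<and> word_pairing \<sigma> r \<tau> P \<noteq> P"
    using Q b word_pairing_relabel[OF assms(1,2)] relabel_points[OF assms(1) permutes_inv[OF assms(2)]]
      relabel_inj[OF assms(1,2)] by simp
qed

lemma surgery_relabel:
  assumes "\<sigma> permutes {1..n}" "\<tau> permutes {1..n}"
  shows "surgery (word_pairing \<sigma> r \<tau>) (relabel \<sigma> (pinv \<tau>) A) (relabel \<sigma> (pinv \<tau>) B) (relabel \<sigma> (pinv \<tau>) P)
      = relabel \<sigma> (pinv \<tau>) (surgery (base_pairing r) A B P)"
  by (simp add: surgery_def word_pairing_relabel[OF assms] relabel_inj[OF assms])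

text \<open>The diagrammatic counterpart of \<open>left_slide\<close>, with the same
  three-cycle.\<close>

lemma surgery_slide:
  assumes \<sigma>: "\<sigma> permutes {1..n}" and \<tau>: "\<tau> permutes {1..n}" and r: "2 * r \<le> n"
    and a: "1 \<le> a" "a \<le> 2 * r" and b: "1 \<le> b" "b \<le> n" "b \<noteq> a" "b \<noteq> mate a" and P: "P \<in> points n"
  shows "word_pairing (\<sigma> \<circ> three_cycle (mate a) a b) r \<tau> P
    = surgery (word_pairing \<sigma> r \<tau>) (Top (\<sigma> a)) (Top (\<sigma> b)) P"
proof -
  let ?c = "mate a"
  let ?\<gamma> = "three_cycle ?c a b"
  note m = mate_props[OF a]
  have \<gamma>: "?\<gamma> permutes {1..n}" using a b m r by (intro three_cycle_permutes) auto
  have \<sigma>\<gamma>: "(\<sigma> \<circ> ?\<gamma>) permutes {1..n}" using \<sigma> \<gamma> permutes_compose by blast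
  obtain Q where Q: "Q \<in> points n" "P = relabel (\<sigma> \<circ> ?\<gamma>) (pinv \<tau>) Q" using relabel_obtain[OF \<sigma>\<gamma> \<tau> P] by blast
  let ?g = "relabel ?\<gamma> id"
  have P': "P = relabel \<sigma> (pinv \<tau>) (?g Q)" using Q by (simp add: relabel_comp)
  have tc: "?\<gamma> x = (if x = ?c then a else if x = a then b else if x = b then ?c else x)" for x
    using b m by (intro three_cycle) auto
  have mb: "b \<le> 2 * r \<Longrightarrow> mate b \<noteq> a \<and> mate b \<noteq> ?c \<and> mate b \<noteq> b \<and> mate (mate b) = b"
    using mate_props[OF b(1), of r] b m by metis
  have g: "?\<gamma> ?c = a" "?\<gamma> a = b" "?\<gamma> b = ?c" "\<And>x. x \<noteq> ?c \<Longrightarrow> x \<noteq> a \<Longrightarrow> x \<noteq> b \<Longrightarrow> ?\<gamma> x = x"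
    using tc b m by auto
  \<comment> \<open>With \<open>\<sigma>\<close> and \<open>\<tau>\<close> stripped off, the claim
    concerns \<open>base_pairing r\<close> alone; what varies is whether \<open>b\<close> and the
    point considered belong to arcs or to through strands.\<close>
  have core: "surgery (base_pairing r) (Top a) (Top b) (?g Q) = ?g (base_pairing r Q)"
  proof (cases Q)
    case (Top x)
    then have x: "1 \<le> x" "x \<le> n" using Q by auto
    have mm: "x \<le> 2 * r \<Longrightarrow> mate (mate x) = x" using mate_props x by blast
    consider "x = ?c" | "x = a" | "x = b" | "x \<noteq> ?c" "x \<noteq> a" "x \<noteq> b" by blast
    then show ?thesis
    proof cases
      case 1
      then show ?thesis unfolding Top relabel.simps 1 g using a m b g by (simp add: surgery_def)
    next
      case 2
      then show ?thesis unfolding Top relabel.simps 2 g using a m b g by (simp add: surgery_def)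
    next
      case 3
      then show ?thesis unfolding Top relabel.simps 3 g using a m b g mb
        by (cases "b \<le> 2 * r") (simp_all add: surgery_def)
    next
      case 4
      have "x \<le> 2 * r \<Longrightarrow> mate x \<noteq> a \<and> mate x \<noteq> ?c" using mm 4 m by auto
      moreover have "x \<le> 2 * r \<Longrightarrow> b \<le> 2 * r \<Longrightarrow> x = mate b \<longleftrightarrow> mate x = b" using mm mb by metis
      moreover have "x \<le> 2 * r \<Longrightarrow> mate x = b \<Longrightarrow> b \<le> 2 * r" using mate_props(3)[OF x(1)] by blast
      moreover have "b \<le> 2 * r \<Longrightarrow> mate b \<le> 2 * r" using mate_props(3)[OF b(1)] .
      ultimately have d: "x \<le> 2 * r \<Longrightarrow> mate x \<noteq> a \<and> mate x \<noteq> ?c"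
        "x \<le> 2 * r \<Longrightarrow> mate x = b \<Longrightarrow> b \<le> 2 * r \<and> x = mate b"
        "x \<le> 2 * r \<Longrightarrow> mate x \<noteq> b \<Longrightarrow> b \<le> 2 * r \<Longrightarrow> x \<noteq> mate b"
        "\<not> x \<le> 2 * r \<Longrightarrow> b \<le> 2 * r \<Longrightarrow> x \<noteq> mate b" by auto
      consider "x \<le> 2 * r" "mate x = b" | "x \<le> 2 * r" "mate x \<noteq> b" | "\<not> x \<le> 2 * r" by blast
      then show ?thesis
      proof cases
        case 1
        then show ?thesis unfolding Top relabel.simps g(4)[OF 4] using 4 a g(3) d(2) by (simp add: surgery_def)
      next
        case 2
        then show ?thesis unfolding Top relabel.simps g(4)[OF 4] using 4 a d(1,3) g(4)[of "mate x"]
          by (simp add: surgery_def)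
      next
        case 3
        then show ?thesis unfolding Top relabel.simps g(4)[OF 4] using 4 a d(4) by (simp add: surgery_def)
      qed
    qed
  next
    case (Bot x)
    then have x: "1 \<le> x" "x \<le> n" using Q by auto
    consider "x \<le> 2 * r" | "\<not> x \<le> 2 * r" "x = b" | "\<not> x \<le> 2 * r" "x \<noteq> b" by blast
    then show ?thesis
    proof cases
      case 1
      then show ?thesis unfolding Bot using a by (auto simp: surgery_def)
    next
      case 2
      then show ?thesis unfolding Bot using a g(3) by (simp add: surgery_def)
    next
      case 3
      then have "x \<noteq> ?c" "x \<noteq> a" using a m by auto
      then show ?thesis unfolding Bot using 3 a g(4)[of x] by (simp add: surgery_def)
    qed
  qed
  have "word_pairing (\<sigma> \<circ> ?\<gamma>) r \<tau> P = relabel \<sigma> (pinv \<tau>) (?g (base_pairing r Q))"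
    unfolding Q(2) word_pairing_relabel[OF \<sigma>\<gamma> \<tau>] by (simp add: relabel_comp)
  also have "\<dots> = surgery (word_pairing \<sigma> r \<tau>) (Top (\<sigma> a)) (Top (\<sigma> b)) P"
    unfolding P' core[symmetric] surgery_relabel[OF \<sigma> \<tau>, symmetric] by simp
  finally show ?thesis .
qed

text \<open>The diagrammatic counterpart of \<open>left_new\<close>; the inverse of
  \<open>\<rho>\<close> enters the lower permutation because the two caps points that are joined are
  the lower ends of the former through strands.\<close>

lemma surgery_new:
  assumes \<sigma>: "\<sigma> permutes {1..n}" and \<tau>: "\<tau> permutes {1..n}" and r: "2 * r + 2 \<le> n"
    and \<rho>: "\<rho> permutes {1..n}" "\<forall>j\<in>{1..2 * r}. \<rho> j = j" and P: "P \<in> points n"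
  shows "word_pairing (\<sigma> \<circ> \<rho>) (r + 1) (pinv \<rho> \<circ> \<tau>) P
    = surgery (word_pairing \<sigma> r \<tau>) (Top (\<sigma> (\<rho> (2 * r + 1)))) (Top (\<sigma> (\<rho> (2 * r + 2)))) P"
proof -
  have \<sigma>\<rho>: "(\<sigma> \<circ> \<rho>) permutes {1..n}" using \<sigma> \<rho> permutes_compose by blast
  have \<rho>\<tau>: "(pinv \<rho> \<circ> \<tau>) permutes {1..n}" using \<tau> permutes_inv[OF \<rho>(1)] permutes_compose by blast
  have inv: "pinv (pinv \<rho> \<circ> \<tau>) = pinv \<tau> \<circ> \<rho>"
    using o_inv_distrib[of "pinv \<rho>" \<tau>] permutes_bij[OF \<tau>] permutes_bij[OF permutes_inv[OF \<rho>(1)]]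
      permutes_inv_inv[OF \<rho>(1)] by simp
  obtain Q where Q: "Q \<in> points n" "P = relabel (\<sigma> \<circ> \<rho>) (pinv \<tau> \<circ> \<rho>) Q"
    using relabel_obtain[OF \<sigma>\<rho> \<rho>\<tau> P] inv by metis
  let ?g = "relabel \<rho> \<rho>"
  have P': "P = relabel \<sigma> (pinv \<tau>) (?g Q)" using Q by (simp add: relabel_comp)
  have inj: "\<rho> x = \<rho> y \<longleftrightarrow> x = y" for x y using permutes_inj[OF \<rho>(1)] by (auto dest: injD)
  have small: "\<rho> x \<le> 2 * r \<longleftrightarrow> x \<le> 2 * r" if "1 \<le> x" "x \<le> n" for x
  proof
    assume "\<rho> x \<le> 2 * r"
    moreover have "1 \<le> \<rho> x" using permutes_in_image[OF \<rho>(1), of x] that by auto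
    ultimately have "\<rho> (\<rho> x) = \<rho> x" using \<rho>(2) by simp
    then show "x \<le> 2 * r" using inj \<open>\<rho> x \<le> 2 * r\<close> by simp
  qed (use \<rho> that in auto)
  have core: "surgery (base_pairing r) (Top (\<rho> (2 * r + 1))) (Top (\<rho> (2 * r + 2))) (?g Q) = ?g (base_pairing (r + 1) Q)"
  proof -
    have s: "\<not> \<rho> (2 * r + 1) \<le> 2 * r" "\<not> \<rho> (2 * r + 2) \<le> 2 * r" using small r by auto
    obtain x where x: "Q = Top x \<or> Q = Bot x" "1 \<le> x" "x \<le> n" using Q by (cases Q) auto
    consider "x \<le> 2 * r" | "x = 2 * r + 1" | "x = 2 * r + 2" | "2 * r + 2 < x" by linarith
    then show ?thesis
    proof cases
      case 1
      then have "\<rho> x = x" "\<rho> (mate x) = mate x" using \<rho>(2) x mate_props[OF x(2), of r] by auto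
      then show ?thesis using x 1 inj s by (auto simp: surgery_def)
    next
      case 4
      then show ?thesis using x inj s small[of x] by (auto simp: surgery_def)
    qed (use x inj s in \<open>auto simp: surgery_def\<close>)
  qed
  have "word_pairing (\<sigma> \<circ> \<rho>) (r + 1) (pinv \<rho> \<circ> \<tau>) P = relabel \<sigma> (pinv \<tau>) (?g (base_pairing (r + 1) Q))"
    using word_pairing_relabel[OF \<sigma>\<rho> \<rho>\<tau>, of "r + 1" Q] Q(2) by (simp add: relabel_comp inv)
  also have "\<dots> = surgery (word_pairing \<sigma> r \<tau>) (Top (\<sigma> (\<rho> (2 * r + 1)))) (Top (\<sigma> (\<rho> (2 * r + 2)))) P"
    unfolding P' core[symmetric] surgery_relabel[OF \<sigma> \<tau>, symmetric] by simp
  finally show ?thesis .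
qed

lemma word_pairing_cross:
  assumes "\<sigma> permutes {1..n}" "1 \<le> i" "i < n"
  shows "word_pairing (transpose i (i + 1) \<circ> \<sigma>) r \<tau>
    = relabel (transpose i (i + 1)) id \<circ> word_pairing \<sigma> r \<tau> \<circ> relabel (transpose i (i + 1)) id"
proof
  fix P
  let ?t = "transpose i (i + 1)"
  have "pinv (?t \<circ> \<sigma>) = pinv \<sigma> \<circ> ?t"
    using o_inv_distrib[of ?t \<sigma>] permutes_bij[OF assms(1)] by simp
  then show "word_pairing (?t \<circ> \<sigma>) r \<tau> P = (relabel ?t id \<circ> word_pairing \<sigma> r \<tau> \<circ> relabel ?t id) P"
    by (simp add: word_pairing_def relabel_comp)
qed

lemma id_diagram: "id_diagram n = diagram_of n (word_pairing id 0 id)"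
proof -
  have "diagram_of n (word_pairing id 0 id) = diagram_of n (base_pairing 0)"
    by (rule diagram_of_cong) (simp add: word_pairing_def relabel_id)
  also have "\<dots> = (\<lambda>j. {Top j, Bot j}) ` {1..n} \<union> (\<lambda>j. {Bot j, Top j}) ` {1..n}"
    unfolding diagram_of_def points_def image_Un image_image by (intro arg_cong2[of _ _ _ _ "(\<union>)"] image_cong) auto
  also have "\<dots> = id_diagram n" by (auto simp: id_diagram_def verticals_def insert_commute)
  finally show ?thesis by simp
qed

lemma word_pairing_top:
  assumes "\<sigma> permutes {1..n}" "\<tau> permutes {1..n}"
  shows "word_pairing \<sigma> r \<tau> (Top (\<sigma> j)) = (if j \<le> 2 * r then Top (\<sigma> (mate j)) else Bot (pinv \<tau> j))"
    "word_pairing \<sigma> r \<tau> (Bot (pinv \<tau> j)) = (if j \<le> 2 * r then Bot (pinv \<tau> (mate j)) else Top (\<sigma> j))"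
  using word_pairing_relabel[OF assms, of r "Top j"] word_pairing_relabel[OF assms, of r "Bot j"] by auto

lemma through_strands_word:
  assumes \<sigma>: "\<sigma> permutes {1..n}" and \<tau>: "\<tau> permutes {1..n}" and r: "2 * r \<le> n"
  shows "card (through_strands (diagram_of n (word_pairing \<sigma> r \<tau>))) = n - 2 * r"
proof -
  let ?f = "word_pairing \<sigma> r \<tau>"
  let ?h = "\<lambda>j. {Bot (pinv \<tau> j), Top (\<sigma> j)}"
  note pf = pairing_word[OF \<sigma> \<tau> r]
  have "through_strands (diagram_of n ?f) = ?h ` {2 * r + 1..n}"
  proof (intro equalityI subsetI)
    fix b assume "b \<in> through_strands (diagram_of n ?f)"
    then obtain i j where b: "b = {Bot i, Top j}" "{Top j, Bot i} \<in> diagram_of n ?f"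
      by (auto simp: through_strands_def insert_commute)
    then have ij: "1 \<le> j" "j \<le> n" "?f (Top j) = Bot i" using in_diagram_of[OF pf] by auto
    let ?k = "pinv \<sigma> j"
    have k: "\<sigma> ?k = j" "1 \<le> ?k" "?k \<le> n"
      using permutes_inverses(1)[OF \<sigma>] permutes_in_image[OF permutes_inv[OF \<sigma>], of j] ij by auto
    then have "\<not> ?k \<le> 2 * r" "i = pinv \<tau> ?k" using word_pairing_top(1)[OF \<sigma> \<tau>, of r ?k] ij by (auto split: if_splits)
    then show "b \<in> ?h ` {2 * r + 1..n}" using b k by (intro image_eqI[of _ _ ?k]) auto
  next
    fix b assume "b \<in> ?h ` {2 * r + 1..n}"
    then obtain j where j: "2 * r + 1 \<le> j" "j \<le> n" "b = ?h j" by auto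
    then have "Top (\<sigma> j) \<in> points n" using permutes_in_image[OF \<sigma>, of j] by auto
    moreover have "?f (Top (\<sigma> j)) = Bot (pinv \<tau> j)" using word_pairing_top(1)[OF \<sigma> \<tau>] j by simp
    ultimately have "{Top (\<sigma> j), Bot (pinv \<tau> j)} \<in> diagram_of n ?f" using in_diagram_of[OF pf] by simp
    then show "b \<in> through_strands (diagram_of n ?f)" using j by (auto simp: through_strands_def insert_commute)
  qed
  moreover have "inj_on ?h {2 * r + 1..n}"
    using permutes_inj[OF \<sigma>] by (auto simp: inj_on_def doubleton_eq_iff)
  ultimately show ?thesis by (simp add: card_image)
qed

section \<open>Normal forms of words\<close>

definition normal_word :: "nat \<Rightarrow> (nat \<Rightarrow> nat) \<Rightarrow> nat \<Rightarrow> (nat \<Rightarrow> nat) \<Rightarrow> gen list" where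
  "normal_word n \<sigma> r \<tau> = perm_word n \<sigma> @ cup_word r @ perm_word n \<tau>"

abbreviation word_dg :: "nat \<Rightarrow> (nat \<Rightarrow> nat) \<Rightarrow> nat \<Rightarrow> (nat \<Rightarrow> nat) \<Rightarrow> point set set" where
  "word_dg n \<sigma> r \<tau> \<equiv> diagram_of n (word_pairing \<sigma> r \<tau>)"

context brauer_words begin

lemma left_cross:
  assumes "perm \<sigma>" "1 \<le> i" "i < n"
  shows "Cross i # normal_word n \<sigma> r \<tau> \<approx> normal_word n (transpose i (i + 1) \<circ> \<sigma>) r \<tau>"
  unfolding normal_word_def using cong_right[OF cross_P[OF assms], of "cup_word r @ P \<tau>"] by simp

text \<open>The word and the diagram change in parallel. Let \<open>a\<close> and \<open>b\<close>
  be the preimages of \<open>i\<close> and \<open>i + 1\<close> under \<open>\<sigma>\<close>. Two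
  ends of one arc give a loop, an end of an arc and a point off this arc give a slide, and two
  through strands give a new arc. Only the last case raises \<open>r\<close>, and it is never
  lowered.\<close>

lemma left_cupcap:
  assumes \<sigma>: "perm \<sigma>" and \<tau>: "perm \<tau>" and r: "2 * r \<le> n" and i: "1 \<le> i" "i < n"
  shows "(word_pairing \<sigma> r \<tau> (Top i) = Top (i + 1) \<and> Z (CupCap i # normal_word n \<sigma> r \<tau>)) \<or>
    (word_pairing \<sigma> r \<tau> (Top i) \<noteq> Top (i + 1) \<and>
     (\<exists>\<sigma>' r' \<tau>'. perm \<sigma>' \<and> perm \<tau>' \<and> 2 * r' \<le> n \<and> r \<le> r' \<and>
       CupCap i # normal_word n \<sigma> r \<tau> \<approx> normal_word n \<sigma>' r' \<tau>' \<and>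
       word_dg n \<sigma>' r' \<tau>' = diagram_of n (surgery (word_pairing \<sigma> r \<tau>) (Top i) (Top (i + 1)))))"
proof -
  let ?a = "pinv \<sigma> i" and ?b = "pinv \<sigma> (i + 1)"
  have s: "\<sigma> ?a = i" "\<sigma> ?b = i + 1" using permutes_inverses(1)[OF \<sigma>] by auto
  have inj: "\<sigma> x = \<sigma> y \<longleftrightarrow> x = y" for x y using permutes_inj[OF \<sigma>] by (auto dest: injD)
  have ab: "1 \<le> ?a" "?a \<le> n" "1 \<le> ?b" "?b \<le> n" "?a \<noteq> ?b"
    using permutes_in_image[OF permutes_inv[OF \<sigma>], of i] permutes_in_image[OF permutes_inv[OF \<sigma>], of "i + 1"] i s
    by auto
  have topi: "word_pairing \<sigma> r \<tau> (Top i) = (if ?a \<le> 2 * r then Top (\<sigma> (mate ?a)) else Bot (pinv \<tau> ?a))"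
    using word_pairing_top(1)[OF \<sigma> \<tau>, of r ?a] s by simp
  have slide: "\<exists>\<sigma>' r' \<tau>'. perm \<sigma>' \<and> perm \<tau>' \<and> 2 * r' \<le> n \<and> r \<le> r' \<and>
       CupCap i # normal_word n \<sigma> r \<tau> \<approx> normal_word n \<sigma>' r' \<tau>' \<and>
       word_dg n \<sigma>' r' \<tau>' = diagram_of n (surgery (word_pairing \<sigma> r \<tau>) (Top (\<sigma> a)) (Top (\<sigma> b)))"
    if "1 \<le> a" "a \<le> 2 * r" "1 \<le> b" "b \<le> n" "b \<noteq> a" "b \<noteq> mate a" "{\<sigma> a, \<sigma> b} = {i, i + 1}" for a b
  proof -
    let ?\<sigma> = "\<sigma> \<circ> three_cycle (mate a) a b"
    have "three_cycle (mate a) a b permutes {1..n}"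
      using that r mate_props[OF that(1,2)] by (intro three_cycle_permutes) auto
    then have "perm ?\<sigma>" using \<sigma> permutes_compose by blast
    moreover have "CupCap i # normal_word n \<sigma> r \<tau> \<approx> normal_word n ?\<sigma> r \<tau>"
      using cong_right[OF left_slide[OF \<sigma> r i that], of "P \<tau>"] by (simp add: normal_word_def)
    moreover have "word_dg n ?\<sigma> r \<tau> = diagram_of n (surgery (word_pairing \<sigma> r \<tau>) (Top (\<sigma> a)) (Top (\<sigma> b)))"
      by (rule diagram_of_cong) (rule surgery_slide[OF \<sigma> \<tau> r that(1-6)])
    ultimately show ?thesis using \<tau> r by blast
  qed
  consider "?a \<le> 2 * r" "?b = mate ?a" | "?a \<le> 2 * r" "?b \<noteq> mate ?a"
    | "\<not> ?a \<le> 2 * r" "?b \<le> 2 * r" | "\<not> ?a \<le> 2 * r" "\<not> ?b \<le> 2 * r" by blast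
  then show ?thesis
  proof cases
    case 1
    obtain k where k: "k < r" "{?a, mate ?a} = {2 * k + 1, 2 * k + 2}" using mate_pair[OF ab(1) 1(1)] by blast
    have "{\<sigma> (2 * k + 1), \<sigma> (2 * k + 2)} = {i, i + 1}"
      using arg_cong[OF k(2), of "image \<sigma>"] 1 s by simp
    then have "Z (CupCap i # normal_word n \<sigma> r \<tau>)"
      unfolding normal_word_def using left_loop[OF \<sigma> r i k(1)] by blast
    then show ?thesis using topi 1 s by simp
  next
    case 2
    have "\<sigma> (mate ?a) \<noteq> i + 1" using 2 s inj by metis
    then have "word_pairing \<sigma> r \<tau> (Top i) \<noteq> Top (i + 1)" using topi 2 by simp
    then show ?thesis using slide[OF ab(1) 2(1) ab(3,4)] ab 2 s by simp
  next
    case 3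
    have "mate ?b \<noteq> ?a" using mate_props(3)[OF ab(3) 3(2)] 3 by auto
    then have "surgery (word_pairing \<sigma> r \<tau>) (Top i) (Top (i + 1)) = surgery (word_pairing \<sigma> r \<tau>) (Top (i + 1)) (Top i)"
      using i by (intro surgery_commute[OF pairing_word[OF \<sigma> \<tau> r]]) auto
    moreover have "word_pairing \<sigma> r \<tau> (Top i) \<noteq> Top (i + 1)" using topi 3 by simp
    ultimately show ?thesis
      using slide[OF ab(3) 3(2) ab(1,2,5) \<open>mate ?b \<noteq> ?a\<close>[symmetric]] s by (simp add: insert_commute)
  next
    case 4
    have "card (insert ?a (insert ?b {1..2 * r})) \<le> card {1..n}" using ab r by (intro card_mono) auto
    then have r2: "2 * r + 2 \<le> n" using ab 4 by simp
    define f where "f x = (if x \<le> 2 * r then x else if x = 2 * r + 1 then ?a else ?b)" for x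
    have "\<exists>\<rho>. perm \<rho> \<and> (\<forall>x\<in>{1..2 * r + 2}. \<rho> x = f x)"
    proof (rule permutes_extend)
      show "inj_on f {1..2 * r + 2}" using ab 4 by (auto simp: inj_on_def f_def)
      show "f ` {1..2 * r + 2} \<subseteq> {1..n}" using ab r2 by (auto simp: f_def)
    qed (use r2 in auto)
    then obtain \<rho> where \<rho>: "perm \<rho>" "\<forall>x\<in>{1..2 * r + 2}. \<rho> x = f x" by blast
    have fixed: "\<forall>j\<in>{1..2 * r}. \<rho> j = j" using \<rho>(2) by (auto simp: f_def)
    have \<rho>ab: "\<rho> (2 * r + 1) = ?a" "\<rho> (2 * r + 2) = ?b" using \<rho>(2) by (auto simp: f_def)
    have st: "{\<sigma> (\<rho> (2 * r + 1)), \<sigma> (\<rho> (2 * r + 2))} = {i, i + 1}" using \<rho>ab s by simp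
    let ?\<sigma> = "\<sigma> \<circ> \<rho>" and ?\<tau> = "pinv \<rho> \<circ> \<tau>"
    have p: "perm ?\<sigma>" "perm ?\<tau>" using \<sigma> \<tau> \<rho>(1) permutes_inv permutes_compose by blast+
    have "CupCap i # normal_word n \<sigma> r \<tau> \<approx> P ?\<sigma> @ cup_word (r + 1) @ P (pinv \<rho>) @ P \<tau>"
      using cong_right[OF left_new[OF \<sigma> \<rho>(1) r2 i fixed st], of "P \<tau>"] by (simp add: normal_word_def)
    also have "\<dots> \<approx> normal_word n ?\<sigma> (r + 1) ?\<tau>"
      using cong_left[OF P_comp[OF permutes_inv[OF \<rho>(1)] \<tau>], of "P ?\<sigma> @ cup_word (r + 1)"]
      by (simp add: normal_word_def)
    finally have eq: "CupCap i # normal_word n \<sigma> r \<tau> \<approx> normal_word n ?\<sigma> (r + 1) ?\<tau>" .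
    have "word_dg n ?\<sigma> (r + 1) ?\<tau> = diagram_of n (surgery (word_pairing \<sigma> r \<tau>) (Top i) (Top (i + 1)))"
      using diagram_of_cong[OF surgery_new[OF \<sigma> \<tau> r2 \<rho>(1) fixed]] \<rho>ab s by simp
    moreover have "word_pairing \<sigma> r \<tau> (Top i) \<noteq> Top (i + 1)" using topi 4 by simp
    moreover have "2 * (r + 1) \<le> n" using r2 by simp
    moreover have "r \<le> r + 1" by simp
    ultimately show ?thesis using p eq by blast
  qed
qed

lemma word_diagram_normal:
  assumes "word_diagram n w d"
  shows "\<exists>\<sigma> r \<tau>. perm \<sigma> \<and> perm \<tau> \<and> 2 * r \<le> n \<and> d = word_dg n \<sigma> r \<tau> \<and> w \<approx> normal_word n \<sigma> r \<tau>"
  using assms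
proof (induction rule: word_diagram.induct)
  case empty
  have "normal_word n id 0 id \<approx> []"
    using cong_append[OF P_id P_id] by (simp add: normal_word_def)
  then have "[] \<approx> normal_word n id 0 id" by (rule sym)
  moreover have "perm id" by (rule permutes_id)
  moreover have "2 * 0 \<le> n" by simp
  moreover note id_diagram[of n]
  ultimately show ?case by metis
next
  case (cross i w d)
  then obtain \<sigma> r \<tau> where h: "perm \<sigma>" "perm \<tau>" "2 * r \<le> n" "d = word_dg n \<sigma> r \<tau>" "w \<approx> normal_word n \<sigma> r \<tau>"
    by blast
  let ?\<sigma> = "transpose i (i + 1) \<circ> \<sigma>"
  have "perm ?\<sigma>" using h cross by (intro permutes_compose permutes_swap_id) auto
  moreover have "Cross i # w \<approx> normal_word n ?\<sigma> r \<tau>"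
    using trans[OF cong_Cons[OF h(5)] left_cross[OF h(1) cross(1,2)]] .
  moreover have "stack n (cross_diagram n i) d = word_dg n ?\<sigma> r \<tau>"
    unfolding h(4) stack_cross(1)[OF pairing_word[OF h(1-3)] cross(1,2)] word_pairing_cross[OF h(1) cross(1,2)] ..
  ultimately show ?case using h by blast
next
  case (cupcap i w d)
  then obtain \<sigma> r \<tau> where h: "perm \<sigma>" "perm \<tau>" "2 * r \<le> n" "d = word_dg n \<sigma> r \<tau>" "w \<approx> normal_word n \<sigma> r \<tau>"
    by blast
  note pf = pairing_word[OF h(1-3)]
  have nl: "word_pairing \<sigma> r \<tau> (Top i) \<noteq> Top (i + 1)"
    using cupcap.hyps(4) not_loop_free[OF pf cupcap.hyps(1,2)] h(4) by blast
  with left_cupcap[OF h(1-3) cupcap.hyps(1,2)] obtain \<sigma>' r' \<tau>' where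
    h': "perm \<sigma>'" "perm \<tau>'" "2 * r' \<le> n" "CupCap i # normal_word n \<sigma> r \<tau> \<approx> normal_word n \<sigma>' r' \<tau>'"
      "word_dg n \<sigma>' r' \<tau>' = diagram_of n (surgery (word_pairing \<sigma> r \<tau>) (Top i) (Top (i + 1)))" by blast
  have "CupCap i # w \<approx> normal_word n \<sigma>' r' \<tau>'" using trans[OF cong_Cons[OF h(5)] h'(4)] .
  moreover have "stack n (cupcap_diagram n i) d = word_dg n \<sigma>' r' \<tau>'"
    unfolding h(4) stack_cupcap(1)[OF pf cupcap.hyps(1,2) nl] h'(5) ..
  ultimately show ?case using h' by blast
qed

text \<open>The number of through strands gives \<open>r\<close>. The discrepancy
  \<open>?\<alpha>\<close> of the upper permutations preserves the arcs of
  \<open>cup_word r\<close>, because the cups agree, and so commutes with it. What then remains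
  between \<open>cup_word r\<close> and \<open>\<tau>'\<close> is \<open>?\<beta>\<close>: it fixes
  all points above \<open>2 * r\<close>, because the through strands agree, and preserves the arcs,
  because the caps agree; it is absorbed.\<close>

lemma normal_word_unique:
  assumes \<sigma>: "perm \<sigma>" and \<tau>: "perm \<tau>" and r: "2 * r \<le> n"
    and \<sigma>': "perm \<sigma>'" and \<tau>': "perm \<tau>'" and r': "2 * r' \<le> n"
    and eq: "word_dg n \<sigma> r \<tau> = word_dg n \<sigma>' r' \<tau>'"
  shows "r = r' \<and> normal_word n \<sigma> r \<tau> \<approx> normal_word n \<sigma>' r' \<tau>'"
proof
  show [simp]: "r = r'"
    using through_strands_word[OF \<sigma> \<tau> r] through_strands_word[OF \<sigma>' \<tau>' r'] eq r r' by simp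
  have pe: "word_pairing \<sigma> r' \<tau> Q = word_pairing \<sigma>' r' \<tau>' Q" if "Q \<in> points n" for Q
    using diagram_of_inj[OF pairing_word[OF \<sigma> \<tau> r] pairing_word[OF \<sigma>' \<tau>' r'] eq that] by simp
  let ?\<alpha> = "pinv \<sigma>' \<circ> \<sigma>"
  let ?\<beta> = "?\<alpha> \<circ> \<tau> \<circ> pinv \<tau>'"
  have \<alpha>: "perm ?\<alpha>" using \<sigma> \<sigma>' permutes_inv permutes_compose by blast
  have \<beta>: "perm ?\<beta>" using \<alpha> \<tau> \<tau>' permutes_inv permutes_compose by blast
  have \<sigma>\<alpha>: "\<sigma>' (?\<alpha> j) = \<sigma> j" for j using permutes_inverses(1)[OF \<sigma>'] by simp
  have inj': "\<sigma>' x = \<sigma>' y \<longleftrightarrow> x = y" "pinv \<tau>' x = pinv \<tau>' y \<longleftrightarrow> x = y" for x y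
    using permutes_inj[OF \<sigma>'] permutes_inj[OF permutes_inv[OF \<tau>']] by (auto dest: injD)
  have top: "word_pairing \<sigma> r' \<tau> (Top (\<sigma> j)) = word_pairing \<sigma>' r' \<tau>' (Top (\<sigma>' (?\<alpha> j)))" if "j \<in> {1..n}" for j
    using pe[of "Top (\<sigma> j)"] that permutes_in_image[OF \<sigma>, of j] \<sigma>\<alpha> by simp
  have low: "?\<alpha> j \<le> 2 * r' \<longleftrightarrow> j \<le> 2 * r'" if "j \<in> {1..n}" for j
    using top[OF that] word_pairing_top(1)[OF \<sigma> \<tau>, of r' j] word_pairing_top(1)[OF \<sigma>' \<tau>', of r' "?\<alpha> j"]
    by (auto split: if_splits)
  have \<alpha>mate: "?\<alpha> (mate j) = mate (?\<alpha> j)" if "1 \<le> j" "j \<le> 2 * r'" for j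
  proof -
    have j: "j \<in> {1..n}" using that r' by auto
    have "Top (\<sigma> (mate j)) = Top (\<sigma>' (mate (?\<alpha> j)))"
      using top[OF j] low[OF j] that word_pairing_top(1)[OF \<sigma> \<tau>, of r' j] word_pairing_top(1)[OF \<sigma>' \<tau>', of r' "?\<alpha> j"]
      by simp
    then show ?thesis using \<sigma>\<alpha>[of "mate j"] inj' by simp
  qed
  have bot_hi: "pinv \<tau>' (?\<alpha> j) = pinv \<tau> j" if "j \<in> {1..n}" "2 * r' < j" for j
    using top[OF that(1)] low[OF that(1)] that(2) word_pairing_top(1)[OF \<sigma> \<tau>, of r' j]
      word_pairing_top(1)[OF \<sigma>' \<tau>', of r' "?\<alpha> j"] by simp
  have \<beta>fix: "\<forall>k>2 * r'. ?\<beta> k = k"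
  proof (intro allI impI)
    fix k assume k: "2 * r' < k"
    show "?\<beta> k = k"
    proof (cases "k \<le> n")
      case True
      let ?j = "pinv ?\<alpha> k"
      have \<alpha>j: "?\<alpha> ?j = k" using permutes_inverses(1)[OF \<alpha>] by simp
      have j: "?j \<in> {1..n}" using permutes_in_image[OF permutes_inv[OF \<alpha>], of k] k True by auto
      then have "2 * r' < ?j" using low[OF j] \<alpha>j k by auto
      then have "pinv \<tau>' k = pinv \<tau> ?j" using bot_hi[OF j] \<alpha>j by simp
      then show ?thesis using permutes_inverses(1)[OF \<tau>] \<alpha>j by simp
    qed (use permutes_not_in[OF \<beta>] in auto)
  qed
  have \<beta>mate: "\<forall>j\<in>{1..2 * r'}. ?\<beta> (mate j) = mate (?\<beta> j)"
  proof
    fix j assume j: "j \<in> {1..2 * r'}"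
    let ?x = "\<tau> (pinv \<tau>' j)"
    have \<tau>x: "pinv \<tau> ?x = pinv \<tau>' j" using permutes_inverses(2)[OF \<tau>] by simp
    have x: "?x \<in> {1..n}"
      using permutes_in_image[OF \<tau>, of "pinv \<tau>' j"] permutes_in_image[OF permutes_inv[OF \<tau>'], of j] j r' by simp
    have "word_pairing \<sigma> r' \<tau> (Bot (pinv \<tau> ?x)) = word_pairing \<sigma>' r' \<tau>' (Bot (pinv \<tau>' j))"
      using pe[of "Bot (pinv \<tau>' j)"] \<tau>x permutes_in_image[OF permutes_inv[OF \<tau>'], of j] j r' by simp
    then have "?x \<le> 2 * r'" "pinv \<tau> (mate ?x) = pinv \<tau>' (mate j)"
      using word_pairing_top(2)[OF \<sigma> \<tau>, of r' ?x] word_pairing_top(2)[OF \<sigma>' \<tau>', of r' j] j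
      by (auto split: if_splits)
    moreover from this(2) have "\<tau> (pinv \<tau>' (mate j)) = mate ?x" using permutes_inverses(1)[OF \<tau>] by metis
    ultimately show "?\<beta> (mate j) = mate (?\<beta> j)" using \<alpha>mate[of ?x] x by simp
  qed
  have \<alpha>\<tau>: "?\<alpha> \<circ> \<tau> = ?\<beta> \<circ> \<tau>'" using permutes_inv_o(2)[OF \<tau>'] by (simp add: comp_assoc)
  have "P \<sigma> \<approx> P \<sigma>' @ P ?\<alpha>"
    using sym[OF P_comp[OF \<sigma>' \<alpha>]] permutes_inv_o(1)[OF \<sigma>'] by (simp add: comp_assoc[symmetric])
  from cong_right[OF this, of "cup_word r' @ P \<tau>"]
  have "normal_word n \<sigma> r \<tau> \<approx> P \<sigma>' @ (P ?\<alpha> @ cup_word r') @ P \<tau>" by (simp add: normal_word_def)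
  also have "\<dots> \<approx> P \<sigma>' @ (cup_word r' @ P ?\<alpha>) @ P \<tau>"
    using \<alpha>mate low r' by (intro cong P_cup_commute \<alpha>) auto
  also have "\<dots> = (P \<sigma>' @ cup_word r') @ (P ?\<alpha> @ P \<tau>)" by simp
  also have "\<dots> \<approx> (P \<sigma>' @ cup_word r') @ (P ?\<beta> @ P \<tau>')"
    using trans[OF P_comp[OF \<alpha> \<tau>] sym[OF P_comp[OF \<beta> \<tau>', folded \<alpha>\<tau>]]] by (intro cong_left)
  also have "\<dots> = P \<sigma>' @ (cup_word r' @ P ?\<beta>) @ P \<tau>'" by simp
  also have "\<dots> \<approx> P \<sigma>' @ cup_word r' @ P \<tau>'"
    by (rule cong, rule cup_absorb[OF \<beta> order.refl r' \<beta>fix \<beta>mate])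
  finally show "normal_word n \<sigma> r \<tau> \<approx> normal_word n \<sigma>' r' \<tau>'" by (simp add: normal_word_def)
qed

text \<open>The bound \<open>r \<le> r'\<close> says that multiplication never loses arcs; it is
  what turns normal forms into statements about the ideals.\<close>

definition reducible :: "nat \<Rightarrow> gen list \<Rightarrow> bool" where
  "reducible r w \<longleftrightarrow> Z w \<or> (\<exists>\<sigma> r' \<tau>. perm \<sigma> \<and> perm \<tau> \<and> 2 * r' \<le> n \<and> r \<le> r' \<and> w \<approx> normal_word n \<sigma> r' \<tau>)"

lemma reducible_eqv: "u \<approx> v \<Longrightarrow> reducible r u \<Longrightarrow> reducible r v"
  unfolding reducible_def using Z_eqv trans[OF sym] by blast

lemma reducible_left:
  assumes "reducible r w" "g = Cross i \<or> g = CupCap i" "1 \<le> i" "i < n"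
  shows "reducible r (g # w)"
proof (cases "Z w")
  case True
  then show ?thesis using Z_cong[of w "[g]" "[]"] by (simp add: reducible_def)
next
  case False
  then obtain \<sigma> r' \<tau> where h: "perm \<sigma>" "perm \<tau>" "2 * r' \<le> n" "r \<le> r'" "w \<approx> normal_word n \<sigma> r' \<tau>"
    using assms(1) by (auto simp: reducible_def)
  have "reducible r (g # normal_word n \<sigma> r' \<tau>)"
  proof (cases "g = Cross i")
    case True
    have "transpose i (i + 1) \<circ> \<sigma> permutes {1..n}"
      using h assms by (intro permutes_compose permutes_swap_id) auto
    then show ?thesis using left_cross[OF h(1) assms(3,4)] h True unfolding reducible_def by blast
  next
    case False
    then show ?thesis
      using left_cupcap[OF h(1-3) assms(3,4)] assms(2) order_trans[OF h(4)] unfolding reducible_def by metis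
  qed
  then show ?thesis by (rule reducible_eqv[OF sym[OF cong_Cons[OF h(5)]]])
qed

lemma rev_normal_word:
  assumes "perm \<sigma>" "perm \<tau>" "2 * r \<le> n"
  shows "rev (normal_word n \<sigma> r \<tau>) \<approx> normal_word n (pinv \<tau>) r (pinv \<sigma>)"
proof -
  have "rev (P \<rho>) \<approx> P (pinv \<rho>)" if "perm \<rho>" for \<rho>
  proof (rule P_eqv)
    note p = perm_word[OF that]
    show "cross_word n (rev (P \<rho>))" using p by simp
    show "word_perm (rev (P \<rho>)) = pinv \<rho>"
      using word_perm_rev[OF p(1)] p(2) by (intro inv_unique_comp[symmetric]) auto
  qed
  moreover have "rev (cup_word r) \<approx> cup_word r" by (rule cup_mset[OF assms(3)]) simp
  ultimately show ?thesis using assms by (auto simp: normal_word_def intro!: cong_append)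
qed

lemma reducible_rev: "reducible r (rev w) \<Longrightarrow> brauer_words.reducible (\<lambda>u v. rev u \<approx> rev v) n (\<lambda>u. Z (rev u)) r w"
  unfolding reducible_def brauer_words.reducible_def[OF brauer_words_rev]
proof (elim disjE exE conjE)
  fix \<sigma> r' \<tau> assume h: "perm \<sigma>" "perm \<tau>" "2 * r' \<le> n" "r \<le> r'" "rev w \<approx> normal_word n \<sigma> r' \<tau>"
  have "rev (normal_word n (pinv \<tau>) r' (pinv \<sigma>)) \<approx> normal_word n \<sigma> r' \<tau>"
    using rev_normal_word[OF permutes_inv[OF h(2)] permutes_inv[OF h(1)] h(3)]
      permutes_inv_inv[OF h(1)] permutes_inv_inv[OF h(2)] by simp
  then have "rev w \<approx> rev (normal_word n (pinv \<tau>) r' (pinv \<sigma>))" using h(5) sym trans by blast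
  then show "Z (rev w) \<or> (\<exists>\<sigma> r' \<tau>. perm \<sigma> \<and> perm \<tau> \<and> 2 * r' \<le> n \<and> r \<le> r' \<and> rev w \<approx> rev (normal_word n \<sigma> r' \<tau>))"
    using permutes_inv[OF h(1)] permutes_inv[OF h(2)] h(3,4) by blast
qed simp

text \<open>\<open>reducible_left\<close> in the mirrored instance of the locale, where the normal
  words reappear with both permutations inverted and exchanged.\<close>

lemma reducible_right:
  assumes "reducible r w" "g = Cross i \<or> g = CupCap i" "1 \<le> i" "i < n"
  shows "reducible r (w @ [g])"
proof -
  interpret R: brauer_words "\<lambda>u v. rev u \<approx> rev v" n "\<lambda>u. Z (rev u)" by (rule brauer_words_rev)
  have "R.reducible r (rev w)" by (rule reducible_rev) (use assms in simp)
  from R.reducible_left[OF this assms(2-4)] have "R.reducible r (g # rev w)" .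
  from R.reducible_rev[of r "rev (g # rev w)"] this show ?thesis by simp
qed

lemma reducible_cup_word:
  assumes "2 * r \<le> n"
    and "\<forall>g\<in>set u \<union> set v. \<exists>i. 1 \<le> i \<and> i < n \<and> (g = Cross i \<or> g = CupCap i)"
  shows "reducible r (u @ cup_word r @ v)"
proof -
  have "normal_word n id r id \<approx> cup_word r"
    unfolding normal_word_def using cong_append[OF P_id cong_append[OF refl P_id], of "cup_word r"] by simp
  then have base: "reducible r (cup_word r)"
    unfolding reducible_def using assms(1) sym permutes_id by blast
  have "reducible r (cup_word r @ v)"
    using assms(2)
  proof (induction v rule: rev_induct)
    case (snoc g v)
    then obtain i where "1 \<le> i" "i < n" "g = Cross i \<or> g = CupCap i" by auto
    then show ?case using reducible_right[of r "cup_word r @ v" g i] snoc by simp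
  qed (simp add: base)
  then show ?thesis using assms(2)
  proof (induction u)
    case (Cons g u)
    then obtain i where "1 \<le> i" "i < n" "g = Cross i \<or> g = CupCap i" by auto
    then show ?case using reducible_left[of r "u @ cup_word r @ v" g i] Cons by simp
  qed simp
qed

end

section \<open>The free algebra modulo the relations\<close>

lemma free_word_mult: "free_word u * free_word v = free_word (u @ v)"
  by (simp add: free_word_def mult_single plus_word_def)

lemma free_word_Nil: "free_word [] = 1"
  by (simp add: free_word_def flip: zero_word_def)

abbreviation word_ok :: "nat \<Rightarrow> gen list \<Rightarrow> bool" where
  "word_ok n w \<equiv> \<forall>g\<in>set w. gen_ok n g"

lemma relation_ideal_closed:
  "0 \<in> relation_ideal n"
  "f \<in> relation_ideal n \<Longrightarrow> g \<in> relation_ideal n \<Longrightarrow> f + g \<in> relation_ideal n"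
  "f \<in> relation_ideal n \<Longrightarrow> f \<in> carrier (free_algebra n)"
  "f \<in> relation_ideal n \<Longrightarrow> h \<in> carrier (free_algebra n) \<Longrightarrow> h * f \<in> relation_ideal n"
  "f \<in> relation_ideal n \<Longrightarrow> h \<in> carrier (free_algebra n) \<Longrightarrow> f * h \<in> relation_ideal n"
  using ideal.axioms(1)[OF ideal_relation_ideal[of n]] ideal.I_l_closed[OF ideal_relation_ideal[of n]]
    ideal.I_r_closed[OF ideal_relation_ideal[of n]]
  by (auto dest: additive_subgroup.zero_closed additive_subgroup.a_closed additive_subgroup.a_Hcarr)

lemma relation_ideal_uminus: "f \<in> relation_ideal n \<Longrightarrow> - f \<in> relation_ideal n"
  using relation_ideal_closed(4)[of f n "- 1"] free_minus_closed[OF free_one_closed] by simp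

lemma relation_ideal_uminus_iff [simp]: "- f \<in> relation_ideal n \<longleftrightarrow> f \<in> relation_ideal n"
  using relation_ideal_uminus[of f n] relation_ideal_uminus[of "- f" n] by auto

lemma relation_ideal_diff: "f \<in> relation_ideal n \<Longrightarrow> g \<in> relation_ideal n \<Longrightarrow> f - g \<in> relation_ideal n"
  using relation_ideal_closed(2)[of f n "- g"] by simp

lemma relation_ideal_diff_commute: "f - g \<in> relation_ideal n \<Longrightarrow> g - f \<in> relation_ideal n"
  using relation_ideal_uminus[of "f - g"] by simp

lemma relation_in_ideal: "(l, r) \<in> relations n \<Longrightarrow> l - r \<in> relation_ideal n"
  unfolding relation_ideal_def
  by (rule subsetD[OF ring.genideal_self[OF ring_free_algebra]])
    (use relations_closed free_diff_closed in blast)+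

lemma relation_words:
  "(free_word u, free_word v) \<in> relations n \<Longrightarrow> free_word u - free_word v \<in> relation_ideal n"
  "(free_word u, - free_word v) \<in> relations n \<Longrightarrow> free_word u + free_word v \<in> relation_ideal n"
  using relation_in_ideal[of "free_word u"] by force+

text \<open>The type of letters also contains indices out of range. Requiring that both words are
  admissible or neither is makes this a congruence on all words.\<close>

definition word_eqv :: "nat \<Rightarrow> gen list \<Rightarrow> gen list \<Rightarrow> bool" where
  "word_eqv n u v \<longleftrightarrow> (word_ok n u \<longleftrightarrow> word_ok n v) \<and>
     (word_ok n u \<longrightarrow> free_word u - free_word v \<in> relation_ideal n \<or> free_word u + free_word v \<in> relation_ideal n)"

text \<open>Inadmissible words count as zero, so that the property survives multiplication by
  arbitrary words.\<close>

definition word_zero :: "nat \<Rightarrow> gen list \<Rightarrow> bool" where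
  "word_zero n u \<longleftrightarrow> (word_ok n u \<longrightarrow> free_word u \<in> relation_ideal n)"

lemma sandwich_ideal:
  assumes "f \<in> relation_ideal n" "word_ok n a" "word_ok n b"
  shows "free_word a * f * free_word b \<in> relation_ideal n"
  using assms by (intro relation_ideal_closed(4,5) free_word_closed)

lemma word_eqv_relation:
  "(free_word u, free_word v) \<in> relations n \<Longrightarrow> word_ok n u \<Longrightarrow> word_ok n v \<Longrightarrow> word_eqv n u v"
  "(free_word u, - free_word v) \<in> relations n \<Longrightarrow> word_ok n u \<Longrightarrow> word_ok n v \<Longrightarrow> word_eqv n u v"
  using relation_words by (auto simp: word_eqv_def)

interpretation VV_words: brauer_words "word_eqv n" n "word_zero n" for n
proof unfold_locales
  note R = word_eqv_relation[of _ _ n] and rels = relations.intros[of _ n, unfolded free_word_mult free_word_Nil[symmetric], simplified]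
  have refl: "word_eqv n u u" for u by (auto simp: word_eqv_def relation_ideal_closed)
  show "word_eqv n u u" for u by (rule refl)
  show sym: "word_eqv n v u" if "word_eqv n u v" for u v
    using that relation_ideal_diff_commute[of "free_word u" "free_word v" n] by (auto simp: word_eqv_def add.commute)
  show "word_eqv n u w" if "word_eqv n u v" "word_eqv n v w" for u v w
  proof -
    let ?I = "relation_ideal n"
    let ?u = "free_word u" and ?v = "free_word v" and ?w = "free_word w"
    have "?u - ?w = (?u - ?v) + (?v - ?w)" "?u - ?w = (?u + ?v) - (?v + ?w)"
      "?u + ?w = (?u - ?v) + (?v + ?w)" "?u + ?w = (?u + ?v) - (?v - ?w)" by (simp_all add: algebra_simps)
    then show ?thesis
      using that relation_ideal_closed(2)[of _ n] relation_ideal_diff[of _ n] unfolding word_eqv_def by metis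
  qed
  show "word_eqv n (a @ u @ b) (a @ v @ b)" if "word_eqv n u v" for u v a b
  proof (cases "word_ok n a \<and> word_ok n b \<and> word_ok n u")
    case True
    have "free_word (a @ u @ b) - free_word (a @ v @ b) = free_word a * (free_word u - free_word v) * free_word b"
      "free_word (a @ u @ b) + free_word (a @ v @ b) = free_word a * (free_word u + free_word v) * free_word b"
      by (simp_all add: algebra_simps flip: free_word_mult)
    then show ?thesis using True that sandwich_ideal[of _ n a b] unfolding word_eqv_def by (metis Un_iff set_append)
  qed (use that in \<open>auto simp: word_eqv_def\<close>)
  show "word_eqv n [Cross i, Cross i] []" if "1 \<le> i" "i < n" for i
    using relations.ss[OF that] that by (intro R) (simp_all add: free_word_mult free_word_Nil)
  show "word_eqv n [Cross i, Cross j] [Cross j, Cross i]" if "1 \<le> i" "i + 1 < j" "j < n" for i j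
    using relations.ss_comm[of i n j] that by (intro R) (simp_all add: free_word_mult)
  show "word_eqv n [Cross i, Cross (i + 1), Cross i] [Cross (i + 1), Cross i, Cross (i + 1)]"
    if "1 \<le> i" "i + 1 < n" for i
    using relations.braid[OF that] that by (intro R(1)) (simp_all add: free_word_mult)
  show "word_eqv n [Cross i, CupCap j] [CupCap j, Cross i]"
    if "1 \<le> i" "i < n" "1 \<le> j" "j < n" "i + 1 < j \<or> j + 1 < i" for i j
    using relations.se_comm[of i n j] that by (intro R(1)) (auto simp add: free_word_mult)
  show "word_eqv n [CupCap i, CupCap j] [CupCap j, CupCap i]" if "1 \<le> i" "i + 1 < j" "j < n" for i j
    using relations.ee_comm[of i n j] that by (intro R(1)) (auto simp add: free_word_mult)
  show "word_eqv n [CupCap i, Cross i] [CupCap i]" if "1 \<le> i" "i < n" for i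
    using relations.es[OF that] that by (intro R(1)) (simp_all add: free_word_mult)
  show "word_eqv n [Cross i, CupCap i] [CupCap i]" if "1 \<le> i" "i < n" for i
    using relations.se[OF that] that by (intro R(2)) (simp_all add: free_word_mult)
  show "word_eqv n [Cross i, CupCap (i + 1), CupCap i] [Cross (i + 1), CupCap i]" if "1 \<le> i" "i + 1 < n" for i
    using relations.see_down[OF that] that by (intro R(1)) (simp_all add: free_word_mult)
  show "word_eqv n [Cross (i + 1), CupCap i, CupCap (i + 1)] [Cross i, CupCap (i + 1)]" if "1 \<le> i" "i + 1 < n" for i
    using relations.see_up[OF that] that by (intro R(2)) (simp_all add: free_word_mult)
  show "word_eqv n [CupCap (i + 1), CupCap i, Cross (i + 1)] [CupCap (i + 1), Cross i]" if "1 \<le> i" "i + 1 < n" for i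
    using relations.ees_up[OF that] that by (intro R(1)) (simp_all add: free_word_mult)
  show "word_eqv n [CupCap i, CupCap (i + 1), Cross i] [CupCap i, Cross (i + 1)]" if "1 \<le> i" "i + 1 < n" for i
    using relations.ees_down[OF that] that by (intro R(2)) (simp_all add: free_word_mult)
  show "word_zero n [CupCap i, CupCap i]" if "1 \<le> i" "i < n" for i
    using relation_in_ideal[OF relations.ee[OF that]] by (simp add: word_zero_def free_word_mult)
  show "word_zero n v" if "word_eqv n u v" "word_zero n u" for u v
  proof -
    have "free_word v = free_word u - (free_word u - free_word v)" "free_word v = (free_word u + free_word v) - free_word u"
      by simp_all
    then show ?thesis using that relation_ideal_diff[of _ n] unfolding word_zero_def word_eqv_def by metis
  qed
  show "word_zero n (a @ u @ b)" if "word_zero n u" for a u b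
    using that sandwich_ideal[of "free_word u" n a b] by (auto simp: word_zero_def free_word_mult)
qed

text \<open>Linear combinations of words modulo the relations, as a subset of the free algebra:
  since the relation ideal is included, rewriting can be done with representatives.\<close>

inductive_set lin_span :: "nat \<Rightarrow> gen list set \<Rightarrow> free_alg set" for n W where
  ideal: "f \<in> relation_ideal n \<Longrightarrow> f \<in> lin_span n W"
| word: "w \<in> W \<Longrightarrow> Poly_Mapping.single (Word w) c \<in> lin_span n W"
| add: "f \<in> lin_span n W \<Longrightarrow> g \<in> lin_span n W \<Longrightarrow> f + g \<in> lin_span n W"

lemma single_word: "Poly_Mapping.single (Word w) c = Poly_Mapping.single 0 c * free_word w"
  by (simp add: free_word_def mult_single)

lemma span_zero: "0 \<in> lin_span n W"
  by (rule lin_span.ideal[OF relation_ideal_closed(1)])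

lemma span_free_word: "w \<in> W \<Longrightarrow> free_word w \<in> lin_span n W"
  unfolding free_word_def by (rule lin_span.word)

lemma const_closed: "Poly_Mapping.single 0 c \<in> carrier (free_algebra n)"
  by (rule free_single_closed) (simp add: zero_word_def)

lemma span_scale: "f \<in> lin_span n W \<Longrightarrow> Poly_Mapping.single 0 c * f \<in> lin_span n W"
proof (induction rule: lin_span.induct)
  case (ideal f)
  then show ?case by (intro lin_span.ideal relation_ideal_closed(4) const_closed)
next
  case (word w c')
  have "Poly_Mapping.single 0 c * Poly_Mapping.single (Word w) c' = Poly_Mapping.single (Word w) (c * c')"
    by (simp add: mult_single)
  then show ?case using word lin_span.word by simp
qed (simp add: distrib_left lin_span.add)

lemma span_uminus: "f \<in> lin_span n W \<Longrightarrow> - f \<in> lin_span n W"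
proof (induction rule: lin_span.induct)
  case (word w c)
  then show ?case using lin_span.word[of w W "- c"] by (simp add: single_uminus)
next
  case (add f g)
  then show ?case using lin_span.add[of "- f" n W "- g"] by simp
qed (auto intro: lin_span.ideal)

lemma span_diff: "f \<in> lin_span n W \<Longrightarrow> g \<in> lin_span n W \<Longrightarrow> f - g \<in> lin_span n W"
  using lin_span.add[of f n W "- g"] span_uminus by simp

lemma span_cong: "f - g \<in> lin_span n W \<Longrightarrow> g \<in> lin_span n W \<Longrightarrow> f \<in> lin_span n W"
  using lin_span.add[of "f - g" n W g] by simp

lemma span_cong_ideal: "f - g \<in> relation_ideal n \<Longrightarrow> g \<in> lin_span n W \<Longrightarrow> f \<in> lin_span n W"
  by (rule span_cong[OF lin_span.ideal])

lemma span_sandwich: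
  assumes "f \<in> lin_span n W" "word_ok n a" "word_ok n b" "\<And>w. w \<in> W \<Longrightarrow> free_word (a @ w @ b) \<in> lin_span n W'"
  shows "free_word a * f * free_word b \<in> lin_span n W'"
  using assms(1)
proof (induction rule: lin_span.induct)
  case (ideal f)
  then show ?case using assms by (intro lin_span.ideal sandwich_ideal)
next
  case (word w c)
  have "free_word a * Poly_Mapping.single (Word w) c * free_word b = Poly_Mapping.single 0 c * free_word (a @ w @ b)"
    by (simp add: free_word_def mult_single plus_word_def zero_word_def)
  then show ?case using span_scale[OF assms(4)[OF word]] by simp
qed (simp add: distrib_left distrib_right lin_span.add)

lemma span_left:
  assumes "f \<in> lin_span n W" "word_ok n a" "\<And>w. w \<in> W \<Longrightarrow> free_word (a @ w) \<in> lin_span n W'"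
  shows "free_word a * f \<in> lin_span n W'"
  using span_sandwich[of f n W a "[]" W'] assms by (simp add: free_word_Nil)

lemma span_right:
  assumes "f \<in> lin_span n W" "word_ok n b" "\<And>w. w \<in> W \<Longrightarrow> free_word (w @ b) \<in> lin_span n W'"
  shows "f * free_word b \<in> lin_span n W'"
  using span_sandwich[of f n W "[]" b W'] assms by (simp add: free_word_Nil)

lemma span_subset:
  assumes "f \<in> lin_span n W" "\<And>w. w \<in> W \<Longrightarrow> free_word w \<in> lin_span n W'"
  shows "f \<in> lin_span n W'"
  using span_left[of f n W "[]" W'] assms by (simp add: free_word_Nil)

lemma span_eqv: "word_eqv n u v \<Longrightarrow> word_ok n u \<Longrightarrow> free_word v \<in> lin_span n W \<Longrightarrow> free_word u \<in> lin_span n W"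
  using span_cong_ideal[of "free_word u" "free_word v" n W] span_cong_ideal[of "free_word u" "- free_word v" n W]
    span_uminus[of "free_word v" n W]
  by (auto simp: word_eqv_def)

lemma span_word_zero: "word_zero n u \<Longrightarrow> word_ok n u \<Longrightarrow> free_word u \<in> lin_span n W"
  by (simp add: word_zero_def lin_span.ideal)

lemma span_closed:
  assumes "f \<in> lin_span n W" "\<And>w. w \<in> W \<Longrightarrow> word_ok n w"
  shows "f \<in> carrier (free_algebra n)"
  using assms(1)
  by (induction rule: lin_span.induct)
    (auto intro: relation_ideal_closed(3) free_single_closed free_add_closed simp: assms(2))

section \<open>Sliding dots\<close>

definition se_word :: "nat \<Rightarrow> gen list \<Rightarrow> bool" where
  "se_word n w \<longleftrightarrow> (\<forall>g\<in>set w. \<exists>i. 1 \<le> i \<and> i < n \<and> (g = Cross i \<or> g = CupCap i))"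

definition dot_word :: "nat \<Rightarrow> gen list \<Rightarrow> bool" where
  "dot_word n w \<longleftrightarrow> (\<forall>g\<in>set w. \<exists>j. 1 \<le> j \<and> j \<le> n \<and> g = Dot j)"

lemma se_word_simps [simp]:
  "se_word n []" "se_word n (g # w) \<longleftrightarrow> (\<exists>i. 1 \<le> i \<and> i < n \<and> (g = Cross i \<or> g = CupCap i)) \<and> se_word n w"
  "se_word n (u @ v) \<longleftrightarrow> se_word n u \<and> se_word n v"
  by (auto simp: se_word_def)

lemma dot_word_simps [simp]:
  "dot_word n []" "dot_word n (g # w) \<longleftrightarrow> (\<exists>j. 1 \<le> j \<and> j \<le> n \<and> g = Dot j) \<and> dot_word n w"
  "dot_word n (u @ v) \<longleftrightarrow> dot_word n u \<and> dot_word n v"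
  by (auto simp: dot_word_def)

lemma se_word_ok: "se_word n w \<Longrightarrow> word_ok n w"
  by (auto simp: se_word_def)

lemma dot_word_ok: "dot_word n w \<Longrightarrow> word_ok n w"
  by (auto simp: dot_word_def)

lemma cross_se_word: "cross_word n w \<Longrightarrow> se_word n w"
  unfolding cross_word_def se_word_def by blast

lemma cup_se_word: "2 * r \<le> n \<Longrightarrow> se_word n (cup_word r)"
  by (auto simp: se_word_def cup_word_def)

text \<open>Both factors may contain cup-caps, so the set is closed under multiplication by
  \<open>s_i\<close> and \<open>e_i\<close>, and it also covers the words built around longer
  products \<open>cup_word q\<close> with \<open>r \<le> q\<close>.\<close>

definition cup_words :: "nat \<Rightarrow> nat \<Rightarrow> gen list set" where
  "cup_words n r = {a @ cup_word r @ b | a b. se_word n a \<and> se_word n b}"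

definition dotted_words :: "nat \<Rightarrow> nat \<Rightarrow> gen list set" where
  "dotted_words n r = {u @ t @ v | u t v. dot_word n u \<and> dot_word n v \<and> t \<in> cup_words n r}"

lemma cup_words_se: "t \<in> cup_words n r \<Longrightarrow> 2 * r \<le> n \<Longrightarrow> se_word n t"
  using cup_se_word by (auto simp: cup_words_def)

lemma cup_words_extend: "t \<in> cup_words n r \<Longrightarrow> se_word n a \<Longrightarrow> se_word n b \<Longrightarrow> a @ t @ b \<in> cup_words n r"
proof -
  assume *: "t \<in> cup_words n r" "se_word n a" "se_word n b"
  then obtain x y where "t = x @ cup_word r @ y" "se_word n x" "se_word n y" by (auto simp: cup_words_def)
  with * have "a @ t @ b = (a @ x) @ cup_word r @ (y @ b)" "se_word n (a @ x)" "se_word n (y @ b)" by auto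
  then show ?thesis unfolding cup_words_def by blast
qed

lemma cup_words_mono:
  assumes "r \<le> r'" "2 * r' \<le> n"
  shows "cup_words n r' \<subseteq> cup_words n r"
proof
  fix t assume "t \<in> cup_words n r'"
  then obtain a b where t: "t = a @ cup_word r' @ b" "se_word n a" "se_word n b" by (auto simp: cup_words_def)
  have "cup_word r' = cup_word r @ map (\<lambda>k. CupCap (2 * k + 1)) [r..<r']"
    using assms upt_add_eq_append[of 0 r "r' - r"] by (simp add: cup_word_def)
  moreover have "se_word n (cup_word r')" using assms by (intro cup_se_word)
  ultimately show "t \<in> cup_words n r"
    using t unfolding cup_words_def
    by (intro CollectI exI[of _ a] exI[of _ "map (\<lambda>k. CupCap (2 * k + 1)) [r..<r'] @ b"]) auto
qed

text \<open>Rewriting with error terms: a subword may be exchanged if the errors, placed in the same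
  context, already lie in the target span.\<close>

lemma span_replace:
  assumes "free_word x - free_word y \<in> lin_span n W" "word_ok n a" "word_ok n b"
    "\<And>w. w \<in> W \<Longrightarrow> free_word (a @ w @ b) \<in> lin_span n W'"
  shows "free_word (a @ x @ b) - free_word (a @ y @ b) \<in> lin_span n W'"
    "free_word (a @ y @ b) \<in> lin_span n W' \<Longrightarrow> free_word (a @ x @ b) \<in> lin_span n W'"
proof -
  have "free_word (a @ x @ b) - free_word (a @ y @ b) = free_word a * (free_word x - free_word y) * free_word b"
    by (simp add: algebra_simps flip: free_word_mult)
  then show 1: "free_word (a @ x @ b) - free_word (a @ y @ b) \<in> lin_span n W'"
    using span_sandwich[of "free_word x - free_word y" n W a b W'] assms by simp
  show "free_word (a @ y @ b) \<in> lin_span n W' \<Longrightarrow> free_word (a @ x @ b) \<in> lin_span n W'"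
    using 1 by (rule span_cong)
qed

lemma span_empty: "lin_span n {} = relation_ideal n"
proof
  show "lin_span n {} \<subseteq> relation_ideal n"
  proof
    fix f assume "f \<in> lin_span n {}"
    then show "f \<in> relation_ideal n" by induction (auto intro: relation_ideal_closed)
  qed
qed (auto intro: lin_span.ideal)

lemma ideal_replace:
  assumes "free_word x - free_word y \<in> relation_ideal n" "word_ok n a" "word_ok n b"
  shows "free_word (a @ x @ b) - free_word (a @ y @ b) \<in> relation_ideal n"
    "free_word (a @ y @ b) \<in> lin_span n W' \<Longrightarrow> free_word (a @ x @ b) \<in> lin_span n W'"
  using span_replace[of x y n "{}" a b "{}"] span_replace[of x y n "{}" a b W'] assms
  by (simp_all add: span_empty)

lemma cross_dot:
  assumes "1 \<le> i" "i < n" "1 \<le> j" "j \<le> n"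
  shows "free_word [Cross i, Dot j] - free_word [Dot (transpose i (i + 1) j), Cross i] \<in> lin_span n {[CupCap i], []}"
    "free_word [Dot j, Cross i] - free_word [Cross i, Dot (transpose i (i + 1) j)] \<in> lin_span n {[CupCap i], []}"
proof -
  let ?S = "lin_span n {[CupCap i], []}" and ?t = "transpose i (i + 1)"
  have e: "free_word [CupCap i] \<in> ?S" "1 \<in> ?S"
    using span_free_word[of "[CupCap i]" "{[CupCap i], []}" n] span_free_word[of "[]" "{[CupCap i], []}" n]
    by (auto simp: free_word_Nil)
  have sy: "free_word [Cross i, Dot i] - free_word [Dot (i + 1), Cross i] \<in> ?S"
    using lin_span.ideal[OF relation_in_ideal[OF relations.sy[OF assms(1,2)]], unfolded free_word_mult append.simps]
    by (rule span_cong) (rule span_diff[OF span_uminus[OF e(1)] e(2)])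
  have ys: "free_word [Dot i, Cross i] - free_word [Cross i, Dot (i + 1)] \<in> ?S"
    using lin_span.ideal[OF relation_in_ideal[OF relations.ys[OF assms(1,2)]], unfolded free_word_mult append.simps]
    by (rule span_cong) (rule span_diff[OF e])
  have main: "free_word [Cross i, Dot j] - free_word [Dot (?t j), Cross i] \<in> ?S" if "1 \<le> j" "j \<le> n" for j
  proof -
    consider "j = i" | "j = i + 1" | "j \<noteq> i" "j \<noteq> i + 1" by blast
    then show ?thesis
    proof cases
      case 1
      then show ?thesis using sy by simp
    next
      case 2
      then show ?thesis using span_uminus[OF ys] by simp
    next
      case 3
      then show ?thesis
        using lin_span.ideal[OF relation_in_ideal[OF relations.sy_comm[OF assms(1,2) that 3]], of "{[CupCap i], []}"]
        by (simp add: free_word_mult transpose_def)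
    qed
  qed
  show "free_word [Cross i, Dot j] - free_word [Dot (?t j), Cross i] \<in> ?S" by (rule main[OF assms(3,4)])
  have "1 \<le> ?t j" "?t j \<le> n" using assms by (auto simp: transpose_def)
  from span_uminus[OF main[OF this]] show "free_word [Dot j, Cross i] - free_word [Cross i, Dot (?t j)] \<in> ?S"
    by simp
qed

lemma cupcap_dot:
  "\<lbrakk>1 \<le> i; i < n; 1 \<le> j; j \<le> n; j \<noteq> i; j \<noteq> i + 1\<rbrakk> \<Longrightarrow>
     free_word [CupCap i, Dot j] - free_word [Dot j, CupCap i] \<in> relation_ideal n"
  using relation_in_ideal[OF relations.ey_comm] by (simp add: free_word_mult)

lemma cupcap_dot_pair:
  "\<lbrakk>1 \<le> i; i < n\<rbrakk> \<Longrightarrow> free_word [CupCap i, Dot i] - free_word [CupCap i, Dot (i + 1)] + free_word [CupCap i] \<in> relation_ideal n"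
  using relation_in_ideal[OF relations.ey] by (simp add: free_word_mult right_diff_distrib)

lemma dot_cupcap_pair:
  "\<lbrakk>1 \<le> i; i < n\<rbrakk> \<Longrightarrow> free_word [Dot i, CupCap i] - free_word [Dot (i + 1), CupCap i] - free_word [CupCap i] \<in> relation_ideal n"
  using relation_in_ideal[OF relations.ye] by (simp add: free_word_mult left_diff_distrib)

text \<open>The sign-sensitive companion of \<open>word_eqv\<close>: reordering commuting letters
  must not disturb the signs inside sums.\<close>

definition word_same :: "nat \<Rightarrow> gen list \<Rightarrow> gen list \<Rightarrow> bool" where
  "word_same n u v \<longleftrightarrow> (word_ok n u \<longleftrightarrow> word_ok n v) \<and> (word_ok n u \<longrightarrow> free_word u - free_word v \<in> relation_ideal n)"

interpretation same: word_congruence "word_same n" for n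
proof
  show "word_same n u u" for u by (simp add: word_same_def relation_ideal_closed)
  show "word_same n v u" if "word_same n u v" for u v
    using that relation_ideal_diff_commute by (auto simp: word_same_def)
  show "word_same n u w" if "word_same n u v" "word_same n v w" for u v w
    using that relation_ideal_closed(2)[of "free_word u - free_word v" n "free_word v - free_word w"]
    by (auto simp: word_same_def)
  show "word_same n (a @ u @ b) (a @ v @ b)" if "word_same n u v" for u v a b
    using that ideal_replace(1)[of u v n a b] unfolding word_same_def by auto
qed

lemma dots_commute:
  assumes "dot_word n u" "mset u = mset v"
  shows "free_word u - free_word v \<in> relation_ideal n"
proof -
  have "word_same n u v"
  proof (rule same.commute_mset[OF assms(2)])
    fix x y assume "x \<in> set u" "y \<in> set u"
    with assms(1) obtain i j where "1 \<le> i" "i \<le> n" "x = Dot i" "1 \<le> j" "j \<le> n" "y = Dot j"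
      unfolding dot_word_def by metis
    then show "word_same n [x, y] [y, x]"
      using relation_in_ideal[OF relations.yy_comm[of i n j]] by (simp add: word_same_def free_word_mult)
  qed
  then show ?thesis using dot_word_ok[OF assms(1)] by (auto simp: word_same_def)
qed

text \<open>Passes from \<open>A = - A\<close> to \<open>A = 0\<close>; over the complex numbers 2
  is invertible.\<close>

lemma ideal_half: "f + f \<in> relation_ideal n \<Longrightarrow> f \<in> relation_ideal n"
proof -
  assume "f + f \<in> relation_ideal n"
  then have "Poly_Mapping.single 0 (1 / 2) * (f + f) \<in> relation_ideal n"
    by (intro relation_ideal_closed(4) const_closed)
  moreover have "Poly_Mapping.single 0 (1 / 2 :: complex) * (f + f) = f"
  proof -
    have "Poly_Mapping.single 0 (1 / 2 :: complex) * (f + f)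
        = (Poly_Mapping.single 0 (1 / 2) + Poly_Mapping.single 0 (1 / 2)) * f"
      by (simp add: distrib_left distrib_right)
    also have "\<dots> = Poly_Mapping.single 0 1 * f" by (simp flip: single_add)
    finally show ?thesis by simp
  qed
  ultimately show ?thesis by simp
qed

fun swap_dot :: "nat \<Rightarrow> gen \<Rightarrow> gen" where
  "swap_dot i (Dot j) = Dot (transpose i (i + 1) j)"
| "swap_dot i g = g"

lemma dot_word_swap: "1 \<le> i \<Longrightarrow> i < n \<Longrightarrow> dot_word n u \<Longrightarrow> dot_word n (map (swap_dot i) u)"
  by (auto simp: dot_word_def transpose_def)

text \<open>
  Moving \<open>s\<^sub>i\<close> across a polynomial \<open>f\<close> in \<open>e\<^sub>i f e\<^sub>i = e\<^sub>i s\<^sub>i f e\<^sub>i\<close> gives \<open>- e\<^sub>i f e\<^sub>i\<close>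
  up to terms with fewer dots, since \<open>e\<^sub>i y\<^sub>i\<close> and \<open>e\<^sub>i y\<^sub>i\<^sub>+\<^sub>1\<close> agree up to \<open>e\<^sub>i\<close>.
\<close>

lemma cupcap_dots_cupcap:
  assumes i: "1 \<le> i" "i < n"
  shows "dot_word n u \<Longrightarrow> free_word (CupCap i # u @ [CupCap i]) \<in> relation_ideal n"
proof (induction "length u" arbitrary: u rule: less_induct)
  case less
  let ?I = "relation_ideal n" and ?e = "CupCap i" and ?s = "swap_dot i"
  let ?E = "\<lambda>w. free_word (?e # w @ [?e])"
  have IH: "?E w \<in> ?I" if "dot_word n w" "length w < length u" for w
    using less that by blast
  \<comment> \<open>Behind \<open>e_i\<close> the dots \<open>y_i\<close> and \<open>y_(i+1)\<close>
    differ by a scalar, and the resulting error has one dot less, hence vanishes by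
    induction.\<close>
  have step1: "?E (a @ Dot j # b) - ?E (a @ Dot (transpose i (i + 1) j) # b) \<in> ?I"
    if d: "dot_word n (a @ Dot j # b)" "length (a @ Dot j # b) = length u" for a b j
  proof -
    have front: "?E (a @ Dot k # b) - ?E (Dot k # a @ b) \<in> ?I" if "1 \<le> k" "k \<le> n" for k
      using ideal_replace(1)[OF dots_commute[of n "a @ Dot k # b" "Dot k # a @ b"], of "[?e]" "[?e]"] d that i by auto
    have ab: "?E (a @ b) \<in> ?I" using d by (intro IH) auto
    have "word_ok n (a @ b)" using d by (intro dot_word_ok) auto
    then have "free_word [] * (free_word [?e, Dot i] - free_word [?e, Dot (i + 1)] + free_word [?e]) * free_word ((a @ b) @ [?e]) \<in> ?I"
      using i by (intro sandwich_ideal cupcap_dot_pair) auto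
    then have "?E (Dot i # a @ b) - ?E (Dot (i + 1) # a @ b) + ?E (a @ b) \<in> ?I"
      by (simp add: free_word_Nil distrib_right left_diff_distrib free_word_mult)
    from relation_ideal_diff[OF this ab] have "?E (Dot i # a @ b) - ?E (Dot (i + 1) # a @ b) \<in> ?I" by simp
    from relation_ideal_diff[OF relation_ideal_closed(2)[OF front[of i] this] front[of "i + 1"]]
    have key: "?E (a @ Dot i # b) - ?E (a @ Dot (i + 1) # b) \<in> ?I" using i by simp
    consider "j = i" | "j = i + 1" | "j \<noteq> i" "j \<noteq> i + 1" by blast
    then show ?thesis
      by cases (use key relation_ideal_diff_commute[OF key] relation_ideal_closed(1) in \<open>simp_all add: transpose_def\<close>)
  qed
  have step2: "?E (a @ b) - ?E (a @ map ?s b) \<in> ?I"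
    if "dot_word n (a @ b)" "length (a @ b) = length u" for a b
    using that
  proof (induction b arbitrary: a)
    case (Cons g b)
    then obtain j where j: "g = Dot j" "1 \<le> j" "j \<le> n" by auto
    have "dot_word n ((a @ [?s g]) @ b)" using Cons.prems j i by (auto simp: transpose_def)
    from Cons.IH[OF this] Cons.prems step1[of a j b] j
    show ?case using relation_ideal_closed(2)[of "?E (a @ g # b) - ?E (a @ ?s g # b)" n] by fastforce
  qed (simp add: relation_ideal_closed)
  have step3: "free_word (?e # a @ Cross i # b @ [?e]) - free_word (?e # a @ map ?s b @ [Cross i, ?e]) \<in> ?I"
    if "dot_word n (a @ b)" "length (a @ b) = length u" for a b
    using that
  proof (induction b arbitrary: a)
    case (Cons g b)
    then obtain j where j: "g = Dot j" "1 \<le> j" "j \<le> n" by auto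
    have ok: "word_ok n (?e # a)" "word_ok n (b @ [?e])" using Cons.prems i dot_word_ok[of n a] dot_word_ok[of n b] by auto
    have "free_word ((?e # a) @ [Cross i, Dot j] @ b @ [?e]) - free_word ((?e # a) @ [Dot (transpose i (i + 1) j), Cross i] @ b @ [?e])
        \<in> lin_span n {}"
    proof (rule span_replace(1)[OF cross_dot(1)[OF i j(2,3)] ok])
      \<comment> \<open>The error \<open>[CupCap i]\<close> creates a factor
        \<open>e_i a e_i\<close>, the error \<open>[]\<close> deletes one dot. In both cases the
        induction hypothesis applies.\<close>
      fix w assume "w \<in> {[CupCap i], []}"
      then consider "w = [?e]" | "w = []" by auto
      then show "free_word ((?e # a) @ w @ b @ [?e]) \<in> lin_span n {}"
      proof cases
        case 1
        have "?E a * free_word (b @ [?e]) \<in> ?I"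
          using Cons.prems ok by (intro relation_ideal_closed(5) IH free_word_closed) auto
        then show ?thesis using 1 by (simp add: span_empty free_word_mult)
      next
        case 2
        then show ?thesis using IH[of "a @ b"] Cons.prems by (simp add: span_empty)
      qed
    qed
    then have 1: "free_word (?e # a @ Cross i # g # b @ [?e]) - free_word (?e # (a @ [?s g]) @ Cross i # b @ [?e]) \<in> ?I"
      using j by (simp add: span_empty)
    have "dot_word n ((a @ [?s g]) @ b)" using Cons.prems j i by (auto simp: transpose_def)
    from relation_ideal_closed(2)[OF 1 Cons.IH[OF this]] Cons.prems show ?case by simp
  qed (simp add: relation_ideal_closed)
  let ?u = "map ?s u"
  have ok: "word_ok n u" "word_ok n ?u"
    using dot_word_ok[OF less.prems] dot_word_ok[OF dot_word_swap[OF i less.prems]] by blast+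
  define A B C D where "A = ?E u" and "B = free_word (?e # Cross i # u @ [?e])"
    and "C = free_word (?e # ?u @ [Cross i, ?e])" and "D = ?E ?u"
  have BA: "B - A \<in> ?I"
    using ideal_replace(1)[OF relation_words(1)[of "[?e, Cross i]" "[?e]"], of n "[]" "u @ [?e]"]
      relations.es[OF i] ok i by (auto simp: A_def B_def free_word_mult)
  have BC: "B - C \<in> ?I" using step3[of "[]" u] less.prems by (simp add: B_def C_def)
  have CD: "C + D \<in> ?I"
  proof -
    have "free_word [Cross i, ?e] + free_word [?e] \<in> ?I"
      using relation_words(2)[of "[Cross i, ?e]" "[?e]" n] relations.se[OF i] by (simp add: free_word_mult)
    then have "free_word (?e # ?u) * (free_word [Cross i, ?e] + free_word [?e]) \<in> ?I"
      using ok i by (intro relation_ideal_closed(4) free_word_closed) auto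
    then show ?thesis by (simp add: C_def D_def distrib_left free_word_mult)
  qed
  have AD: "A - D \<in> ?I" using step2[of "[]" u] less.prems by (simp add: A_def D_def)
  \<comment> \<open>The four congruences say \<open>A = B = C = - D = - A\<close>.\<close>
  have "(A - D) - (B - A) + (B - C) + (C + D) \<in> ?I"
    by (rule relation_ideal_closed(2)[OF relation_ideal_closed(2)[OF relation_ideal_diff[OF AD BA] BC] CD])
  moreover have "(A - D) - (B - A) + (B - C) + (C + D) = A + A" by simp
  ultimately show "?E u \<in> ?I" using ideal_half[of A n] by (simp add: A_def)
qed

text \<open>Each crossing passed leaves error terms \<open>e_i\<close> and 1 in which the dot has
  disappeared.\<close>

lemma cross_word_slide:
  "cross_word n u \<Longrightarrow> 1 \<le> j \<Longrightarrow> j \<le> n \<Longrightarrow>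
    free_word (u @ [Dot j]) - free_word (Dot (word_perm u j) # u) \<in> lin_span n {w. se_word n w}"
proof (induction u)
  case (Cons g u)
  let ?S = "lin_span n {w. se_word n w}"
  from Cons obtain i where i: "g = Cross i" "1 \<le> i" "i < n" by auto
  have u: "cross_word n u" using Cons by simp
  let ?j = "word_perm u j"
  have j: "1 \<le> ?j" "?j \<le> n" using permutes_in_image[OF word_perm_permutes[OF u], of j] Cons by auto
  have oku: "word_ok n u" "se_word n u" using cross_se_word[OF u] se_word_ok by auto
  have "free_word ([g] @ (u @ [Dot j]) @ []) - free_word ([g] @ (Dot ?j # u) @ []) \<in> ?S"
    using i by (intro span_replace(1)[OF Cons.IH[OF u Cons.prems(2,3)]]) (auto intro: span_free_word)
  moreover have "free_word ([] @ [Cross i, Dot ?j] @ u) - free_word ([] @ [Dot (transpose i (i + 1) ?j), Cross i] @ u) \<in> ?S"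
    using oku i by (intro span_replace(1)[OF cross_dot(1)[OF i(2,3) j]]) (auto intro!: span_free_word)
  ultimately show ?case
    using lin_span.add[of "free_word (g # u @ [Dot j]) - free_word (g # Dot ?j # u)" n] i by fastforce
qed (simp add: span_zero)

lemma cup_word_through:
  assumes "2 * r < c" "c \<le> n"
  shows "free_word (Dot c # cup_word r) - free_word (cup_word r @ [Dot c]) \<in> relation_ideal n"
proof -
  have "word_same n (Dot c # cup_word r) (cup_word r @ [Dot c])"
  proof (rule same.commute_word)
    fix g assume "g \<in> set (cup_word r)"
    then obtain k where "k < r" "g = CupCap (2 * k + 1)" by (auto simp: cup_word_def)
    then show "word_same n [Dot c, g] [g, Dot c]"
      using relation_ideal_diff_commute[OF cupcap_dot[of "2 * k + 1" n c]] assms by (auto simp: word_same_def)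
  qed
  then show ?thesis using assms by (auto simp: word_same_def cup_word_def)
qed

text \<open>The factor of the arc through \<open>c\<close> can be brought next to the dot, where the
  relations \<open>ye\<close> and \<open>ey\<close> move the dot to the other end at the price of a
  multiple of the word without the dot.\<close>

lemma cup_word_mate:
  assumes "2 * r \<le> n" "1 \<le> c" "c \<le> 2 * r"
  shows "free_word (Dot c # cup_word r) - free_word (Dot (mate c) # cup_word r) \<in> lin_span n {cup_word r}"
    "free_word (cup_word r @ [Dot c]) - free_word (cup_word r @ [Dot (mate c)]) \<in> lin_span n {cup_word r}"
proof -
  let ?S = "lin_span n {cup_word r}" and ?c = "free_word (cup_word r)"
  have cS: "?c \<in> ?S" by (rule span_free_word) simp
  obtain k where k: "k < r" "(c = 2 * k + 1 \<and> mate c = 2 * k + 2) \<or> (c = 2 * k + 2 \<and> mate c = 2 * k + 1)"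
    using mate_cases[OF assms(2,3)] by metis
  let ?i = "2 * k + 1"
  have i: "1 \<le> ?i" "?i < n" using k assms by auto
  let ?e = "CupCap ?i"
  have "?e \<in> set (cup_word r)" using k by (auto simp: cup_word_def)
  then obtain a b where ab: "cup_word r = a @ ?e # b" by (auto simp: in_set_conv_decomp)
  have com: "word_same n [x, g] [g, x]" if xg: "x \<in> set (cup_word r)" "g \<in> set (cup_word r)" for x g
  proof -
    obtain p q where pq: "p < r" "q < r" "x = CupCap (2 * p + 1)" "g = CupCap (2 * q + 1)"
      using xg by (auto simp: cup_word_def)
    show ?thesis
    proof (cases "p = q")
      case False
      then have "\<bar>int (2 * p + 1) - int (2 * q + 1)\<bar> > 1" by linarith
      then show ?thesis using relation_in_ideal[OF relations.ee_comm[of "2 * p + 1" n "2 * q + 1"]] pq assms(1)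
        by (simp add: word_same_def free_word_mult)
    qed (use pq in simp)
  qed
  have "word_same n (cup_word r) (?e # a @ b)" "word_same n (cup_word r) ((a @ b) @ [?e])"
    by (rule same.commute_mset, simp add: ab, rule com, assumption+)+
  moreover have ok: "word_ok n (cup_word r)" "word_ok n (a @ b)"
    using se_word_ok[OF cup_se_word[OF assms(1)]] ab by auto
  ultimately have L: "?c - free_word (?e # a @ b) \<in> relation_ideal n" and R: "?c - free_word ((a @ b) @ [?e]) \<in> relation_ideal n"
    by (auto simp: word_same_def)
  let ?y = "free_word [Dot ?i]" and ?y' = "free_word [Dot (?i + 1)]"
  have yc: "?y \<in> carrier (free_algebra n)" "?y' \<in> carrier (free_algebra n)" "(1::free_alg) \<in> carrier (free_algebra n)"
    using i by (auto intro!: free_word_closed free_one_closed)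
  have "(?y - ?y' - 1) * (?c - free_word (?e # a @ b)) \<in> relation_ideal n"
    using L yc by (intro relation_ideal_closed(4) free_diff_closed)
  moreover have "(free_word [Dot ?i, ?e] - free_word [Dot (?i + 1), ?e] - free_word [?e]) * free_word (a @ b) \<in> relation_ideal n"
    using ok(2) by (intro relation_ideal_closed(5) dot_cupcap_pair i free_word_closed)
  then have "(?y - ?y' - 1) * free_word (?e # a @ b) \<in> relation_ideal n"
    by (simp add: left_diff_distrib free_word_mult)
  ultimately have "(?y - ?y' - 1) * ?c \<in> relation_ideal n"
    using relation_ideal_closed(2) by (fastforce simp: right_diff_distrib)
  then have l: "?y * ?c - ?y' * ?c - ?c \<in> relation_ideal n" by (simp add: left_diff_distrib)
  have "(?c - free_word ((a @ b) @ [?e])) * (?y - ?y' + 1) \<in> relation_ideal n"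
    using R yc by (intro relation_ideal_closed(5) free_diff_closed free_add_closed)
  moreover have "free_word (a @ b) * (free_word [?e, Dot ?i] - free_word [?e, Dot (?i + 1)] + free_word [?e]) \<in> relation_ideal n"
    using ok(2) by (intro relation_ideal_closed(4) cupcap_dot_pair i free_word_closed)
  then have "free_word ((a @ b) @ [?e]) * (?y - ?y' + 1) \<in> relation_ideal n"
    by (simp add: right_diff_distrib distrib_left free_word_mult)
  ultimately have "?c * (?y - ?y' + 1) \<in> relation_ideal n"
    using relation_ideal_closed(2) by (fastforce simp: left_diff_distrib)
  then have rr: "?c * ?y - ?c * ?y' - (- ?c) \<in> relation_ideal n" by (simp add: right_diff_distrib distrib_left)
  have l': "free_word (Dot ?i # cup_word r) - free_word (Dot (?i + 1) # cup_word r) \<in> ?S"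
    using span_cong_ideal[OF l cS] by (simp add: free_word_mult)
  have r': "free_word (cup_word r @ [Dot ?i]) - free_word (cup_word r @ [Dot (?i + 1)]) \<in> ?S"
    using span_cong_ideal[OF rr span_uminus[OF cS]] by (simp add: free_word_mult)
  have ii: "?i + 1 = 2 * k + 2" by simp
  show "free_word (Dot c # cup_word r) - free_word (Dot (mate c) # cup_word r) \<in> ?S"
    using k(2) l' span_uminus[OF l'] unfolding ii by auto
  show "free_word (cup_word r @ [Dot c]) - free_word (cup_word r @ [Dot (mate c)]) \<in> ?S"
    using k(2) r' span_uminus[OF r'] unfolding ii by auto
qed

fun dot_at :: "point \<Rightarrow> gen list \<Rightarrow> gen list" where
  "dot_at (Top j) w = Dot j # w"
| "dot_at (Bot j) w = w @ [Dot j]"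

text \<open>Replacing \<open>u\<close> by \<open>v\<close> multiplies both terms of the difference
  by the same sign, and spans are closed under negation.\<close>

lemma dot_at_eqv:
  assumes "word_eqv n u v" "word_ok n u" "P \<in> points n" "Q \<in> points n"
    "free_word (dot_at P v) - free_word (dot_at Q v) \<in> lin_span n W"
  shows "free_word (dot_at P u) - free_word (dot_at Q u) \<in> lin_span n W"
proof -
  let ?d = "\<lambda>P f. case P of Top j \<Rightarrow> free_word [Dot j] * f | Bot j \<Rightarrow> f * free_word [Dot j]"
  have d: "free_word (dot_at R w) = ?d R (free_word w)" for R w by (cases R) (simp_all add: free_word_mult)
  have I: "?d R f \<in> relation_ideal n" if "f \<in> relation_ideal n" "R \<in> points n" for R f
    using that relation_ideal_closed(4,5)[OF that(1) free_word_closed] by (cases R) auto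
  have lin: "?d R (f - g) = ?d R f - ?d R g" "?d R (f + g) = ?d R f + ?d R g" for R f g
    by (cases R; simp add: algebra_simps)+
  from assms(1,2) consider "free_word u - free_word v \<in> relation_ideal n" | "free_word u + free_word v \<in> relation_ideal n"
    by (auto simp: word_eqv_def)
  then show ?thesis
  proof cases
    case 1
    have "?d P (free_word u - free_word v) - ?d Q (free_word u - free_word v) \<in> relation_ideal n"
      using I[OF 1] assms(3,4) by (intro relation_ideal_diff) auto
    then have "(free_word (dot_at P u) - free_word (dot_at Q u)) - (free_word (dot_at P v) - free_word (dot_at Q v)) \<in> relation_ideal n"
      unfolding d lin by (simp add: algebra_simps)
    then show ?thesis by (rule span_cong_ideal) (rule assms(5))
  next
    case 2
    have "?d P (free_word u + free_word v) - ?d Q (free_word u + free_word v) \<in> relation_ideal n"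
      using I[OF 2] assms(3,4) by (intro relation_ideal_diff) auto
    then have "(free_word (dot_at P u) - free_word (dot_at Q u)) - (- (free_word (dot_at P v) - free_word (dot_at Q v))) \<in> relation_ideal n"
      unfolding d lin by (simp add: algebra_simps)
    then show ?thesis by (rule span_cong_ideal) (rule span_uminus[OF assms(5)])
  qed
qed

lemma perm_word_se: "\<sigma> permutes {1..n} \<Longrightarrow> se_word n (perm_word n \<sigma>)"
  using perm_word(1) cross_se_word by blast

lemma normal_word_cup: "\<sigma> permutes {1..n} \<Longrightarrow> \<tau> permutes {1..n} \<Longrightarrow> normal_word n \<sigma> r \<tau> \<in> cup_words n r"
  using perm_word_se by (auto simp: normal_word_def cup_words_def)

text \<open>The dot travels through the outer permutation to \<open>cup_word r\<close>, then along
  an arc or a through strand, and back out. Every step has errors without the dot in the span of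
  \<open>cup_words n r\<close>.\<close>

lemma slide_dot:
  assumes \<sigma>: "\<sigma> permutes {1..n}" and \<tau>: "\<tau> permutes {1..n}" and r: "2 * r \<le> n"
    and w: "word_eqv n w (normal_word n \<sigma> r \<tau>)" "word_ok n w" and P: "P \<in> points n"
  shows "free_word (dot_at P w) - free_word (dot_at (word_pairing \<sigma> r \<tau> P) w) \<in> lin_span n (cup_words n r)"
proof -
  let ?S = "lin_span n (cup_words n r)" and ?X = "normal_word n \<sigma> r \<tau>"
  let ?p = "perm_word n \<sigma>" and ?q = "perm_word n \<tau>" and ?c = "cup_word r"
  \<comment> \<open>The intermediate position: the dot sits immediately above or below
    \<open>cup_word r\<close>.\<close>
  define mid where "mid L = (case L of Top x \<Rightarrow> free_word (?p @ (Dot x # ?c) @ ?q) | Bot x \<Rightarrow> free_word (?p @ (?c @ [Dot x]) @ ?q))" for L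
  note pw = perm_word[OF \<sigma>] perm_word[OF \<tau>]
  note se = perm_word_se[OF \<sigma>] perm_word_se[OF \<tau>] cup_se_word[OF r]
  note ok = se[THEN se_word_ok]
  have okc: "word_ok n (?c @ ?q)" "word_ok n (?p @ ?c)" using ok by auto
  have 1: "free_word (dot_at (relabel \<sigma> (pinv \<tau>) L) ?X) - mid L \<in> ?S" if "L \<in> points n" for L
  proof (cases L)
    case (Top x)
    have "free_word ([] @ (?p @ [Dot x]) @ ?c @ ?q) - free_word ([] @ (Dot (word_perm ?p x) # ?p) @ ?c @ ?q) \<in> ?S"
    proof (rule span_replace(1)[OF cross_word_slide[OF pw(1)] _ okc(1)])
      fix w assume "w \<in> {w. se_word n w}"
      then show "free_word ([] @ w @ ?c @ ?q) \<in> ?S"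
        using se by (intro span_free_word) (auto simp: cup_words_def)
    qed (use that Top in auto)
    from span_uminus[OF this] show ?thesis using Top pw by (simp add: normal_word_def mid_def)
  next
    case (Bot x)
    have "1 \<le> pinv \<tau> x \<and> pinv \<tau> x \<le> n" using permutes_in_image[OF permutes_inv[OF \<tau>], of x] that Bot by simp
    then have "free_word ((?p @ ?c) @ (?q @ [Dot (pinv \<tau> x)]) @ []) - free_word ((?p @ ?c) @ (Dot (word_perm ?q (pinv \<tau> x)) # ?q) @ []) \<in> ?S"
    proof (intro span_replace(1)[OF cross_word_slide[OF pw(3)] okc(2)])
      fix w assume "w \<in> {w. se_word n w}"
      then show "free_word ((?p @ ?c) @ w @ []) \<in> ?S"
        using se by (intro span_free_word) (auto simp: cup_words_def)
    qed auto
    then show ?thesis using Bot pw permutes_inverses(1)[OF \<tau>] by (simp add: normal_word_def mid_def)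
  qed
  have memb: "free_word (?p @ w @ ?q) \<in> ?S" if "w \<in> {?c}" for w
    using that se by (intro span_free_word) (auto simp: cup_words_def)
  have thr: "mid (Top x) - mid (Bot x) \<in> ?S" if "2 * r < x" "x \<le> n" for x
    using lin_span.ideal[OF ideal_replace(1)[OF cup_word_through[OF that] ok(1,2)]]
    by (simp add: mid_def)
  have 2: "mid L - mid (base_pairing r L) \<in> ?S" if "L \<in> points n" for L
  proof (cases L)
    case (Top x)
    show ?thesis
    proof (cases "x \<le> 2 * r")
      case True
      have "free_word (?p @ (Dot x # ?c) @ ?q) - free_word (?p @ (Dot (mate x) # ?c) @ ?q) \<in> ?S"
        using True that Top by (intro span_replace(1)[OF cup_word_mate(1)[OF r] ok(1,2) memb]) auto
      then show ?thesis using True Top by (simp add: mid_def)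
    qed (use thr Top that in auto)
  next
    case (Bot x)
    show ?thesis
    proof (cases "x \<le> 2 * r")
      case True
      have "free_word (?p @ (?c @ [Dot x]) @ ?q) - free_word (?p @ (?c @ [Dot (mate x)]) @ ?q) \<in> ?S"
        using True that Bot by (intro span_replace(1)[OF cup_word_mate(2)[OF r] ok(1,2) memb]) auto
      then show ?thesis using True Bot by (simp add: mid_def)
    next
      case False
      then show ?thesis using span_uminus[OF thr[of x]] Bot that by auto
    qed
  qed
  obtain L where L: "L \<in> points n" "P = relabel \<sigma> (pinv \<tau>) L" using relabel_obtain[OF \<sigma> \<tau> P] by blast
  let ?L = "base_pairing r L"
  have L': "?L \<in> points n" using pairingD(1)[OF pairing_base[OF r] L(1)] .
  have Q: "word_pairing \<sigma> r \<tau> P = relabel \<sigma> (pinv \<tau>) ?L" using L word_pairing_relabel[OF \<sigma> \<tau>] by simp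
  have "(free_word (dot_at P ?X) - mid L) + (mid L - mid ?L) - (free_word (dot_at (word_pairing \<sigma> r \<tau> P) ?X) - mid ?L) \<in> ?S"
    unfolding Q unfolding L(2) by (intro span_diff lin_span.add 1 2 L(1) L')
  then have "free_word (dot_at P ?X) - free_word (dot_at (word_pairing \<sigma> r \<tau> P) ?X) \<in> ?S" by simp
  then show ?thesis
    using dot_at_eqv[OF w P] pairingD(1)[OF pairing_word[OF \<sigma> \<tau> r] P] by blast
qed

context brauer_words begin

text \<open>Naturality pulls the factor belonging to the cup out to the front. This exhibits the
  second \<open>e_i\<close> needed for \<open>e_i f e_i = 0\<close>.\<close>

lemma normal_word_top_cup:
  assumes \<sigma>: "perm \<sigma>" and \<tau>: "perm \<tau>" and r: "2 * r \<le> n" and i: "1 \<le> i" "i < n"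
    and cup: "word_pairing \<sigma> r \<tau> (Top i) = Top (i + 1)"
  shows "\<exists>w. normal_word n \<sigma> r \<tau> \<approx> CupCap i # w"
proof -
  let ?a = "pinv \<sigma> i"
  have s: "\<sigma> ?a = i" using permutes_inverses(1)[OF \<sigma>] by simp
  have a: "1 \<le> ?a" using permutes_in_image[OF permutes_inv[OF \<sigma>], of i] i by auto
  have c: "?a \<le> 2 * r" "\<sigma> (mate ?a) = i + 1"
    using cup word_pairing_top(1)[OF \<sigma> \<tau>, of r ?a] s by (auto split: if_splits)
  obtain k where k: "k < r" "{?a, mate ?a} = {2 * k + 1, 2 * k + 2}" using mate_pair[OF a c(1)] by blast
  have im: "{\<sigma> (2 * k + 1), \<sigma> (2 * k + 2)} = {i, i + 1}" using arg_cong[OF k(2), of "image \<sigma>"] c s by simp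
  obtain v where v: "cup_word r \<approx> CupCap (2 * k + 1) # v" using cup_split[OF r k(1)] by blast
  have nat: "CupCap i # P \<sigma> \<approx> P \<sigma> @ [CupCap (2 * k + 1)]"
    by (rule naturality[OF \<sigma> im]) (use i r k in simp_all)
  have "normal_word n \<sigma> r \<tau> \<approx> (P \<sigma> @ [CupCap (2 * k + 1)]) @ v @ P \<tau>"
    unfolding normal_word_def using cong[OF v, of "P \<sigma>" "P \<tau>"] by simp
  also have "\<dots> \<approx> CupCap i # P \<sigma> @ v @ P \<tau>" using cong_right[OF sym[OF nat], of "v @ P \<tau>"] by simp
  finally show ?thesis by blast
qed

lemma normal_word_bot_cap:
  assumes \<sigma>: "perm \<sigma>" and \<tau>: "perm \<tau>" and r: "2 * r \<le> n" and i: "1 \<le> i" "i < n"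
    and cap: "word_pairing \<sigma> r \<tau> (Bot i) = Bot (i + 1)"
  shows "\<exists>w. normal_word n \<sigma> r \<tau> \<approx> w @ [CupCap i]"
proof -
  let ?a = "\<tau> i"
  have s: "pinv \<tau> ?a = i" using permutes_inverses(2)[OF \<tau>] by simp
  have a: "1 \<le> ?a" using permutes_in_image[OF \<tau>, of i] i by auto
  have c: "?a \<le> 2 * r" "pinv \<tau> (mate ?a) = i + 1"
    using cap word_pairing_top(2)[OF \<sigma> \<tau>, of r ?a] s by (auto split: if_splits)
  then have "\<tau> (i + 1) = mate ?a" using permutes_inverses(1)[OF \<tau>] by metis
  moreover obtain k where k: "k < r" "{?a, mate ?a} = {2 * k + 1, 2 * k + 2}" using mate_pair[OF a c(1)] by blast
  ultimately have im: "{\<tau> i, \<tau> (i + 1)} = {2 * k + 1, 2 * k + 1 + 1}" by (simp add: add.commute)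
  obtain v where v: "cup_word r \<approx> CupCap (2 * k + 1) # v" using cup_split[OF r k(1)] by blast
  have "CupCap (2 * k + 1) \<in> set (cup_word r)" using k by (auto simp: cup_word_def)
  then obtain x y where xy: "cup_word r = x @ CupCap (2 * k + 1) # y" by (auto simp: in_set_conv_decomp)
  have c: "cup_word r \<approx> (x @ y) @ [CupCap (2 * k + 1)]" by (rule sym, rule cup_mset[OF r]) (simp add: xy)
  have nat: "CupCap (2 * k + 1) # P \<tau> \<approx> P \<tau> @ [CupCap i]"
    by (rule naturality[OF \<tau> im]) (use i r k in simp_all)
  have "normal_word n \<sigma> r \<tau> \<approx> P \<sigma> @ ((x @ y) @ [CupCap (2 * k + 1)]) @ P \<tau>"
    unfolding normal_word_def by (rule cong[OF c])
  also have "\<dots> \<approx> (P \<sigma> @ x @ y @ P \<tau>) @ [CupCap i]"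
    using cong_left[OF nat, of "P \<sigma> @ x @ y"] by simp
  finally show ?thesis by blast
qed

end

section \<open>Closure of the dotted words under multiplication by generators\<close>

lemma dotted_words_I: "dot_word n u \<Longrightarrow> dot_word n v \<Longrightarrow> t \<in> cup_words n r \<Longrightarrow> u @ t @ v \<in> dotted_words n r"
  by (auto simp: dotted_words_def)

lemma dotted_span_dot:
  assumes "f \<in> lin_span n (dotted_words n r)" "1 \<le> j" "j \<le> n"
  shows "free_word [Dot j] * f \<in> lin_span n (dotted_words n r)" "f * free_word [Dot j] \<in> lin_span n (dotted_words n r)"
proof -
  have j: "dot_word n [Dot j]" "word_ok n [Dot j]" using assms by auto
  show "free_word [Dot j] * f \<in> lin_span n (dotted_words n r)"
  proof (rule span_left[OF assms(1) j(2)])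
    fix w assume "w \<in> dotted_words n r"
    then obtain u t v where w: "w = u @ t @ v" "dot_word n u" "dot_word n v" "t \<in> cup_words n r"
      by (auto simp: dotted_words_def)
    then have "([Dot j] @ u) @ t @ v \<in> dotted_words n r" using j by (intro dotted_words_I) auto
    then show "free_word ([Dot j] @ w) \<in> lin_span n (dotted_words n r)" using w by (intro span_free_word) simp
  qed
  show "f * free_word [Dot j] \<in> lin_span n (dotted_words n r)"
  proof (rule span_right[OF assms(1) j(2)])
    fix w assume "w \<in> dotted_words n r"
    then obtain u t v where w: "w = u @ t @ v" "dot_word n u" "dot_word n v" "t \<in> cup_words n r"
      by (auto simp: dotted_words_def)
    then have "u @ t @ (v @ [Dot j]) \<in> dotted_words n r" using j by (intro dotted_words_I) auto
    then show "free_word (w @ [Dot j]) \<in> lin_span n (dotted_words n r)" using w by (intro span_free_word) simp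
  qed
qed

lemma cup_words_cases:
  assumes "t \<in> cup_words n r" "2 * r \<le> n"
  obtains "word_zero n t" | \<sigma> r' \<tau> where "\<sigma> permutes {1..n}" "\<tau> permutes {1..n}" "2 * r' \<le> n" "r \<le> r'"
    "word_eqv n t (normal_word n \<sigma> r' \<tau>)"
proof -
  obtain a b where t: "t = a @ cup_word r @ b" "se_word n a" "se_word n b" using assms by (auto simp: cup_words_def)
  have "VV_words.reducible n r (a @ cup_word r @ b)"
    by (rule VV_words.reducible_cup_word[OF assms(2)]) (use t in \<open>auto simp: se_word_def\<close>)
  then show ?thesis using that t(1) unfolding VV_words.reducible_def by blast
qed

text \<open>The dot at \<open>i\<close> is slid along its strand in \<open>t\<close>. At the bottom
  it joins \<open>v\<close> (\<open>IH\<close>); at a top point other than \<open>i + 1\<close> it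
  falls under \<open>IH_dot\<close>; at \<open>i + 1\<close> the word \<open>t\<close> is
  zero-producing, since it begins with \<open>e_i\<close> and the dots between two cup-caps give 0.
  The errors of the slide have lost the dot and also fall under \<open>IH\<close>.\<close>

lemma cupcap_through_dots:
  assumes i: "1 \<le> i" "i < n" and r: "2 * r \<le> n" and t: "t \<in> cup_words n r"
    and uv: "dot_word n u" "dot_word n v"
    and IH: "\<And>t v. t \<in> cup_words n r \<Longrightarrow> dot_word n v \<Longrightarrow> free_word (CupCap i # u @ t @ v) \<in> lin_span n (dotted_words n r)"
    and IH_dot: "\<And>j. 1 \<le> j \<Longrightarrow> j \<le> n \<Longrightarrow> j \<noteq> i \<Longrightarrow> j \<noteq> i + 1 \<Longrightarrow>
       free_word (CupCap i # u @ Dot j # t @ v) \<in> lin_span n (dotted_words n r)"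
  shows "free_word (CupCap i # u @ Dot i # t @ v) \<in> lin_span n (dotted_words n r)"
proof -
  let ?S = "lin_span n (dotted_words n r)" and ?e = "CupCap i"
  have ok: "word_ok n (?e # u)" "word_ok n v" "word_ok n t" "word_ok n (?e # u @ Dot i # t @ v)"
    using i dot_word_ok[OF uv(1)] dot_word_ok[OF uv(2)] se_word_ok[OF cup_words_se[OF t r]] by auto
  from t r show ?thesis
  proof (cases rule: cup_words_cases)
    case 1
    from VV_words.Z_cong[OF this, of "?e # u @ [Dot i]" v] show ?thesis
      using ok by (intro span_word_zero) auto
  next
    case (2 \<sigma> r' \<tau>)
    let ?Q = "word_pairing \<sigma> r' \<tau> (Top i)"
    note pf = pairing_word[OF 2(1,2,3)]
    have Pi: "Top i \<in> points n" using i by simp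
    have sl: "free_word (Dot i # t) - free_word (dot_at ?Q t) \<in> lin_span n (cup_words n r)"
      using slide_dot[OF 2(1,2,3,5) ok(3) Pi] cup_words_mono[OF 2(4,3)]
      by (auto intro: span_subset span_free_word)
    have rep: "free_word ((?e # u) @ (Dot i # t) @ v) \<in> ?S" if "free_word ((?e # u) @ dot_at ?Q t @ v) \<in> ?S"
      using IH uv(2) by (intro span_replace(2)[OF sl ok(1,2) _ that]) simp
    show ?thesis
    proof (cases ?Q)
      case (Top m)
      then have m: "1 \<le> m" "m \<le> n" "m \<noteq> i" using pairingD(1,3)[OF pf Pi] by auto
      show ?thesis
      proof (cases "m = i + 1")
        case True
        then obtain w where w: "word_eqv n (normal_word n \<sigma> r' \<tau>) (?e # w)"
          using VV_words.normal_word_top_cup[OF 2(1,2,3) i] Top by blast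
        have "word_eqv n t (?e # w)" using VV_words.trans[OF 2(5) w] .
        then have e: "word_eqv n (?e # u @ Dot i # t @ v) ((?e # (u @ [Dot i]) @ [?e]) @ w @ v)"
          using VV_words.cong[of n t "?e # w" "?e # u @ [Dot i]" v] by simp
        have "word_zero n (?e # (u @ [Dot i]) @ [?e])"
          using cupcap_dots_cupcap[OF i, of "u @ [Dot i]"] uv i by (simp add: word_zero_def)
        from VV_words.Z_cong[OF this, of "[]" "w @ v"]
        have "word_zero n ((?e # (u @ [Dot i]) @ [?e]) @ w @ v)" by simp
        then have "word_zero n (?e # u @ Dot i # t @ v)" using VV_words.Z_eqv[OF VV_words.sym[OF e]] by blast
        then show ?thesis using ok(4) by (rule span_word_zero)
      next
        case False
        then show ?thesis using rep IH_dot[OF m] Top by simp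
      qed
    next
      case (Bot m)
      then have "dot_word n (Dot m # v)" using pairingD(1)[OF pf Pi] uv by auto
      then show ?thesis using rep IH[OF t] Bot by simp
    qed
  qed
qed

text \<open>The mirror image of \<open>cupcap_through_dots\<close>. It is argued again because
  reversal is available only up to sign, which does not suffice for sums.\<close>

lemma dots_through_cupcap:
  assumes i: "1 \<le> i" "i < n" and r: "2 * r \<le> n" and t: "t \<in> cup_words n r"
    and uv: "dot_word n u" "dot_word n v"
    and IH: "\<And>t u. t \<in> cup_words n r \<Longrightarrow> dot_word n u \<Longrightarrow> free_word (u @ t @ v @ [CupCap i]) \<in> lin_span n (dotted_words n r)"
    and IH_dot: "\<And>j. 1 \<le> j \<Longrightarrow> j \<le> n \<Longrightarrow> j \<noteq> i \<Longrightarrow> j \<noteq> i + 1 \<Longrightarrow>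
       free_word (u @ t @ Dot j # v @ [CupCap i]) \<in> lin_span n (dotted_words n r)"
  shows "free_word (u @ t @ Dot i # v @ [CupCap i]) \<in> lin_span n (dotted_words n r)"
proof -
  let ?S = "lin_span n (dotted_words n r)" and ?e = "CupCap i"
  have ok: "word_ok n u" "word_ok n (v @ [?e])" "word_ok n t" "word_ok n (u @ t @ Dot i # v @ [?e])"
    using i dot_word_ok[OF uv(1)] dot_word_ok[OF uv(2)] se_word_ok[OF cup_words_se[OF t r]] by auto
  from t r show ?thesis
  proof (cases rule: cup_words_cases)
    case 1
    from VV_words.Z_cong[OF this, of u "Dot i # v @ [?e]"] show ?thesis
      using ok by (intro span_word_zero) auto
  next
    case (2 \<sigma> r' \<tau>)
    let ?Q = "word_pairing \<sigma> r' \<tau> (Bot i)"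
    note pf = pairing_word[OF 2(1,2,3)]
    have Pi: "Bot i \<in> points n" using i by simp
    have sl: "free_word (t @ [Dot i]) - free_word (dot_at ?Q t) \<in> lin_span n (cup_words n r)"
      using slide_dot[OF 2(1,2,3,5) ok(3) Pi] cup_words_mono[OF 2(4,3)]
      by (auto intro: span_subset span_free_word)
    have rep: "free_word (u @ (t @ [Dot i]) @ v @ [?e]) \<in> ?S" if "free_word (u @ dot_at ?Q t @ v @ [?e]) \<in> ?S"
      using IH uv(1) by (intro span_replace(2)[OF sl ok(1,2) _ that]) simp
    show ?thesis
    proof (cases ?Q)
      case (Bot m)
      then have m: "1 \<le> m" "m \<le> n" "m \<noteq> i" using pairingD(1,3)[OF pf Pi] by auto
      show ?thesis
      proof (cases "m = i + 1")
        case True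
        then obtain w where w: "word_eqv n (normal_word n \<sigma> r' \<tau>) (w @ [?e])"
          using VV_words.normal_word_bot_cap[OF 2(1,2,3) i] Bot by blast
        have "word_eqv n t (w @ [?e])" using VV_words.trans[OF 2(5) w] .
        then have e: "word_eqv n (u @ t @ Dot i # v @ [?e]) ((u @ w) @ (?e # (Dot i # v) @ [?e]) @ [])"
          using VV_words.cong[of n t "w @ [?e]" u "Dot i # v @ [?e]"] by simp
        have "word_zero n (?e # (Dot i # v) @ [?e])"
          using cupcap_dots_cupcap[OF i, of "Dot i # v"] uv i by (simp add: word_zero_def)
        from VV_words.Z_cong[OF this, of "u @ w" "[]"]
        have "word_zero n (u @ t @ Dot i # v @ [?e])" by (rule VV_words.Z_eqv[OF VV_words.sym[OF e]])
        then show ?thesis using ok(4) by (rule span_word_zero)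
      next
        case False
        then show ?thesis using rep IH_dot[OF m] Bot by simp
      qed
    next
      case (Top m)
      then have "dot_word n (u @ [Dot m])" using pairingD(1)[OF pf Pi] uv by auto
      then show ?thesis using rep IH[OF t, of "u @ [Dot m]"] Top by simp
    qed
  qed
qed

lemma swap_cupcap_dot:
  assumes "1 \<le> i" "i < n"
  shows "free_word [CupCap i, Dot (i + 1)] - free_word [CupCap i, Dot i] \<in> lin_span n {[CupCap i]}"
    "free_word [Dot (i + 1), CupCap i] - free_word [Dot i, CupCap i] \<in> lin_span n {[CupCap i]}"
proof -
  have e: "free_word [CupCap i] \<in> lin_span n {[CupCap i]}" by (rule span_free_word) simp
  have "(free_word [CupCap i, Dot (i + 1)] - free_word [CupCap i, Dot i]) - free_word [CupCap i] \<in> relation_ideal n"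
    using relation_ideal_uminus[OF cupcap_dot_pair[OF assms]] by (simp add: algebra_simps)
  then show "free_word [CupCap i, Dot (i + 1)] - free_word [CupCap i, Dot i] \<in> lin_span n {[CupCap i]}"
    using e by (rule span_cong_ideal)
  have "(free_word [Dot (i + 1), CupCap i] - free_word [Dot i, CupCap i]) - (- free_word [CupCap i]) \<in> relation_ideal n"
    using relation_ideal_uminus[OF dot_cupcap_pair[OF assms]] by (simp add: algebra_simps)
  then show "free_word [Dot (i + 1), CupCap i] - free_word [Dot i, CupCap i] \<in> lin_span n {[CupCap i]}"
    using span_uminus[OF e] by (rule span_cong_ideal)
qed

text \<open>Induction on the number of dots between the generator and \<open>t\<close>: each move
  either takes one of them out of this place or leaves errors with fewer dots there.\<close>

lemma dotted_left:
  assumes i: "1 \<le> i" "i < n" and r: "2 * r \<le> n"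
  shows "dot_word n u \<Longrightarrow> dot_word n v \<Longrightarrow> t \<in> cup_words n r \<Longrightarrow> g = Cross i \<or> g = CupCap i \<Longrightarrow>
    free_word (g # u @ t @ v) \<in> lin_span n (dotted_words n r)"
proof (induction "length u" arbitrary: u v t g rule: less_induct)
  case less
  let ?S = "lin_span n (dotted_words n r)" and ?e = "CupCap i"
  note ok = less.prems(1,2)[THEN dot_word_ok] se_word_ok[OF cup_words_se[OF less.prems(3) r]]
  have g: "se_word n [g]" using less.prems(4) i by auto
  show ?case
  proof (cases u)
    case Nil
    have "[g] @ t @ [] \<in> cup_words n r" by (rule cup_words_extend[OF less.prems(3) g]) simp
    then have "[] @ ([g] @ t) @ v \<in> dotted_words n r" using less.prems by (intro dotted_words_I) auto
    then show ?thesis using Nil by (intro span_free_word) simp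
  next
    case (Cons h u1)
    then obtain j where j: "h = Dot j" "1 \<le> j" "j \<le> n" and u1: "dot_word n u1" using less.prems by auto
    have len: "length u1 < length u" using Cons by simp
    have okr: "word_ok n (u1 @ t @ v)" using ok Cons by auto
    have cupcap_front: "free_word (?e # Dot k # w @ t @ v) \<in> ?S"
      if "1 \<le> k" "k \<le> n" "k \<noteq> i" "k \<noteq> i + 1" "dot_word n w" "length w < length u" for k w
    proof -
      have "free_word ([] @ [Dot k, ?e] @ w @ t @ v) \<in> ?S"
        using dotted_span_dot(1)[OF less.hyps[OF that(6,5) less.prems(2,3), of ?e] that(1,2)]
        by (simp add: free_word_mult)
      then have "free_word ([] @ [?e, Dot k] @ w @ t @ v) \<in> ?S"
        by (rule ideal_replace(2)[OF cupcap_dot[OF i that(1-4)], rotated 2]) (use ok dot_word_ok[OF that(5)] in auto)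
      then show ?thesis by simp
    qed
    \<comment> \<open>A single dot away from \<open>i\<close> and \<open>i + 1\<close> suffices for
      \<open>other\<close>: it is brought to the front and passes \<open>e_i\<close>. For
      \<open>same\<close> a dot \<open>y_(i+1)\<close> is first exchanged for \<open>y_i\<close>,
      and \<open>y_i\<close> is moved next to \<open>t\<close>.\<close>
    consider (cross) "g = Cross i" | (other) k a b where "g = ?e" "u = a @ Dot k # b" "k \<noteq> i" "k \<noteq> i + 1"
      | (same) "g = ?e" "j = i \<or> j = i + 1" using less.prems(4) Cons j by (metis append_Nil)
    then show ?thesis
    proof cases
      case cross
      let ?t = "transpose i (i + 1) j"
      have tj: "1 \<le> ?t" "?t \<le> n" using j i by (auto simp: transpose_def)
      have "free_word ([] @ [Cross i, Dot j] @ u1 @ t @ v) \<in> ?S"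
      proof (rule span_replace(2)[OF cross_dot(1)[OF i j(2,3)] _ okr])
        fix w assume "w \<in> {[?e], []}"
        then show "free_word ([] @ w @ u1 @ t @ v) \<in> ?S"
          using less.hyps[OF len u1 less.prems(2,3), of ?e] dotted_words_I[OF u1 less.prems(2,3)]
          by (auto intro: span_free_word)
      next
        show "free_word ([] @ [Dot ?t, Cross i] @ u1 @ t @ v) \<in> ?S"
          using dotted_span_dot(1)[OF less.hyps[OF len u1 less.prems(2,3), of "Cross i"] tj]
          by (simp add: free_word_mult)
      qed simp
      then show ?thesis using Cons cross j by simp
    next
      case other
      have "free_word ([?e] @ (Dot k # a @ b) @ t @ v) \<in> ?S"
        using cupcap_front[of k "a @ b"] other less.prems(1) by auto
      then show ?thesis
        using ideal_replace(2)[OF dots_commute[OF less.prems(1), of "Dot k # a @ b"], of "[?e]" "t @ v"] other ok i by auto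
    next
      case same
      have "free_word (?e # u1 @ Dot i # t @ v) \<in> ?S"
      proof (rule cupcap_through_dots[OF i r less.prems(3) u1 less.prems(2)])
        show "free_word (?e # u1 @ t @ v) \<in> ?S" if "t \<in> cup_words n r" "dot_word n v" for t v
          using less.hyps[OF len u1 that(2,1), of ?e] by simp
        show "free_word (?e # u1 @ Dot k # t @ v) \<in> ?S" if "1 \<le> k" "k \<le> n" "k \<noteq> i" "k \<noteq> i + 1" for k
          using ideal_replace(2)[OF dots_commute[of n "u1 @ [Dot k]" "Dot k # u1"], of "[?e]" "t @ v"]
            cupcap_front[OF that u1 len] u1 that ok i by auto
      qed
      then have "free_word (?e # Dot i # u1 @ t @ v) \<in> ?S"
        using ideal_replace(2)[OF dots_commute[of n "Dot i # u1" "u1 @ [Dot i]"], of "[?e]" "t @ v"] u1 ok i by auto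
      moreover have "free_word ([] @ [?e, Dot (i + 1)] @ u1 @ t @ v) \<in> ?S" if "free_word (?e # Dot i # u1 @ t @ v) \<in> ?S"
        using less.hyps[OF len u1 less.prems(2,3), of ?e] that
        by (intro span_replace(2)[OF swap_cupcap_dot(1)[OF i] _ okr]) auto
      ultimately show ?thesis using same Cons j by auto
    qed
  qed
qed

text \<open>The mirror image of \<open>dotted_left\<close>, by induction on the number of dots in
  \<open>v\<close>.\<close>

lemma dotted_right:
  assumes i: "1 \<le> i" "i < n" and r: "2 * r \<le> n"
  shows "dot_word n u \<Longrightarrow> dot_word n v \<Longrightarrow> t \<in> cup_words n r \<Longrightarrow> g = Cross i \<or> g = CupCap i \<Longrightarrow>
    free_word (u @ t @ v @ [g]) \<in> lin_span n (dotted_words n r)"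
proof (induction "length v" arbitrary: u v t g rule: less_induct)
  case less
  let ?S = "lin_span n (dotted_words n r)" and ?e = "CupCap i"
  note ok = less.prems(1,2)[THEN dot_word_ok] se_word_ok[OF cup_words_se[OF less.prems(3) r]]
  have g: "se_word n [g]" using less.prems(4) i by auto
  show ?case
  proof (cases v rule: rev_exhaust)
    case Nil
    have "[] @ t @ [g] \<in> cup_words n r" by (rule cup_words_extend[OF less.prems(3) _ g]) simp
    then have "u @ (t @ [g]) @ [] \<in> dotted_words n r" using less.prems by (intro dotted_words_I) auto
    then show ?thesis using Nil by (intro span_free_word) simp
  next
    case (snoc v1 h)
    then obtain j where j: "h = Dot j" "1 \<le> j" "j \<le> n" and v1: "dot_word n v1" using less.prems by auto
    have len: "length v1 < length v" using snoc by simp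
    have okr: "word_ok n (u @ t @ v1)" using ok snoc by auto
    have cupcap_back: "free_word (u @ t @ w @ [Dot k, ?e]) \<in> ?S"
      if "1 \<le> k" "k \<le> n" "k \<noteq> i" "k \<noteq> i + 1" "dot_word n w" "length w < length v" for k w
    proof -
      have "free_word ((u @ t @ w) @ [?e, Dot k] @ []) \<in> ?S"
        using dotted_span_dot(2)[OF less.hyps[OF that(6) less.prems(1) that(5) less.prems(3), of ?e] that(1,2)]
        by (simp add: free_word_mult)
      then have "free_word ((u @ t @ w) @ [Dot k, ?e] @ []) \<in> ?S"
        by (rule ideal_replace(2)[OF relation_ideal_diff_commute[OF cupcap_dot[OF i that(1-4)]], rotated 2])
          (use ok dot_word_ok[OF that(5)] in auto)
      then show ?thesis by simp
    qed
    consider (cross) "g = Cross i" | (other) k a b where "g = ?e" "v = a @ Dot k # b" "k \<noteq> i" "k \<noteq> i + 1"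
      | (same) "g = ?e" "j = i \<or> j = i + 1" using less.prems(4) snoc j by metis
    then show ?thesis
    proof cases
      case cross
      let ?t = "transpose i (i + 1) j"
      have tj: "1 \<le> ?t" "?t \<le> n" using j i by (auto simp: transpose_def)
      have "free_word ((u @ t @ v1) @ [Dot j, Cross i] @ []) \<in> ?S"
      proof (rule span_replace(2)[OF cross_dot(2)[OF i j(2,3)] okr])
        fix w assume "w \<in> {[?e], []}"
        then show "free_word ((u @ t @ v1) @ w @ []) \<in> ?S"
          using less.hyps[OF len less.prems(1) v1 less.prems(3), of ?e] dotted_words_I[OF less.prems(1) v1 less.prems(3)]
          by (auto intro: span_free_word)
      next
        show "free_word ((u @ t @ v1) @ [Cross i, Dot ?t] @ []) \<in> ?S"
          using dotted_span_dot(2)[OF less.hyps[OF len less.prems(1) v1 less.prems(3), of "Cross i"] tj]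
          by (simp add: free_word_mult)
      qed simp
      then show ?thesis using snoc cross j by simp
    next
      case other
      have "free_word ((u @ t) @ ((a @ b) @ [Dot k]) @ [?e]) \<in> ?S"
        using cupcap_back[of k "a @ b"] other less.prems(2) by auto
      then show ?thesis
        using ideal_replace(2)[OF dots_commute[OF less.prems(2), of "(a @ b) @ [Dot k]"], of "u @ t" "[?e]"] other ok i by auto
    next
      case same
      have "free_word (u @ t @ Dot i # v1 @ [?e]) \<in> ?S"
      proof (rule dots_through_cupcap[OF i r less.prems(3) less.prems(1) v1])
        show "free_word (u @ t @ v1 @ [?e]) \<in> ?S" if "t \<in> cup_words n r" "dot_word n u" for t u
          using less.hyps[OF len that(2) v1 that(1), of ?e] by simp
        show "free_word (u @ t @ Dot k # v1 @ [?e]) \<in> ?S" if "1 \<le> k" "k \<le> n" "k \<noteq> i" "k \<noteq> i + 1" for k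
          using ideal_replace(2)[OF dots_commute[of n "Dot k # v1" "v1 @ [Dot k]"], of "u @ t" "[?e]"]
            cupcap_back[OF that v1 len] v1 that ok i by auto
      qed
      then have "free_word (u @ t @ v1 @ [Dot i, ?e]) \<in> ?S"
        using ideal_replace(2)[OF dots_commute[of n "v1 @ [Dot i]" "Dot i # v1"], of "u @ t" "[?e]"] v1 ok i by auto
      moreover have "free_word ((u @ t @ v1) @ [Dot (i + 1), ?e] @ []) \<in> ?S" if "free_word (u @ t @ v1 @ [Dot i, ?e]) \<in> ?S"
        using less.hyps[OF len less.prems(1) v1 less.prems(3), of ?e] that
        by (intro span_replace(2)[OF swap_cupcap_dot(2)[OF i] okr]) auto
      ultimately show ?thesis using same snoc j by auto
    qed
  qed
qed

section \<open>Reduction to normal diagrams\<close>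

definition normal_words :: "nat \<Rightarrow> (point set set \<Rightarrow> gen list) \<Rightarrow> nat \<Rightarrow> gen list set" where
  "normal_words n m k = {dots n a @ m d @ dots n b | a d b.
     brauer_diagram n d \<and> card (through_strands d) \<le> k \<and>
     (\<forall>j\<in>{1..n}. \<not> top_dot_allowed d j \<longrightarrow> a j = 0) \<and>
     (\<forall>j\<in>{1..n}. \<not> bot_dot_allowed d j \<longrightarrow> b j = 0)}"

lemma normal_diagrams_image: "normal_diagrams n m k = VV_word n ` normal_words n m k"
  unfolding normal_diagrams_def normal_words_def by blast

lemma dot_word_dots: "dot_word n (dots n a)"
  by (auto simp: dot_word_def dots_def)

lemma mset_dots:
  assumes "dot_word n u"
  shows "mset u = mset (dots n (\<lambda>j. count (mset u) (Dot j)))"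
proof (rule multiset_eqI)
  fix g
  have cnt: "count (mset (concat (map (\<lambda>j. replicate (a j) (Dot j)) js))) (Dot k) = (if k \<in> set js then a k else 0)"
    if "distinct js" for js k and a :: "nat \<Rightarrow> nat"
    using that by (induction js) auto
  show "count (mset u) g = count (mset (dots n (\<lambda>j. count (mset u) (Dot j)))) g"
  proof (cases "\<exists>j. 1 \<le> j \<and> j \<le> n \<and> g = Dot j")
    case True
    then obtain j where "1 \<le> j" "j \<le> n" "g = Dot j" by blast
    then show ?thesis using cnt[of "[1..<n+1]" "\<lambda>j. count (mset u) (Dot j)" j] by (simp add: dots_def)
  next
    case False
    then have "g \<notin> set u" "g \<notin> set (dots n (\<lambda>j. count (mset u) (Dot j)))"
      using assms dot_word_dots[of n] unfolding dot_word_def by blast+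
    then show ?thesis by (metis count_eq_zero_iff set_mset_mset)
  qed
qed

text \<open>Independence of the chosen monomial up to sign: \<open>m\<close> of a diagram has some
  normal form with this diagram, and by \<open>normal_word_unique\<close> any other one agrees with
  it.\<close>

lemma monomial_normal_word:
  assumes m: "monomial_choice n m" and p: "\<sigma> permutes {1..n}" "\<tau> permutes {1..n}" "2 * r \<le> n"
  shows "word_eqv n (m (word_dg n \<sigma> r \<tau>)) (normal_word n \<sigma> r \<tau>)" "word_ok n (m (word_dg n \<sigma> r \<tau>))"
proof -
  let ?d = "word_dg n \<sigma> r \<tau>"
  have "word_diagram n (m ?d) ?d"
    using m brauer_diagram_of[OF pairing_word[OF p]] by (simp add: monomial_choice_def)
  from VV_words.word_diagram_normal[OF this] obtain \<sigma>' r' \<tau>' where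
    h: "\<sigma>' permutes {1..n}" "\<tau>' permutes {1..n}" "2 * r' \<le> n" "?d = word_dg n \<sigma>' r' \<tau>'"
      "word_eqv n (m ?d) (normal_word n \<sigma>' r' \<tau>')" by blast
  from VV_words.normal_word_unique[OF h(1-3) p h(4)[symmetric]]
  show "word_eqv n (m ?d) (normal_word n \<sigma> r \<tau>)" using h(5) VV_words.trans by blast
  then show "word_ok n (m ?d)"
    using se_word_ok[OF cup_words_se[OF normal_word_cup[OF p(1,2)] p(3)]] by (auto simp: word_eqv_def)
qed

definition bad_top :: "point set set \<Rightarrow> gen \<Rightarrow> bool" where
  "bad_top d g \<longleftrightarrow> (\<exists>j. g = Dot j \<and> \<not> top_dot_allowed d j)"

definition bad_bot :: "point set set \<Rightarrow> gen \<Rightarrow> bool" where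
  "bad_bot d g \<longleftrightarrow> (\<exists>j. g = Dot j \<and> \<not> bot_dot_allowed d j)"

text \<open>Inner induction on the number of misplaced dots, the total number \<open>N\<close> being
  fixed. A misplaced top dot sits at the left end of a cup and slides to the right end. A misplaced
  bottom dot sits at the right end of a cap or on a through strand and slides to the left end or to
  the top. Each new place is allowed, and the errors have fewer dots, as treated by
  \<open>IH\<close>.\<close>

lemma dotted_reduce_step:
  assumes m: "monomial_choice n m" and p: "\<sigma> permutes {1..n}" "\<tau> permutes {1..n}" "2 * r' \<le> n" and r: "r \<le> r'"
    and IH: "\<And>u v t. length u + length v < N \<Longrightarrow> dot_word n u \<Longrightarrow> dot_word n v \<Longrightarrow> t \<in> cup_words n r \<Longrightarrow>
       free_word (u @ t @ v) \<in> lin_span n (normal_words n m (n - 2 * r))"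
  defines "d \<equiv> word_dg n \<sigma> r' \<tau>"
  shows "length u + length v = N \<Longrightarrow> dot_word n u \<Longrightarrow> dot_word n v \<Longrightarrow>
    free_word (u @ m d @ v) \<in> lin_span n (normal_words n m (n - 2 * r))"
proof (induction "length (filter (bad_top d) u) + length (filter (bad_bot d) v)" arbitrary: u v rule: less_induct)
  case less
  let ?S = "lin_span n (normal_words n m (n - 2 * r))"
  let ?f = "word_pairing \<sigma> r' \<tau>"
  note pf = pairing_word[OF p]
  note md = monomial_normal_word[OF m p, folded d_def]
  note ok = less.prems(2,3)[THEN dot_word_ok]
  have sl: "free_word (dot_at Q (m d)) - free_word (dot_at (?f Q) (m d)) \<in> lin_span n (cup_words n r)"
    if "Q \<in> points n" for Q
    using slide_dot[OF p md that] cup_words_mono[OF r p(3)] by (auto intro: span_subset span_free_word)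
  have ind: "{P, Q} \<in> d \<longleftrightarrow> P \<in> points n \<and> Q = ?f P" for P Q unfolding d_def by (rule in_diagram_of[OF pf])
  consider (top) g where "g \<in> set u" "bad_top d g" | (bot) g where "g \<in> set v" "bad_bot d g"
    | (none) "\<forall>g\<in>set u. \<not> bad_top d g" "\<forall>g\<in>set v. \<not> bad_bot d g" by blast
  then show ?case
  proof cases
    case top
    then obtain j where j: "g = Dot j" "1 \<le> j" "j \<le> n" using less.prems(2) unfolding dot_word_def by blast
    obtain a b where ab: "u = a @ Dot j # b" using top(1) j by (auto simp: in_set_conv_decomp)
    have dw: "dot_word n (a @ b)" using less.prems(2) ab by auto
    have na: "\<not> top_dot_allowed d j" using top(2) j by (auto simp: bad_top_def)
    have Pj: "Top j \<in> points n" using j by simp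
    obtain l where l: "?f (Top j) = Top l" "j < l" "l \<le> n"
    proof (cases "?f (Top j)")
      case (Top l)
      have "\<not> l < j" "l \<noteq> j" "l \<le> n"
        using na ind[of "Top j" "Top l"] Top Pj pairingD(1,3)[OF pf Pj] by (auto simp: top_dot_allowed_def insert_commute)
      then show ?thesis using that Top by auto
    next
      case (Bot l)
      then have "{Top j, Bot l} \<in> d" using ind Pj by simp
      then show ?thesis using na by (auto simp: top_dot_allowed_def insert_commute)
    qed
    have "{Top j, Top l} \<in> d" using ind l Pj by simp
    then have al: "top_dot_allowed d l" using l by (auto simp: top_dot_allowed_def)
    have "free_word (((a @ b) @ [Dot l]) @ m d @ v) \<in> ?S"
    proof (rule less.hyps)
      show "length (filter (bad_top d) ((a @ b) @ [Dot l])) + length (filter (bad_bot d) v)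
        < length (filter (bad_top d) u) + length (filter (bad_bot d) v)"
        using al top(2) j ab by (auto simp: bad_top_def)
    qed (use less.prems ab l dw in auto)
    then have "free_word ((a @ b) @ dot_at (?f (Top j)) (m d) @ v) \<in> ?S" using l by simp
    then have "free_word ((a @ b) @ dot_at (Top j) (m d) @ v) \<in> ?S"
      by (rule span_replace(2)[OF sl[OF Pj] dot_word_ok[OF dw] ok(2), rotated 1])
        (use IH[of "a @ b" v] less.prems ab dw in auto)
    then have "free_word ([] @ ((a @ b) @ [Dot j]) @ (m d @ v)) \<in> ?S" by simp
    then have "free_word ([] @ u @ (m d @ v)) \<in> ?S"
      by (rule ideal_replace(2)[OF dots_commute[OF less.prems(2)], rotated 3]) (use ab ok md in auto)
    then show ?thesis by simp
  next
    case bot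
    then obtain j where j: "g = Dot j" "1 \<le> j" "j \<le> n" using less.prems(3) unfolding dot_word_def by blast
    obtain a b where ab: "v = a @ Dot j # b" using bot(1) j by (auto simp: in_set_conv_decomp)
    have dw: "dot_word n (a @ b)" using less.prems(3) ab by auto
    have na: "\<not> bot_dot_allowed d j" using bot(2) j by (auto simp: bad_bot_def)
    have Pj: "Bot j \<in> points n" using j by simp
    have "free_word (u @ dot_at (?f (Bot j)) (m d) @ a @ b) \<in> ?S"
    proof (cases "?f (Bot j)")
      case (Bot l)
      have l: "\<not> j < l" "l \<noteq> j" "1 \<le> l" "l \<le> n"
        using na ind[of "Bot j" "Bot l"] Bot Pj pairingD(1,3)[OF pf Pj] by (auto simp: bot_dot_allowed_def)
      have "{Bot l, Bot j} \<in> d" using ind[of "Bot j" "Bot l"] Bot Pj by (simp add: insert_commute)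
      moreover have "l < j" using l(1,2) by simp
      ultimately have al: "bot_dot_allowed d l" unfolding bot_dot_allowed_def by blast
      have "free_word (u @ m d @ Dot l # a @ b) \<in> ?S"
      proof (rule less.hyps)
        show "length (filter (bad_top d) u) + length (filter (bad_bot d) (Dot l # a @ b))
          < length (filter (bad_top d) u) + length (filter (bad_bot d) v)"
          using al bot(2) j ab by (auto simp: bad_bot_def)
      qed (use less.prems ab l dw in auto)
      then show ?thesis using Bot by simp
    next
      case (Top l)
      have l: "1 \<le> l" "l \<le> n" using pairingD(1)[OF pf Pj] Top by auto
      have "{Bot j, Top l} \<in> d" using ind Top Pj by simp
      then have al: "top_dot_allowed d l" by (auto simp: top_dot_allowed_def)
      have "free_word ((u @ [Dot l]) @ m d @ a @ b) \<in> ?S"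
      proof (rule less.hyps)
        show "length (filter (bad_top d) (u @ [Dot l])) + length (filter (bad_bot d) (a @ b))
          < length (filter (bad_top d) u) + length (filter (bad_bot d) v)"
          using al bot(2) j ab by (auto simp: bad_top_def)
      qed (use less.prems ab l dw in auto)
      then show ?thesis using Top by simp
    qed
    then have "free_word (u @ dot_at (Bot j) (m d) @ a @ b) \<in> ?S"
      by (rule span_replace(2)[OF sl[OF Pj] ok(1) dot_word_ok[OF dw], rotated 1])
        (use IH[of u "a @ b"] less.prems ab dw in auto)
    then have "free_word ((u @ m d) @ (Dot j # a @ b) @ []) \<in> ?S" by simp
    then have "free_word ((u @ m d) @ v @ []) \<in> ?S"
      by (rule ideal_replace(2)[OF dots_commute[OF less.prems(3)], rotated 3]) (use ab ok md in auto)
    then show ?thesis by simp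
  next
    case none
    \<comment> \<open>No dot is misplaced any more; it remains to sort the commuting dots, whose
      multiplicities are the exponents.\<close>
    define a where "a j = count (mset u) (Dot j)" for j
    define b where "b j = count (mset v) (Dot j)" for j
    have "a j = 0" if "\<not> top_dot_allowed d j" for j
      using none(1) that unfolding a_def bad_top_def by (metis count_eq_zero_iff set_mset_mset)
    moreover have "b j = 0" if "\<not> bot_dot_allowed d j" for j
      using none(2) that unfolding b_def bad_bot_def by (metis count_eq_zero_iff set_mset_mset)
    moreover have "brauer_diagram n d" "card (through_strands d) \<le> n - 2 * r"
      unfolding d_def using brauer_diagram_of[OF pf] through_strands_word[OF p] r by simp_all
    ultimately have "dots n a @ m d @ dots n b \<in> normal_words n m (n - 2 * r)"
      unfolding normal_words_def by blast
    then have "free_word ((dots n a @ m d) @ dots n b @ []) \<in> ?S" by (intro span_free_word) simp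
    then have "free_word ((dots n a @ m d) @ v @ []) \<in> ?S"
      by (rule ideal_replace(2)[OF dots_commute[OF less.prems(3) mset_dots[OF less.prems(3), folded b_def]], rotated 2])
        (use md dot_word_ok[OF dot_word_dots] in auto)
    then have "free_word ([] @ dots n a @ (m d @ v)) \<in> ?S" by simp
    then have "free_word ([] @ u @ (m d @ v)) \<in> ?S"
      by (rule ideal_replace(2)[OF dots_commute[OF less.prems(2) mset_dots[OF less.prems(2), folded a_def]], rotated 2])
        (use md ok in auto)
    then show ?thesis by simp
  qed
qed

text \<open>Outer induction on the total number of dots; the word without dots is exchanged for the
  chosen monomial of its diagram.\<close>

lemma dotted_reduce:
  assumes m: "monomial_choice n m" and r: "2 * r \<le> n"
  shows "dot_word n u \<Longrightarrow> dot_word n v \<Longrightarrow> t \<in> cup_words n r \<Longrightarrow>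
    free_word (u @ t @ v) \<in> lin_span n (normal_words n m (n - 2 * r))"
proof (induction "length u + length v" arbitrary: u v t rule: less_induct)
  case less
  let ?S = "lin_span n (normal_words n m (n - 2 * r))"
  note ok = less.prems(1,2)[THEN dot_word_ok] se_word_ok[OF cup_words_se[OF less.prems(3) r]]
  from less.prems(3) r show ?case
  proof (cases rule: cup_words_cases)
    case 1
    from VV_words.Z_cong[OF this, of u v] show ?thesis using ok by (intro span_word_zero) auto
  next
    case (2 \<sigma> r' \<tau>)
    let ?d = "word_dg n \<sigma> r' \<tau>"
    have fw: "free_word (u @ m ?d @ v) \<in> ?S"
      using less.hyps less.prems(1,2) by (intro dotted_reduce_step[OF m 2(1-4), where N = "length u + length v"]) auto
    have e: "word_eqv n (u @ t @ v) (u @ m ?d @ v)"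
      using VV_words.trans[OF 2(5) VV_words.sym[OF monomial_normal_word(1)[OF m 2(1-3)]]] by (rule VV_words.cong)
    show ?thesis by (rule span_eqv[OF e _ fw]) (use ok in auto)
  qed
qed

lemma word_diagram_ok: "word_diagram n w d \<Longrightarrow> word_ok n w"
  by (induction rule: word_diagram.induct) auto

lemma normal_word_ok: "monomial_choice n m \<Longrightarrow> w \<in> normal_words n m k \<Longrightarrow> word_ok n w"
proof -
  assume m: "monomial_choice n m" and "w \<in> normal_words n m k"
  then obtain a d b where w: "w = dots n a @ m d @ dots n b" "brauer_diagram n d" by (auto simp: normal_words_def)
  have "word_diagram n (m d) d" using m w by (simp add: monomial_choice_def)
  then have "word_ok n (m d)" by (rule word_diagram_ok)
  then show ?thesis using w dot_word_ok[OF dot_word_dots] by auto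
qed

text \<open>At most \<open>n - 2 * r\<close> through strands means at least \<open>r\<close> arcs,
  so \<open>cup_word r\<close> occurs as a factor. This is the source of the inclusion of the normal
  diagrams in the ideal.\<close>

lemma normal_word_factor:
  assumes m: "monomial_choice n m" and r: "2 * r \<le> n" and w: "w \<in> normal_words n m (n - 2 * r)"
  shows "\<exists>u v. word_ok n u \<and> word_ok n v \<and> word_eqv n w (u @ cup_word r @ v)"
proof -
  obtain a d b where w: "w = dots n a @ m d @ dots n b" "brauer_diagram n d" "card (through_strands d) \<le> n - 2 * r"
    using w by (auto simp: normal_words_def)
  have "word_diagram n (m d) d" using m w by (simp add: monomial_choice_def)
  from VV_words.word_diagram_normal[OF this] obtain \<sigma> r' \<tau> where
    h: "\<sigma> permutes {1..n}" "\<tau> permutes {1..n}" "2 * r' \<le> n" "d = word_dg n \<sigma> r' \<tau>"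
      "word_eqv n (m d) (normal_word n \<sigma> r' \<tau>)" by blast
  have "r \<le> r'" using through_strands_word[OF h(1-3)] w(3) h(3,4) r by simp
  then have "normal_word n \<sigma> r' \<tau> \<in> cup_words n r"
    using normal_word_cup[OF h(1,2)] cup_words_mono h(3) by blast
  then obtain x y where xy: "normal_word n \<sigma> r' \<tau> = x @ cup_word r @ y" "se_word n x" "se_word n y"
    by (auto simp: cup_words_def)
  have "word_eqv n w ((dots n a @ x) @ cup_word r @ (y @ dots n b))"
    using VV_words.cong[OF h(5), of "dots n a" "dots n b"] w xy by simp
  moreover have "word_ok n (dots n a @ x)" "word_ok n (y @ dots n b)"
    using dot_word_ok[OF dot_word_dots] se_word_ok[OF xy(2)] se_word_ok[OF xy(3)] by auto
  ultimately show ?thesis by blast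
qed

section \<open>From generators to the whole free algebra\<close>

lemma carrier_span: "f \<in> carrier (free_algebra n) \<Longrightarrow> f \<in> lin_span n {w. word_ok n w}"
proof (induction f rule: update_induct)
  case const
  show ?case by (rule span_zero)
next
  case (update f a b)
  have eq: "Poly_Mapping.update a b f = f + Poly_Mapping.single a b"
    using update(1) by (intro poly_mapping_eqI) (auto simp: lookup_update lookup_add lookup_single in_keys_iff)
  have k: "Poly_Mapping.keys (Poly_Mapping.update a b f) = insert a (Poly_Mapping.keys f)"
    using update(2) by (simp add: keys_update)
  have "f \<in> carrier (free_algebra n)" "word_ok n (letters a)"
    using update.prems unfolding carrier_free_algebra k by auto
  then have "f \<in> lin_span n {w. word_ok n w}" and "letters a \<in> {w. word_ok n w}"
    using update.IH by auto
  from this(1) lin_span.word[OF this(2), of b n] show ?case unfolding eq by (intro lin_span.add) simp_all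
qed

text \<open>Closure under single generators extends to words letter by letter and then to sums;
  scalars are central, so they may be pulled out on either side.\<close>

lemma span_ideal_closed:
  assumes W: "\<And>w. w \<in> W \<Longrightarrow> word_ok n w"
    and gen: "\<And>g w. gen_ok n g \<Longrightarrow> w \<in> W \<Longrightarrow> free_word (g # w) \<in> lin_span n W"
      "\<And>g w. gen_ok n g \<Longrightarrow> w \<in> W \<Longrightarrow> free_word (w @ [g]) \<in> lin_span n W"
    and f: "f \<in> lin_span n W" and h: "h \<in> carrier (free_algebra n)"
  shows "h * f \<in> lin_span n W" "f * h \<in> lin_span n W"
proof -
  have fc: "f \<in> carrier (free_algebra n)" by (rule span_closed[OF f W])
  have wl: "free_word w * f \<in> lin_span n W" if "word_ok n w" for w
    using that
  proof (induction w)
    case (Cons g w)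
    then have "free_word [g] * (free_word w * f) \<in> lin_span n W"
      using gen(1) by (intro span_left[of "free_word w * f" n W "[g]" W]) auto
    then show ?case by (simp add: free_word_mult flip: mult.assoc)
  qed (simp add: free_word_Nil f)
  have wr: "f * free_word w \<in> lin_span n W" if "word_ok n w" for w
    using that
  proof (induction w rule: rev_induct)
    case (snoc g w)
    then have "(f * free_word w) * free_word [g] \<in> lin_span n W"
      using gen(2) by (intro span_right[of "f * free_word w" n W "[g]" W]) auto
    then show ?case by (simp add: free_word_mult mult.assoc)
  qed (simp add: free_word_Nil f)
  have comm: "f * Poly_Mapping.single 0 c = Poly_Mapping.single 0 c * f" for c
  proof (induction f rule: update_induct)
    case (update f a b)
    have "Poly_Mapping.update a b f = f + Poly_Mapping.single a b"
      using update(1) by (intro poly_mapping_eqI) (auto simp: lookup_update lookup_add lookup_single in_keys_iff)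
    then show ?case using update(3) by (simp add: distrib_left distrib_right mult_single mult.commute)
  qed simp
  from carrier_span[OF h] show "h * f \<in> lin_span n W" "f * h \<in> lin_span n W"
  proof (induction h)
    case (ideal h)
    { case 1 show ?case using ideal fc by (intro lin_span.ideal relation_ideal_closed(5)) }
    { case 2 show ?case using ideal fc by (intro lin_span.ideal relation_ideal_closed(4)) }
  next
    case (word w c)
    { case 1 show ?case unfolding single_word mult.assoc using word by (intro span_scale wl) simp }
    { case 2
      have "f * Poly_Mapping.single (Word w) c = Poly_Mapping.single 0 c * (f * free_word w)"
        unfolding single_word by (metis comm mult.assoc)
      then show ?case using word wr by (auto intro: span_scale) }
  qed (auto simp: distrib_left distrib_right intro: lin_span.add)
qed

lemma dotted_span_ideal:
  assumes r: "2 * r \<le> n" and f: "f \<in> lin_span n (dotted_words n r)" and h: "h \<in> carrier (free_algebra n)"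
  shows "h * f \<in> lin_span n (dotted_words n r)" "f * h \<in> lin_span n (dotted_words n r)"
proof -
  have W: "word_ok n w" if "w \<in> dotted_words n r" for w
    using that dot_word_ok se_word_ok[OF cup_words_se[OF _ r]] by (fastforce simp: dotted_words_def)
  have L: "free_word (g # w) \<in> lin_span n (dotted_words n r)" if gw: "gen_ok n g" "w \<in> dotted_words n r" for g w
  proof -
    obtain u t v where w: "w = u @ t @ v" "dot_word n u" "dot_word n v" "t \<in> cup_words n r"
      using gw(2) by (auto simp: dotted_words_def)
    show ?thesis
    proof (cases g)
      case (Dot j)
      then show ?thesis using dotted_span_dot(1)[OF span_free_word[OF gw(2)], of j] gw by (simp add: free_word_mult)
    qed (use dotted_left[OF _ _ r w(2-4)] gw w in auto)
  qed
  have R: "free_word (w @ [g]) \<in> lin_span n (dotted_words n r)" if gw: "gen_ok n g" "w \<in> dotted_words n r" for g w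
  proof -
    obtain u t v where w: "w = u @ t @ v" "dot_word n u" "dot_word n v" "t \<in> cup_words n r"
      using gw(2) by (auto simp: dotted_words_def)
    show ?thesis
    proof (cases g)
      case (Dot j)
      then show ?thesis using dotted_span_dot(2)[OF span_free_word[OF gw(2)], of j] gw by (simp add: free_word_mult)
    qed (use dotted_right[OF _ _ r w(2-4)] gw w in auto)
  qed
  show "h * f \<in> lin_span n (dotted_words n r)" "f * h \<in> lin_span n (dotted_words n r)"
    using span_ideal_closed[OF W L R f h] by auto
qed

section \<open>The ideals\<close>

context brauer_words begin

text \<open>The gaps keep the pairs \<open>js ! k\<close>, \<open>js ! k + 1\<close> disjoint, so
  some permutation carries the standard pairs to them; conjugation by it exchanges the two products.
  Having both directions gives both inclusions of the ideals.\<close>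

lemma spaced_cups:
  assumes js: "length js = r" "set js \<subseteq> {1..n - 1}"
    "\<forall>j<r. \<forall>k<r. j \<noteq> k \<longrightarrow> \<bar>int (js ! j) - int (js ! k)\<bar> > 1" and r: "2 * r \<le> n"
  shows "\<exists>\<sigma>. perm \<sigma> \<and> map CupCap js \<approx> P \<sigma> @ cup_word r @ P (pinv \<sigma>) \<and>
    cup_word r \<approx> P (pinv \<sigma>) @ map CupCap js @ P \<sigma>"
proof -
  have rng: "1 \<le> js ! k" "js ! k + 1 \<le> n" "js ! k \<le> n" if "k < r" for k
    using js(1,2) nth_mem[of k js] that by fastforce+
  \<comment> \<open>The pair \<open>2 * k + 1\<close>, \<open>2 * k + 2\<close> is to go to
    \<open>js ! k\<close>, \<open>js ! k + 1\<close>.\<close>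
  define f where "f x = (if odd x then js ! (x div 2) else js ! (x div 2 - 1) + 1)" for x
  have f: "f (2 * k + 1) = js ! k" "f (2 * k + 2) = js ! k + 1" for k by (auto simp: f_def)
  have "\<exists>\<sigma>. perm \<sigma> \<and> (\<forall>x\<in>{1..2 * r}. \<sigma> x = f x)"
  proof (rule permutes_extend)
    show "f ` {1..2 * r} \<subseteq> {1..n}"
    proof
      fix y assume "y \<in> f ` {1..2 * r}"
      then obtain x where x: "1 \<le> x" "x \<le> 2 * r" "y = f x" by auto
      show "y \<in> {1..n}"
        using x(1,2) by (cases rule: mate_cases) (use x(3) f rng in auto)
    qed
    show "inj_on f {1..2 * r}"
    proof (rule inj_onI)
      fix x y assume "x \<in> {1..2 * r}" "y \<in> {1..2 * r}" and eq: "f x = f y"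
      then have x: "1 \<le> x" "x \<le> 2 * r" and y: "1 \<le> y" "y \<le> 2 * r" by auto
      obtain k where k: "k < r" "x = 2 * k + 1 \<or> x = 2 * k + 2" using mate_pair[OF x] by blast
      obtain l where l: "l < r" "y = 2 * l + 1 \<or> y = 2 * l + 2" using mate_pair[OF y] by blast
      have "\<bar>int (js ! k) - int (js ! l)\<bar> \<le> 1" using eq k l f[of k] f[of l] by auto
      then have "k = l" using js(3) k(1) l(1) by force
      then show "x = y" using eq k l f[of k] by auto
    qed
  qed (use r in auto)
  then obtain \<sigma> where \<sigma>: "perm \<sigma>" "\<forall>x\<in>{1..2 * r}. \<sigma> x = f x" by blast
  have "m \<le> r \<Longrightarrow> map CupCap (take m js) @ P \<sigma> \<approx> P \<sigma> @ cup_word m" for m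
  proof (induction m)
    case (Suc m)
    then have m: "m < r" by simp
    have im: "{\<sigma> (2 * m + 1), \<sigma> (2 * m + 2)} = {js ! m, js ! m + 1}" using \<sigma>(2) f[of m] m by auto
    have nat: "CupCap (js ! m) # P \<sigma> \<approx> P \<sigma> @ [CupCap (2 * m + 1)]"
      by (rule naturality[OF \<sigma>(1) im]) (use rng[OF m] m r in simp_all)
    have "map CupCap (take (Suc m) js) @ P \<sigma> = map CupCap (take m js) @ CupCap (js ! m) # P \<sigma>"
      using m js(1) by (simp add: take_Suc_conv_app_nth)
    also have "\<dots> \<approx> map CupCap (take m js) @ P \<sigma> @ [CupCap (2 * m + 1)]" by (rule cong_left[OF nat])
    also have "\<dots> \<approx> P \<sigma> @ cup_word (Suc m)" using cong_right[OF Suc.IH, of "[CupCap (2 * m + 1)]"] m by simp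
    finally show ?case .
  qed simp
  from this[of r] have c: "map CupCap js @ P \<sigma> \<approx> P \<sigma> @ cup_word r" using js(1) by simp
  have "map CupCap js \<approx> map CupCap js @ P \<sigma> @ P (pinv \<sigma>)"
    using cong_left[OF sym[OF P_inv(1)[OF \<sigma>(1)]], of "map CupCap js"] by simp
  also have "\<dots> \<approx> P \<sigma> @ cup_word r @ P (pinv \<sigma>)" using cong_right[OF c, of "P (pinv \<sigma>)"] by simp
  finally have 1: "map CupCap js \<approx> P \<sigma> @ cup_word r @ P (pinv \<sigma>)" .
  have "cup_word r \<approx> P (pinv \<sigma>) @ P \<sigma> @ cup_word r"
    using cong_right[OF sym[OF P_inv(2)[OF \<sigma>(1)]], of "cup_word r"] by simp
  also have "\<dots> \<approx> P (pinv \<sigma>) @ map CupCap js @ P \<sigma>" by (rule cong_left[OF sym[OF c]])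
  finally show ?thesis using 1 \<sigma>(1) by blast
qed

end

section \<open>Passage to the quotient\<close>

lemma carrier_VV: "carrier (VV n) = VV_class n ` carrier (free_algebra n)"
  by (auto simp: VV_def FactRing_def VV_class_def A_RCOSETS_def')

lemma VV_class_add:
  "f \<in> carrier (free_algebra n) \<Longrightarrow> g \<in> carrier (free_algebra n) \<Longrightarrow>
    VV_class n (f + g) = VV_class n f \<oplus>\<^bsub>VV n\<^esub> VV_class n g"
  using ring_hom_add[OF VV_class_hom] by force

lemma VV_class_mult:
  "f \<in> carrier (free_algebra n) \<Longrightarrow> g \<in> carrier (free_algebra n) \<Longrightarrow>
    VV_class n (f * g) = VV_class n f \<otimes>\<^bsub>VV n\<^esub> VV_class n g"
  using ring_hom_mult[OF VV_class_hom] by force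

lemma VV_class_closed: "f \<in> carrier (free_algebra n) \<Longrightarrow> VV_class n f \<in> carrier (VV n)"
  by (simp add: carrier_VV)

lemma zero_VV: "\<zero>\<^bsub>VV n\<^esub> = relation_ideal n"
  by (simp add: VV_def FactRing_def)

lemma VV_class_eq_zero:
  "f \<in> carrier (free_algebra n) \<Longrightarrow> VV_class n f = \<zero>\<^bsub>VV n\<^esub> \<longleftrightarrow> f \<in> relation_ideal n"
  unfolding zero_VV VV_class_def
  using ring.a_rcos_zero[OF ring_free_algebra ideal_relation_ideal] ideal.rcos_const_imp_mem[OF ideal_relation_ideal]
  by blast

lemma VV_class_eqD:
  assumes "f \<in> carrier (free_algebra n)" "g \<in> carrier (free_algebra n)" "VV_class n f = VV_class n g"
  shows "f - g \<in> relation_ideal n"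
proof -
  interpret ring "VV n" by (rule ring_VV)
  have d: "f - g \<in> carrier (free_algebra n)" using assms by (intro free_diff_closed)
  have "VV_class n ((f - g) + g) = VV_class n (f - g) \<oplus>\<^bsub>VV n\<^esub> VV_class n g"
    by (rule VV_class_add[OF d assms(2)])
  then have "VV_class n (f - g) \<oplus>\<^bsub>VV n\<^esub> VV_class n g = \<zero>\<^bsub>VV n\<^esub> \<oplus>\<^bsub>VV n\<^esub> VV_class n g"
    using assms(3) VV_class_closed[OF assms(2)] by simp
  then have "VV_class n (f - g) = \<zero>\<^bsub>VV n\<^esub>"
    using add.right_cancel[of "VV_class n g" "VV_class n (f - g)" "\<zero>\<^bsub>VV n\<^esub>"] VV_class_closed assms(2) d by auto
  then show ?thesis using VV_class_eq_zero[OF d] by simp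
qed

lemma VV_class_ideal:
  assumes S: "S \<subseteq> carrier (free_algebra n)" "0 \<in> S" "\<And>f g. f \<in> S \<Longrightarrow> g \<in> S \<Longrightarrow> f + g \<in> S"
    and mult: "\<And>f h. f \<in> S \<Longrightarrow> h \<in> carrier (free_algebra n) \<Longrightarrow> h * f \<in> S"
      "\<And>f h. f \<in> S \<Longrightarrow> h \<in> carrier (free_algebra n) \<Longrightarrow> f * h \<in> S"
  shows "ideal (VV_class n ` S) (VV n)"
proof (rule idealI[OF ring_VV])
  interpret ring "VV n" by (rule ring_VV)
  have zero: "VV_class n 0 = \<zero>\<^bsub>VV n\<^esub>"
    using VV_class_eq_zero[OF free_zero_closed] relation_ideal_closed(1) by blast
  have neg: "- f \<in> S \<and> \<ominus>\<^bsub>VV n\<^esub> VV_class n f = VV_class n (- f)" if f: "f \<in> S" for f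
  proof
    show m: "- f \<in> S" using mult(1)[OF f, of "- 1"] free_minus_closed[OF free_one_closed] by simp
    show "\<ominus>\<^bsub>VV n\<^esub> VV_class n f = VV_class n (- f)"
      using VV_class_add[of "- f" n f] m f S(1) zero VV_class_closed by (intro minus_equality) auto
  qed
  show "subgroup (VV_class n ` S) (add_monoid (VV n))"
  proof
    show "VV_class n ` S \<subseteq> carrier (add_monoid (VV n))" using S(1) VV_class_closed by auto
    show "x \<otimes>\<^bsub>add_monoid (VV n)\<^esub> y \<in> VV_class n ` S" if xy: "x \<in> VV_class n ` S" "y \<in> VV_class n ` S" for x y
    proof -
      obtain f g where fg: "f \<in> S" "x = VV_class n f" "g \<in> S" "y = VV_class n g" using xy by blast
      then have "x \<otimes>\<^bsub>add_monoid (VV n)\<^esub> y = VV_class n (f + g)"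
        using VV_class_add[of f n g] S(1) by (simp add: subsetD)
      then show ?thesis using imageI[OF S(3)[OF fg(1,3)], of "VV_class n"] by simp
    qed
    show "\<one>\<^bsub>add_monoid (VV n)\<^esub> \<in> VV_class n ` S" using zero imageI[OF S(2), of "VV_class n"] by simp
    show "inv\<^bsub>add_monoid (VV n)\<^esub> x \<in> VV_class n ` S" if x: "x \<in> VV_class n ` S" for x
    proof -
      obtain f where f: "f \<in> S" "x = VV_class n f" using x by blast
      show ?thesis using neg[OF f(1)] imageI[of "- f" S "VV_class n"] f(2) unfolding a_inv_def by simp
    qed
  qed
  fix a x assume "a \<in> VV_class n ` S" "x \<in> carrier (VV n)"
  then obtain f h where fh: "f \<in> S" "a = VV_class n f" "h \<in> carrier (free_algebra n)" "x = VV_class n h"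
    by (auto simp: carrier_VV)
  have fc: "f \<in> carrier (free_algebra n)" using fh(1) S(1) by blast
  show "x \<otimes>\<^bsub>VV n\<^esub> a \<in> VV_class n ` S"
    using VV_class_mult[OF fh(3) fc] imageI[OF mult(1)[OF fh(1,3)], of "VV_class n"] fh(2,4) by simp
  show "a \<otimes>\<^bsub>VV n\<^esub> x \<in> VV_class n ` S"
    using VV_class_mult[OF fc fh(3)] imageI[OF mult(2)[OF fh(1,3)], of "VV_class n"] fh(2,4) by simp
qed

lemma ideal_span:
  assumes K: "ideal K (VV n)" and W: "\<And>w. w \<in> W \<Longrightarrow> word_ok n w \<and> VV_word n w \<in> K" and f: "f \<in> lin_span n W"
  shows "VV_class n f \<in> K"
  using f
proof induction
  case (ideal f)
  then have "VV_class n f = \<zero>\<^bsub>VV n\<^esub>" using VV_class_eq_zero relation_ideal_closed(3) by blast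
  then show ?case using additive_subgroup.zero_closed[OF ideal.axioms(1)[OF K]] by simp
next
  case (word w c)
  have "VV_class n (Poly_Mapping.single 0 c * free_word w) = VV_class n (Poly_Mapping.single 0 c) \<otimes>\<^bsub>VV n\<^esub> VV_word n w"
    unfolding VV_word_def using W[OF word] by (intro VV_class_mult const_closed free_word_closed) auto
  then show ?case
    unfolding single_word using ideal.I_l_closed[OF K _ VV_class_closed[OF const_closed]] W[OF word] by simp
next
  case (add f g)
  have "f \<in> carrier (free_algebra n)" "g \<in> carrier (free_algebra n)"
    using add.hyps span_closed W by blast+
  then show ?case using VV_class_add[of f n g] additive_subgroup.a_closed[OF ideal.axioms(1)[OF K]] add.IH by simp
qed

lemma span_lincomb:
  assumes W: "\<And>w. w \<in> W \<Longrightarrow> word_ok n w" and f: "f \<in> lin_span n W"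
  shows "VV_class n f \<in> linear_combinations n (VV_word n ` W)"
  using f
proof induction
  interpret ring "VV n" by (rule ring_VV)
  {
    case (ideal f)
    then have "VV_class n f = \<zero>\<^bsub>VV n\<^esub>" using VV_class_eq_zero relation_ideal_closed(3) by blast
    then show ?case unfolding linear_combinations_def
      by (intro CollectI exI[of _ "{}"] exI[of _ "\<lambda>_. 0"]) simp
  next
    case (word w c)
    let ?x = "VV_word n w"
    have wc: "free_word w \<in> carrier (free_algebra n)" using W[OF word] by (rule free_word_closed)
    have c: "VV_scalar n c \<otimes>\<^bsub>VV n\<^esub> ?x \<in> carrier (VV n)"
      unfolding VV_scalar_def VV_word_def using VV_class_closed[OF wc] VV_class_closed[OF const_closed] by simp
    have "VV_class n (Poly_Mapping.single (Word w) c) = VV_scalar n c \<otimes>\<^bsub>VV n\<^esub> ?x"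
      unfolding single_word VV_scalar_def VV_word_def using wc by (intro VV_class_mult const_closed)
    also have "\<dots> = finsum (VV n) (\<lambda>x. VV_scalar n c \<otimes>\<^bsub>VV n\<^esub> x) {?x}" using c by (simp add: finsum_insert)
    finally show ?case unfolding linear_combinations_def using word
      by (intro CollectI exI[of _ "{?x}"] exI[of _ "\<lambda>_. c"]) auto
  next
    case (add f g)
    obtain F c where F: "VV_class n f = finsum (VV n) (\<lambda>x. VV_scalar n (c x) \<otimes>\<^bsub>VV n\<^esub> x) F" "finite F" "F \<subseteq> VV_word n ` W"
      using add.IH(1) by (auto simp: linear_combinations_def)
    obtain G d where G: "VV_class n g = finsum (VV n) (\<lambda>x. VV_scalar n (d x) \<otimes>\<^bsub>VV n\<^esub> x) G" "finite G" "G \<subseteq> VV_word n ` W"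
      using add.IH(2) by (auto simp: linear_combinations_def)
    have carr: "x \<in> carrier (VV n)" if x: "x \<in> F \<union> G" for x
    proof -
      obtain w where "w \<in> W" "x = VV_word n w" using x F(3) G(3) by blast
      then show ?thesis using VV_word_closed[OF W] by simp
    qed
    have sc: "VV_scalar n z \<in> carrier (VV n)" for z unfolding VV_scalar_def by (rule VV_class_closed[OF const_closed])
    have s0: "VV_scalar n 0 = \<zero>\<^bsub>VV n\<^esub>"
      unfolding VV_scalar_def using VV_class_eq_zero[OF free_zero_closed] relation_ideal_closed(1) by simp
    have sadd: "VV_scalar n (y + z) = VV_scalar n y \<oplus>\<^bsub>VV n\<^esub> VV_scalar n z" for y z
      unfolding VV_scalar_def single_add by (intro VV_class_add const_closed)
    \<comment> \<open>Extended by 0 to the union of the supports, the two families of coefficients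
      can be added; a class that occurs in both sums is thus counted with both coefficients.\<close>
    let ?c = "\<lambda>x. if x \<in> F then c x else 0" and ?d = "\<lambda>x. if x \<in> G then d x else 0"
    have "VV_class n f = finsum (VV n) (\<lambda>x. VV_scalar n (?c x) \<otimes>\<^bsub>VV n\<^esub> x) (F \<union> G)"
      unfolding F(1) using F(2) G(2) carr sc by (intro add.finprod_mono_neutral_cong_left) (auto simp: s0)
    moreover have "VV_class n g = finsum (VV n) (\<lambda>x. VV_scalar n (?d x) \<otimes>\<^bsub>VV n\<^esub> x) (F \<union> G)"
      unfolding G(1) using F(2) G(2) carr sc by (intro add.finprod_mono_neutral_cong_left) (auto simp: s0)
    ultimately have "VV_class n f \<oplus>\<^bsub>VV n\<^esub> VV_class n g
        = finsum (VV n) (\<lambda>x. VV_scalar n (?c x) \<otimes>\<^bsub>VV n\<^esub> x \<oplus>\<^bsub>VV n\<^esub> VV_scalar n (?d x) \<otimes>\<^bsub>VV n\<^esub> x) (F \<union> G)"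
      using carr sc by (simp only:) (intro finsum_addf[symmetric], auto)
    also have "\<dots> = finsum (VV n) (\<lambda>x. VV_scalar n (?c x + ?d x) \<otimes>\<^bsub>VV n\<^esub> x) (F \<union> G)"
      using carr sc by (intro finsum_cong') (auto simp: sadd l_distr simp del: if_split)
    finally have "VV_class n (f + g) = \<dots>"
      using VV_class_add[OF span_closed span_closed, OF add.hyps(1) W add.hyps(2) W] by simp
    then show ?case unfolding linear_combinations_def using F G
      by (intro CollectI exI[of _ "F \<union> G"] exI[of _ "\<lambda>x. ?c x + ?d x"]) auto
  }
qed

lemma lincomb_ideal:
  assumes K: "ideal K (VV n)" and N: "N \<subseteq> K"
  shows "linear_combinations n N \<subseteq> K"
proof
  interpret ideal K "VV n" by (rule K)
  fix x assume "x \<in> linear_combinations n N"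
  then obtain F c where F: "x = finsum (VV n) (\<lambda>x. VV_scalar n (c x) \<otimes>\<^bsub>VV n\<^esub> x) F" "finite F" "F \<subseteq> N"
    by (auto simp: linear_combinations_def)
  have mem: "VV_scalar n (c x) \<otimes>\<^bsub>VV n\<^esub> x \<in> K" if "x \<in> F" for x
    using that F(3) N VV_class_closed[OF const_closed] by (intro I_l_closed) (auto simp: VV_scalar_def)
  show "x \<in> K" unfolding F(1) using F(2) mem
  proof (induction F rule: finite_induct)
    case (insert y F)
    then show ?case using Icarr by (subst finsum_insert) auto
  qed simp
qed

lemma cup_word_ok: "2 * r \<le> n \<Longrightarrow> word_ok n (cup_word r)"
  using se_word_ok[OF cup_se_word] .

lemma odd_e_product_cup: "odd_e_product n r = VV_word n (cup_word r)"
  by (simp add: odd_e_product_def e_product_def cup_word_def comp_def)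

text \<open>Ideals do not see signs, so equality up to sign is enough to transfer
  membership.\<close>

lemma VV_word_ideal_eqv:
  assumes K: "ideal K (VV n)" and w: "word_eqv n w (u @ x @ v)" "word_ok n u" "word_ok n v" "word_ok n x" and x: "VV_word n x \<in> K"
  shows "VV_word n w \<in> K"
proof -
  have ok: "word_ok n (u @ x @ v)" using w by auto
  then have okw: "word_ok n w" using w(1) by (simp add: word_eqv_def)
  have "VV_word n (u @ x @ v) = VV_word n u \<otimes>\<^bsub>VV n\<^esub> (VV_word n x \<otimes>\<^bsub>VV n\<^esub> VV_word n v)"
    using VV_word_append[OF w(2), of "x @ v"] VV_word_append[OF w(4,3)] w(3,4) by (metis UnE set_append)
  also have "\<dots> \<in> K"
    using ideal.I_l_closed[OF K ideal.I_r_closed[OF K x]] VV_word_closed w(2,3) by blast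
  finally have "VV_word n (u @ x @ v) \<in> K" .
  then have "VV_class n (free_word w) \<in> K"
    using ok span_eqv[OF w(1) okw span_free_word[of _ "{u @ x @ v}"]] by (intro ideal_span[OF K, of "{u @ x @ v}"]) auto
  then show ?thesis by (simp add: VV_word_def)
qed

context
  fixes n r :: nat
  assumes r: "1 \<le> r" "2 * r \<le> n"
begin

lemma II_cup: "II n r = Idl\<^bsub>VV n\<^esub> {VV_word n (cup_word r)}"
proof -
  have "r \<le> n div 2" using r by linarith
  then show ?thesis using r by (simp add: II_def odd_e_product_cup)
qed

lemma II_ideal: "ideal (II n r) (VV n)"
  unfolding II_cup using VV_word_closed[OF cup_word_ok[OF r(2)]] by (intro ring.genideal_ideal[OF ring_VV]) simp

lemma cup_in_II: "VV_word n (cup_word r) \<in> II n r"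
  unfolding II_cup by (rule ring.genideal_self'[OF ring_VV VV_word_closed[OF cup_word_ok[OF r(2)]]])

text \<open>The span of the dotted words is a two-sided ideal and contains the generator.\<close>

lemma II_subset_dotted: "II n r \<subseteq> VV_class n ` lin_span n (dotted_words n r)"
  unfolding II_cup
proof (rule ring.genideal_minimal[OF ring_VV])
  have W: "word_ok n w" if "w \<in> dotted_words n r" for w
    using that dot_word_ok se_word_ok[OF cup_words_se[OF _ r(2)]] by (fastforce simp: dotted_words_def)
  show "ideal (VV_class n ` lin_span n (dotted_words n r)) (VV n)"
    using span_closed[OF _ W] span_zero lin_span.add dotted_span_ideal[OF r(2)]
    by (intro VV_class_ideal) auto
  have "cup_word r \<in> cup_words n r" unfolding cup_words_def by (intro CollectI exI[of _ "[]"]) simp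
  then have "cup_word r \<in> dotted_words n r" using dotted_words_I[of n "[]" "[]"] by simp
  then show "{VV_word n (cup_word r)} \<subseteq> VV_class n ` lin_span n (dotted_words n r)"
    using span_free_word by (auto simp: VV_word_def)
qed

lemma II_normal:
  assumes m: "monomial_choice n m"
  shows "II n r = linear_combinations n (normal_diagrams n m (n - 2 * r))"
proof
  show "II n r \<subseteq> linear_combinations n (normal_diagrams n m (n - 2 * r))"
  proof
    fix x assume "x \<in> II n r"
    then obtain f where f: "x = VV_class n f" "f \<in> lin_span n (dotted_words n r)" using II_subset_dotted by blast
    have "f \<in> lin_span n (normal_words n m (n - 2 * r))"
    proof (rule span_subset[OF f(2)])
      fix w assume "w \<in> dotted_words n r"
      then show "free_word w \<in> lin_span n (normal_words n m (n - 2 * r))"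
        using dotted_reduce[OF m r(2)] unfolding dotted_words_def by blast
    qed
    then show "x \<in> linear_combinations n (normal_diagrams n m (n - 2 * r))"
      unfolding f(1) normal_diagrams_image using normal_word_ok[OF m] by (intro span_lincomb)
  qed
  show "linear_combinations n (normal_diagrams n m (n - 2 * r)) \<subseteq> II n r"
    unfolding normal_diagrams_image
  proof (rule lincomb_ideal[OF II_ideal], rule image_subsetI)
    fix w assume "w \<in> normal_words n m (n - 2 * r)"
    from normal_word_factor[OF m r(2) this] show "VV_word n w \<in> II n r"
      using VV_word_ideal_eqv[OF II_ideal _ _ _ cup_word_ok[OF r(2)] cup_in_II] by blast
  qed
qed

lemma II_spaced:
  assumes js: "length js = r" "set js \<subseteq> {1..n - 1}"
    "\<forall>j<r. \<forall>k<r. j \<noteq> k \<longrightarrow> \<bar>int (js ! j) - int (js ! k)\<bar> > 1"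
  shows "II n r = Idl\<^bsub>VV n\<^esub> {e_product n js}"
proof -
  let ?w = "map CupCap js"
  have okw: "word_ok n ?w" using js(2) r by fastforce
  obtain \<sigma> where \<sigma>: "\<sigma> permutes {1..n}"
    "word_eqv n ?w (perm_word n \<sigma> @ cup_word r @ perm_word n (pinv \<sigma>))"
    "word_eqv n (cup_word r) (perm_word n (pinv \<sigma>) @ ?w @ perm_word n \<sigma>)"
    using VV_words.spaced_cups[OF js r(2)] by blast
  note ok = se_word_ok[OF perm_word_se[OF \<sigma>(1)]] se_word_ok[OF perm_word_se[OF permutes_inv[OF \<sigma>(1)]]]
  let ?K = "Idl\<^bsub>VV n\<^esub> {e_product n js}"
  have K: "ideal ?K (VV n)" and e: "VV_word n ?w \<in> ?K"
    using ring.genideal_ideal[OF ring_VV, of "{VV_word n ?w}"] VV_word_closed[OF okw]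
      ring.genideal_self'[OF ring_VV VV_word_closed[OF okw]]
    by (simp_all add: e_product_def)
  have "VV_word n (cup_word r) \<in> ?K" by (rule VV_word_ideal_eqv[OF K \<sigma>(3) ok(2,1) okw e])
  then have "II n r \<subseteq> ?K" unfolding II_cup by (intro ring.genideal_minimal[OF ring_VV K]) simp
  moreover have "VV_word n ?w \<in> II n r"
    by (rule VV_word_ideal_eqv[OF II_ideal \<sigma>(2) ok(1,2) cup_word_ok[OF r(2)] cup_in_II])
  then have "?K \<subseteq> II n r" by (intro ring.genideal_minimal[OF ring_VV II_ideal]) (simp add: e_product_def)
  ultimately show ?thesis by blast
qed

end

section \<open>A tensor representation\<close>

text \<open>Any operators with the signed relations between crossings and cup-caps acquire an action
  of the dots. Indices start at 0 and are unbounded, which removes all side conditions on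
  ranges.\<close>

locale jucys_murphy =
  fixes s e :: "nat \<Rightarrow> 'r::ring_1"
  assumes ss: "s i * s i = 1"
    and ss_comm: "i + 1 < j \<Longrightarrow> s i * s j = s j * s i"
    and se_comm: "i + 1 < j \<or> j + 1 < i \<Longrightarrow> s i * e j = e j * s i"
    and ee_comm: "i + 1 < j \<Longrightarrow> e i * e j = e j * e i"
    and braid: "s i * s (i + 1) * s i = s (i + 1) * s i * s (i + 1)"
    and eee_up: "e (i + 1) * e i * e (i + 1) = - e (i + 1)"
    and eee_down: "e i * e (i + 1) * e i = - e i"
    and es: "e i * s i = e i"
    and se: "s i * e i = - e i"
    and see_down: "s i * e (i + 1) * e i = s (i + 1) * e i"
    and see_up: "s (i + 1) * e i * e (i + 1) = - (s i * e (i + 1))"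
    and ees_up: "e (i + 1) * e i * s (i + 1) = e (i + 1) * s i"
    and ees_down: "e i * e (i + 1) * s i = - (e i * s (i + 1))"
    and ee: "e i * e i = 0"
begin

text \<open>The relation \<open>sy\<close>, multiplied by \<open>s_i\<close> on the right, reads
  \<open>y_(i+1) = s_i y_i s_i + s_i + e_i\<close>. With \<open>y_1 = 0\<close> this is the
  recursion; \<open>jm i\<close> represents \<open>y_(i+1)\<close>.\<close>

fun jm :: "nat \<Rightarrow> 'r" where
  "jm 0 = 0"
| "jm (Suc i) = s i * jm i * s i + s i + e i"

lemma ss_assoc: "s i * (s i * x) = x"
  using ss[of i] by (simp flip: mult.assoc)

lemma jm_commute:
  "(\<And>k. k < i \<Longrightarrow> z * s k = s k * z) \<Longrightarrow> (\<And>k. k < i \<Longrightarrow> z * e k = e k * z) \<Longrightarrow> z * jm i = jm i * z"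
proof (induction i)
  case (Suc i)
  then have "z * jm i = jm i * z" "z * s i = s i * z" "z * e i = e i * z" by auto
  then show ?case by (simp add: distrib_left distrib_right) (metis mult.assoc)
qed simp

lemma jm_low: "i < k \<Longrightarrow> s k * jm i = jm i * s k" "i < k \<Longrightarrow> e k * jm i = jm i * e k"
  by (intro jm_commute ss_comm[symmetric] se_comm se_comm[symmetric] ee_comm[symmetric]; simp)+

lemma ee_up: "e (i + 1) * e i = s i * s (i + 1) * e i" "e (i + 1) * e i = e (i + 1) * s i * s (i + 1)"
  using see_down[of i] ees_up[of i] ss[of i] ss[of "i + 1"] by (metis mult.assoc mult_1 mult_1_right)+

lemma ee_down: "e i * e (i + 1) = - (s (i + 1) * s i * e (i + 1))" "e i * e (i + 1) = - (e i * s (i + 1) * s i)"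
proof -
  have "e i * e (i + 1) = s (i + 1) * (s (i + 1) * e i * e (i + 1))" by (simp add: mult.assoc ss_assoc)
  then show "e i * e (i + 1) = - (s (i + 1) * s i * e (i + 1))" unfolding see_up by (simp add: mult.assoc)
  have "e i * e (i + 1) = (e i * e (i + 1) * s i) * s i" by (simp add: mult.assoc ss)
  then show "e i * e (i + 1) = - (e i * s (i + 1) * s i)" unfolding ees_down by simp
qed

lemma ese: "e i * s (i + 1) * e i = - e i"
proof -
  have "e i * s (i + 1) * e i = - (e i * e (i + 1) * s i) * e i" unfolding ees_down by simp
  also have "\<dots> = e i * e (i + 1) * e i" by (simp add: mult.assoc se)
  finally show ?thesis unfolding eee_down .
qed

text \<open>The critical case of commutation. Both recursion steps are unfolded, giving
  \<open>b a y a b + b a b + b c b + b + f\<close>, where \<open>y\<close> commutes with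
  \<open>b\<close> and \<open>f\<close>.\<close>

lemma jm_next: "s k * jm (Suc (Suc k)) = jm (Suc (Suc k)) * s k" "e k * jm (Suc (Suc k)) = jm (Suc (Suc k)) * e k"
proof -
  define a b c f y where "a = s k" and "b = s (k + 1)" and "c = e k" and "f = e (k + 1)" and "y = jm k"
  have y: "b * y = y * b" "f * y = y * f"
    unfolding b_def f_def y_def by (rule jm_low; simp)+
  have R: "a * a = 1" "b * b = 1" "a * b * a = b * a * b" "f * b = f" "b * f = - f" "c * a = c" "a * c = - c"
    "f * c = a * b * c" "f * c = f * a * b" "c * f = - (b * a * f)" "c * f = - (c * b * a)" "c * b * c = - c"
    unfolding a_def b_def c_def f_def by (fact ss ss braid es se es se ee_up ee_down ese)+
  have j: "jm (Suc (Suc k)) = b * (a * y * a + a + c) * b + b + f"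
    by (simp add: a_def b_def c_def f_def y_def One_nat_def)
  have fab: "a * b * c = f * a * b" using R(8,9) by simp
  have cba: "c * b * a = b * a * f" using R(10,11) by simp
  have "a * (b * a * y * a * b) = (b * a * y * a * b) * a"
  proof -
    have "a * (b * a * y * a * b) = b * a * (b * y) * a * b" using R(3) by (simp flip: mult.assoc)
    also have "\<dots> = b * a * y * (b * a * b)" unfolding y(1) by (simp add: mult.assoc)
    also have "\<dots> = (b * a * y * a * b) * a" unfolding R(3)[symmetric] by (simp add: mult.assoc)
    finally show ?thesis .
  qed
  moreover have "a * (b * a * b) = b * a" unfolding R(3)[symmetric] using R(1) by (simp flip: mult.assoc)
  moreover have "(b * a * b) * a = a * b" unfolding R(3)[symmetric] using R(1) by (simp add: mult.assoc)
  moreover have "a * (b * c * b) = f * a"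
    using fab R(2) by (metis mult.assoc mult_1_right)
  moreover have "(b * c * b) * a = a * f"
    using cba R(2) by (metis mult.assoc mult_1)
  \<comment> \<open>Apart from the first term, left multiplication by \<open>a\<close> yields
    \<open>b a\<close>, \<open>f a\<close>, \<open>a b\<close>, \<open>a f\<close>, and right
    multiplication yields the same four products in another order.\<close>
  ultimately show "s k * jm (Suc (Suc k)) = jm (Suc (Suc k)) * s k"
    unfolding j a_def[symmetric] by (simp add: distrib_left distrib_right mult.assoc)
  have "c * (b * a * y * a * b) = (b * a * y * a * b) * c"
  proof -
    have "c * (b * a * y * a * b) = (c * b * a) * y * a * b" by (simp add: mult.assoc)
    also have "\<dots> = b * a * (f * y) * a * b" unfolding cba by (simp add: mult.assoc)
    also have "\<dots> = b * a * y * (f * a * b)" unfolding y(2) by (simp add: mult.assoc)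
    also have "\<dots> = (b * a * y * a * b) * c" unfolding fab[symmetric] by (simp add: mult.assoc)
    finally show ?thesis .
  qed
  moreover have "c * (b * a * b) = - (c * f)"
  proof -
    have "c * (b * a * b) = (c * b * a) * b" by (simp add: mult.assoc)
    also have "\<dots> = b * a * f" unfolding cba using R(4) by (simp add: mult.assoc)
    finally show ?thesis using R(10) by simp
  qed
  moreover have "(b * a * b) * c = - (f * c)"
  proof -
    have "(b * a * b) * c = b * (a * b * c)" by (simp add: mult.assoc)
    also have "\<dots> = (b * f) * a * b" unfolding fab by (simp add: mult.assoc)
    also have "\<dots> = - (f * a * b)" unfolding R(5) by simp
    finally show ?thesis using R(9) by simp
  qed
  moreover have "c * (b * c * b) = - (c * b)" using R(12) by (metis mult.assoc mult_minus_left)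
  moreover have "(b * c * b) * c = - (b * c)" using R(12) by (metis mult.assoc mult_minus_right)
  \<comment> \<open>On each side the terms other than \<open>b a y a b\<close> cancel in pairs, for
    example \<open>c (b a b) = - c f\<close> against \<open>c f\<close>.\<close>
  ultimately show "e k * jm (Suc (Suc k)) = jm (Suc (Suc k)) * e k"
    unfolding j c_def[symmetric] by (simp add: distrib_left distrib_right mult.assoc)
qed

lemma jm_high: "k + 1 < i \<Longrightarrow> s k * jm i = jm i * s k \<and> e k * jm i = jm i * e k"
proof (induction i)
  case (Suc i)
  show ?case
  proof (cases "i = k + 1")
    case True
    then have "Suc i = Suc (Suc k)" by simp
    then show ?thesis using jm_next[of k] by metis
  next
    case False
    with Suc have ki: "k + 1 < i" by simp
    with Suc have IH: "s k * jm i = jm i * s k" "e k * jm i = jm i * e k" by auto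
    have c: "s k * s i = s i * s k" "s k * e i = e i * s k" "e k * s i = s i * e k" "e k * e i = e i * e k"
      using ki ss_comm se_comm ee_comm by auto
    show ?thesis using IH c by (simp add: distrib_left distrib_right) (metis mult.assoc)
  qed
qed simp

lemma jm_s_comm: "j \<noteq> i \<Longrightarrow> j \<noteq> i + 1 \<Longrightarrow> s i * jm j = jm j * s i"
  using jm_low(1)[of j i] jm_high[of i j] by (cases "j < i") auto

lemma jm_e_comm: "j \<noteq> i \<Longrightarrow> j \<noteq> i + 1 \<Longrightarrow> e i * jm j = jm j * e i"
  using jm_low(2)[of j i] jm_high[of i j] by (cases "j < i") auto

text \<open>\<open>jm i\<close> is built from crossings and cup-caps with indices below
  \<open>i\<close>, and by \<open>jm_high\<close> these commute with the later
  \<open>jm j\<close>.\<close>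

lemma jm_jm_comm: "jm i * jm j = jm j * jm i"
proof -
  have "jm j * jm i = jm i * jm j" if "i < j" for i j
    by (rule jm_commute) (use jm_high that in \<open>auto simp: Suc_le_eq\<close>)
  then show ?thesis using linorder_less_linear[of i j] by metis
qed

text \<open>Unfolding \<open>jm (Suc i)\<close> in the relations \<open>jm_ey\<close> and
  \<open>jm_ye\<close> leaves these identities. In the first induction step,
  \<open>f a = f c b\<close> moves the crossing \<open>b\<close> across \<open>y\<close>, after
  which the hypothesis removes \<open>a\<close> behind \<open>c y\<close>; the second step is
  analogous, with signs.\<close>

lemma e_jm_s: "e i * jm i * s i = e i * jm i" "s i * jm i * e i = - (jm i * e i)"
proof (induction i)
  case (Suc i)
  define a b c f y where "a = s i" and "b = s (i + 1)" and "c = e i" and "f = e (i + 1)" and "y = jm i"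
  have y: "b * y = y * b" unfolding b_def y_def by (rule jm_low) simp
  have R: "a * a = 1" "b * b = 1" "a * b * a = b * a * b"
    "f * c * b = f * a" "b * c * f = - (a * f)" "f * c = f * a * b" "c * f = - (b * a * f)"
    unfolding a_def b_def c_def f_def by (fact ss ss braid ees_up see_up ee_up ee_down)+
  have j: "jm (Suc i) = a * y * a + a + c" by (simp add: a_def c_def y_def)
  { case 1
    have IH: "c * y * a = c * y" using Suc(1) by (simp add: a_def c_def y_def)
    have "f * (a * y * a) * b = f * c * (b * y) * a * b" unfolding mult.assoc[symmetric] R(4) ..
    also have "\<dots> = f * c * y * (b * a * b)" unfolding y by (simp add: mult.assoc)
    also have "\<dots> = f * (c * y * a) * b * a" unfolding R(3)[symmetric] by (simp add: mult.assoc)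
    also have "\<dots> = f * c * (y * b) * a" unfolding IH by (simp add: mult.assoc)
    also have "\<dots> = f * a * y * a" unfolding y[symmetric] mult.assoc[symmetric] R(4) ..
    finally have "f * (a * y * a) * b = f * a * y * a" .
    moreover have "f * a * b = f * c" "f * c * b = f * a" using R by simp_all
    ultimately have "f * jm (Suc i) * b = f * jm (Suc i)"
      unfolding j by (simp add: distrib_left distrib_right mult.assoc)
    then show ?case unfolding b_def f_def Suc_eq_plus1 . }
  { case 2
    have IH: "a * y * c = - (y * c)" using Suc(2) by (simp add: a_def c_def y_def)
    have af: "a * f = - (b * c * f)" using R(5) by simp
    have "b * (a * y * a) * f = b * a * y * (a * f)" by (simp add: mult.assoc)
    also have "\<dots> = - (b * a * (y * b) * c * f)" unfolding af by (simp add: mult.assoc)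
    also have "\<dots> = - ((b * a * b) * y * c * f)" unfolding y[symmetric] by (simp add: mult.assoc)
    also have "\<dots> = - (a * b * (a * y * c) * f)" unfolding R(3)[symmetric] by (simp add: mult.assoc)
    also have "\<dots> = a * (b * y) * c * f" unfolding IH by (simp add: mult.assoc)
    also have "\<dots> = a * y * (b * c * f)" unfolding y by (simp add: mult.assoc)
    also have "\<dots> = - (a * y * a * f)" unfolding R(5) by (simp add: mult.assoc)
    finally have "b * (a * y * a) * f = - (a * y * a * f)" .
    moreover have "b * a * f = - (c * f)" "b * c * f = - (a * f)" using R by simp_all
    ultimately have "b * jm (Suc i) * f = - (jm (Suc i) * f)"
      unfolding j by (simp add: distrib_left distrib_right mult.assoc)
    then show ?case unfolding b_def f_def Suc_eq_plus1 . }
qed simp_all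

lemma jm_sy: "s i * jm i - jm (Suc i) * s i = - e i - 1"
  by (simp add: distrib_right mult.assoc ss es)

lemma jm_ys: "jm i * s i - s i * jm (Suc i) = e i - 1"
  by (simp add: distrib_left ss_assoc mult.assoc ss se)

lemma jm_ey: "e i * (jm i - jm (Suc i)) = - e i"
proof -
  have "e i * jm (Suc i) = (e i * s i) * jm i * s i + e i * s i + e i * e i" by (simp add: distrib_left mult.assoc)
  also have "\<dots> = e i * jm i + e i" unfolding es ee e_jm_s by simp
  finally show ?thesis by (simp add: right_diff_distrib)
qed

lemma jm_ye: "(jm i - jm (Suc i)) * e i = e i"
proof -
  have "jm (Suc i) * e i = s i * jm i * (s i * e i) + s i * e i + e i * e i" by (simp add: distrib_right mult.assoc)
  also have "\<dots> = - (s i * jm i * e i) - e i" unfolding se ee by simp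
  also have "\<dots> = jm i * e i - e i" unfolding e_jm_s by simp
  finally show ?thesis by (simp add: left_diff_distrib)
qed

end

section \<open>Linear operators on functions and the action on tensors\<close>

typedef 'a linop = "{T :: ('a \<Rightarrow> complex) \<Rightarrow> 'a \<Rightarrow> complex. \<forall>f g c x. T (\<lambda>y. f y + c * g y) x = T f x + c * T g x}"
  morphisms app Linop
  by (rule exI[of _ id]) auto

setup_lifting type_definition_linop

lemma linop_linear: "app T (\<lambda>y. f y + c * g y) x = app T f x + c * app T g x"
  using app[of T] by blast

instantiation linop :: (type) ring_1
begin

lift_definition zero_linop :: "'a linop" is "\<lambda>f x. 0" by simp
lift_definition one_linop :: "'a linop" is "\<lambda>f. f" by simp
lift_definition plus_linop :: "'a linop \<Rightarrow> 'a linop \<Rightarrow> 'a linop" is "\<lambda>S T f x. S f x + T f x"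
  by (simp add: algebra_simps)
lift_definition minus_linop :: "'a linop \<Rightarrow> 'a linop \<Rightarrow> 'a linop" is "\<lambda>S T f x. S f x - T f x"
  by (simp add: algebra_simps)
lift_definition uminus_linop :: "'a linop \<Rightarrow> 'a linop" is "\<lambda>T f x. - T f x"
  by (simp add: algebra_simps)
lift_definition times_linop :: "'a linop \<Rightarrow> 'a linop \<Rightarrow> 'a linop" is "\<lambda>S T f. S (T f)"
proof -
  fix S T :: "('a \<Rightarrow> complex) \<Rightarrow> 'a \<Rightarrow> complex" and f g c x
  assume S: "\<And>f g c x. S (\<lambda>y. f y + c * g y) x = S f x + c * S g x"
    and T: "\<And>f g c x. T (\<lambda>y. f y + c * g y) x = T f x + c * T g x"
  show "S (T (\<lambda>y. f y + c * g y)) x = S (T f) x + c * S (T g) x"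
    unfolding T S ..
qed

instance
proof
  fix a b c :: "'a linop"
  show "a * (b + c) = a * b + a * c"
  proof (transfer, intro ext)
    fix S T U :: "('a \<Rightarrow> complex) \<Rightarrow> 'a \<Rightarrow> complex" and f x
    assume "\<forall>f g c x. S (\<lambda>y. f y + c * g y) x = S f x + c * S g x"
    from this[rule_format, of "T f" 1 "U f" x] show "S (\<lambda>x. T f x + U f x) x = S (T f) x + S (U f) x" by simp
  qed
  show "(0 :: 'a linop) \<noteq> 1" by transfer (metis one_neq_zero)
  show "a * b * c = a * (b * c)" by transfer simp
  show "1 * a = a" by transfer simp
  show "a * 1 = a" by transfer simp
  show "(a + b) * c = a * c + b * c" by transfer simp
  show "a + b + c = a + (b + c)" by transfer (simp add: add.assoc)
  show "a + b = b + a" by transfer (simp add: add.commute)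
  show "0 + a = a" by transfer simp
  show "- a + a = 0" by transfer simp
  show "a - b = a + - b" by transfer simp
qed

end

lift_definition scalar :: "complex \<Rightarrow> 'a linop" is "\<lambda>c f x. c * f x"
  by (simp add: algebra_simps)

lemma app_zero: "app T (\<lambda>y. 0) x = 0"
  using linop_linear[of T "\<lambda>y. 0" 1 "\<lambda>y. 0" x] by simp

lemma scalar_simps:
  "scalar c * T = T * scalar c" "scalar (c + d) = scalar c + scalar d" "scalar (c * d) = scalar c * scalar d"
  "scalar 1 = 1" "scalar 0 = 0"
proof -
  show "scalar c * T = T * scalar c"
  proof (rule app_inject[THEN iffD1], intro ext)
    fix f x
    show "app (scalar c * T) f x = app (T * scalar c) f x"
      using linop_linear[of T "\<lambda>y. 0" c f x] app_zero[of T x] by (simp add: times_linop.rep_eq scalar.rep_eq)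
  qed
qed (transfer, simp add: fun_eq_iff algebra_simps)+

lemmas app_simps = zero_linop.rep_eq one_linop.rep_eq plus_linop.rep_eq minus_linop.rep_eq
  uminus_linop.rep_eq times_linop.rep_eq scalar.rep_eq

lemma linop_eqI: "(\<And>f x. app S f x = app T f x) \<Longrightarrow> S = T"
  by (auto simp flip: app_inject)

text \<open>
  The tensor powers of the superspace with even basis vector \<open>False\<close> and odd basis vector
  \<open>True\<close>: \<open>cross_op\<close> is the super flip, and \<open>cupcap_op\<close> contracts with the odd symmetric form
  pairing the two basis vectors and inserts the dual tensor.
\<close>

lift_definition cross_op :: "nat \<Rightarrow> (nat \<Rightarrow> bool) linop" is
  "\<lambda>i f x. (if x i \<and> x (i + 1) then - 1 else 1) * f (x(i := x (i + 1), i + 1 := x i))"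
  by (simp add: algebra_simps)

lift_definition cupcap_op :: "nat \<Rightarrow> (nat \<Rightarrow> bool) linop" is
  "\<lambda>i f x. (if x i = x (i + 1) then 0
     else (if x i then - 1 else 1) * (f (x(i := False, i + 1 := True)) + f (x(i := True, i + 1 := False))))"
  by (simp add: algebra_simps)

lemmas op_simps = cross_op.rep_eq cupcap_op.rep_eq app_simps

interpretation JM: jucys_murphy cross_op cupcap_op
proof
  fix i j :: nat
  \<comment> \<open>A relation on at most three neighbouring positions only has to be checked on the
    eight patterns there; the other positions are a parameter.\<close>
  define set3 where "set3 x p q r = x(i := p, i + 1 := q, i + 2 := r)" for x :: "nat \<Rightarrow> bool" and p q r
  have two: "i + 1 + 1 = i + 2" by simp
  have c3: "app (cross_op i) f (set3 x p q r) = (if p \<and> q then - 1 else 1) * f (set3 x q p r)"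
    "app (cross_op (i + 1)) f (set3 x p q r) = (if q \<and> r then - 1 else 1) * f (set3 x p r q)"
    "app (cupcap_op i) f (set3 x p q r) = (if p = q then 0 else (if p then - 1 else 1) * (f (set3 x False True r) + f (set3 x True False r)))"
    "app (cupcap_op (i + 1)) f (set3 x p q r) = (if q = r then 0 else (if q then - 1 else 1) * (f (set3 x p False True) + f (set3 x p True False)))"
    for f x p q r
    by (simp_all add: set3_def op_simps fun_upd_twist two)
  have three: "S = T" if "\<And>f x p q r. app S f (set3 x p q r) = app T f (set3 x p q r)" for S T
  proof (rule linop_eqI)
    fix f and x :: "nat \<Rightarrow> bool"
    have "x = set3 x (x i) (x (i + 1)) (x (i + 2))" by (auto simp: set3_def)
    then show "app S f x = app T f x" using that by metis
  qed
  show "cross_op i * cross_op i = 1" by (rule three) (simp add: app_simps c3)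
  show "cross_op i * cross_op (i + 1) * cross_op i = cross_op (i + 1) * cross_op i * cross_op (i + 1)"
    by (rule three) (simp add: app_simps c3)
  show "cupcap_op (i + 1) * cupcap_op i * cupcap_op (i + 1) = - cupcap_op (i + 1)"
    by (rule three) (simp add: app_simps c3)
  show "cupcap_op i * cupcap_op (i + 1) * cupcap_op i = - cupcap_op i"
    by (rule three) (simp add: app_simps c3)
  show "cupcap_op i * cross_op i = cupcap_op i" by (rule three) (simp add: app_simps c3)
  show "cross_op i * cupcap_op i = - cupcap_op i" by (rule three) (simp add: app_simps c3)
  show "cross_op i * cupcap_op (i + 1) * cupcap_op i = cross_op (i + 1) * cupcap_op i"
    by (rule three) (simp add: app_simps c3)
  show "cross_op (i + 1) * cupcap_op i * cupcap_op (i + 1) = - (cross_op i * cupcap_op (i + 1))"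
    by (rule three) (simp add: app_simps c3)
  show "cupcap_op (i + 1) * cupcap_op i * cross_op (i + 1) = cupcap_op (i + 1) * cross_op i"
    by (rule three) (simp add: app_simps c3)
  show "cupcap_op i * cupcap_op (i + 1) * cross_op i = - (cupcap_op i * cross_op (i + 1))"
    by (rule three) (simp add: app_simps c3)
  show "cupcap_op i * cupcap_op i = 0" by (rule three) (simp add: app_simps c3)
  show "cross_op i * cross_op j = cross_op j * cross_op i" if "i + 1 < j"
    by (rule linop_eqI) (use that in \<open>simp add: op_simps fun_upd_twist\<close>)
  show "cross_op i * cupcap_op j = cupcap_op j * cross_op i" if "i + 1 < j \<or> j + 1 < i"
    by (rule linop_eqI) (use that in \<open>auto simp add: op_simps fun_upd_twist algebra_simps\<close>)
  show "cupcap_op i * cupcap_op j = cupcap_op j * cupcap_op i" if "i + 1 < j"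
    by (rule linop_eqI) (use that in \<open>simp add: op_simps fun_upd_twist\<close>)
qed

text \<open>Generators are numbered from 1, the positions of a word in the tensor power from 0.\<close>

fun gen_op :: "gen \<Rightarrow> (nat \<Rightarrow> bool) linop" where
  "gen_op (Cross i) = cross_op (i - 1)"
| "gen_op (CupCap i) = cupcap_op (i - 1)"
| "gen_op (Dot j) = JM.jm (j - 1)"

section \<open>Evaluation of the free algebra in the representation\<close>

definition word_op :: "gen list \<Rightarrow> (nat \<Rightarrow> bool) linop" where
  "word_op w = prod_list (map gen_op w)"

definition eval_op :: "free_alg \<Rightarrow> (nat \<Rightarrow> bool) linop" where
  "eval_op f = (\<Sum>w\<in>Poly_Mapping.keys f. scalar (Poly_Mapping.lookup f w) * word_op (letters w))"

lemma eval_add: "eval_op (f + g) = eval_op f + eval_op g"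
  unfolding eval_op_def
  by (rule setsum_keys_plus_distrib) (simp_all add: scalar_simps distrib_right)

lemma eval_single: "eval_op (Poly_Mapping.single w c) = scalar c * word_op (letters w)"
  by (cases "c = 0") (simp_all add: eval_op_def scalar_simps)

lemma poly_mapping_induct [case_names zero add]:
  assumes "Q (0 :: free_alg)" "\<And>f w c. Q f \<Longrightarrow> Q (f + Poly_Mapping.single w c)"
  shows "Q f"
proof (induction f rule: update_induct)
  case (update f a b)
  have "Poly_Mapping.update a b f = f + Poly_Mapping.single a b"
    using update(1) by (intro poly_mapping_eqI) (auto simp: lookup_update lookup_add lookup_single in_keys_iff)
  then show ?case using assms(2) update by simp
qed (rule assms(1))

lemma eval_zero: "eval_op 0 = 0"
  by (simp add: eval_op_def)

lemma eval_mult: "eval_op (f * g) = eval_op f * eval_op g"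
proof (induction f rule: poly_mapping_induct)
  case (add f u c)
  have "eval_op (Poly_Mapping.single u c * g) = eval_op (Poly_Mapping.single u c) * eval_op g"
  proof (induction g rule: poly_mapping_induct)
    case (add g v d)
    have "scalar (c * d) * (word_op (letters u) * word_op (letters v))
        = scalar c * word_op (letters u) * (scalar d * word_op (letters v))"
      by (simp add: scalar_simps(3) mult.assoc) (metis mult.assoc scalar_simps(1))
    then show ?case using add
      by (simp add: distrib_left eval_add mult_single eval_single word_op_def plus_word_def)
  qed (simp add: eval_zero)
  then show ?case using add by (simp add: distrib_right eval_add)
qed (simp add: eval_zero)

lemma eval_uminus: "eval_op (- f) = - eval_op f"
  using eval_add[of f "- f"] by (simp add: eval_zero eq_neg_iff_add_eq_0 add.commute)

lemma eval_diff: "eval_op (f - g) = eval_op f - eval_op g"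
  using eval_add[of f "- g"] by (simp add: eval_uminus)

lemma eval_word: "eval_op (free_word w) = word_op w"
  by (simp add: free_word_def eval_single scalar_simps)

lemma eval_one: "eval_op 1 = 1"
  using eval_word[of "[]"] by (simp add: free_word_Nil word_op_def)

lemma eval_relation: "(l, r) \<in> relations n \<Longrightarrow> eval_op l = eval_op r"
proof (induction rule: relations.cases)
  note [simp] = eval_mult eval_word eval_uminus eval_diff eval_one eval_zero word_op_def
  have dec: "\<exists>k. i = k + 1" if "1 \<le> i" for i :: nat using that by (intro exI[of _ "i - 1"]) simp
  {
    case (ss i) then show ?case using JM.ss by simp
  next
    case (ss_comm i j)
    then have "i - 1 + 1 < j - 1 \<or> j - 1 + 1 < i - 1" by linarith
    then show ?case using ss_comm JM.ss_comm[of "i - 1" "j - 1"] JM.ss_comm[of "j - 1" "i - 1"] by auto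
  next
    case (se_comm i j)
    then have "i - 1 + 1 < j - 1 \<or> j - 1 + 1 < i - 1" by linarith
    then show ?case using se_comm JM.se_comm[of "i - 1" "j - 1"] by auto
  next
    case (ee_comm i j)
    then have "i - 1 + 1 < j - 1 \<or> j - 1 + 1 < i - 1" by linarith
    then show ?case using ee_comm JM.ee_comm[of "i - 1" "j - 1"] JM.ee_comm[of "j - 1" "i - 1"] by auto
  next
    case (braid i) then obtain k where "i = k + 1" using dec by blast
    with braid show ?case using JM.braid[of k] by simp
  next
    case (yy_comm i j) then show ?case using JM.jm_jm_comm by simp
  next
    case (ey_comm i j)
    then have "j - 1 \<noteq> i - 1" "j - 1 \<noteq> i - 1 + 1" by linarith+
    then show ?case using ey_comm JM.jm_e_comm[of "j - 1" "i - 1"] by simp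
  next
    case (sy_comm i j)
    then have "j - 1 \<noteq> i - 1" "j - 1 \<noteq> i - 1 + 1" by linarith+
    then show ?case using sy_comm JM.jm_s_comm[of "j - 1" "i - 1"] by simp
  next
    case (eee_up i) then obtain k where "i = k + 1" using dec by blast
    with eee_up show ?case using JM.eee_up[of k] by simp
  next
    case (eee_down i) then obtain k where "i = k + 1" using dec by blast
    with eee_down show ?case using JM.eee_down[of k] by simp
  next
    case (es i) then show ?case using JM.es by simp
  next
    case (se i) then show ?case using JM.se by simp
  next
    case (see_down i) then obtain k where "i = k + 1" using dec by blast
    with see_down show ?case using JM.see_down[of k] by simp
  next
    case (see_up i) then obtain k where "i = k + 1" using dec by blast
    with see_up show ?case using JM.see_up[of k] by simp
  next
    case (ees_up i) then obtain k where "i = k + 1" using dec by blast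
    with ees_up show ?case using JM.ees_up[of k] by simp
  next
    case (ees_down i) then obtain k where "i = k + 1" using dec by blast
    with ees_down show ?case using JM.ees_down[of k] by simp
  next
    case (ee i) then show ?case using JM.ee by simp
  next
    case (sy i) then obtain k where k: "i = k + 1" using dec by blast
    show ?case using JM.jm_sy[of k, unfolded Suc_eq_plus1] unfolding sy(1,2) k by (simp del: JM.jm.simps)
  next
    case (ys i) then obtain k where k: "i = k + 1" using dec by blast
    show ?case using JM.jm_ys[of k, unfolded Suc_eq_plus1] unfolding ys(1,2) k by (simp del: JM.jm.simps)
  next
    case (ey i) then obtain k where k: "i = k + 1" using dec by blast
    show ?case using JM.jm_ey[of k, unfolded Suc_eq_plus1] unfolding ey(1,2) k by (simp del: JM.jm.simps)
  next
    case (ye i) then obtain k where k: "i = k + 1" using dec by blast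
    show ?case using JM.jm_ye[of k, unfolded Suc_eq_plus1] unfolding ye(1,2) k by (simp del: JM.jm.simps)
  }
qed

lemma eval_relation_ideal:
  assumes "f \<in> relation_ideal n"
  shows "eval_op f = 0"
proof -
  let ?K = "{f \<in> carrier (free_algebra n). eval_op f = 0}"
  have "ideal ?K (free_algebra n)"
  proof (rule idealI[OF ring_free_algebra])
    interpret ring "free_algebra n" by (rule ring_free_algebra)
    show "subgroup ?K (add_monoid (free_algebra n))"
    proof
      show "inv\<^bsub>add_monoid (free_algebra n)\<^esub> x \<in> ?K" if x: "x \<in> ?K" for x
      proof -
        have "\<ominus>\<^bsub>free_algebra n\<^esub> x = - x"
          using x free_minus_closed by (intro minus_equality) auto
        then show ?thesis using x free_minus_closed by (auto simp: eval_uminus a_inv_def)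
      qed
    qed (auto simp: eval_add eval_zero free_add_closed free_zero_closed)
  qed (auto simp: eval_mult free_mult_closed)
  moreover have "{l - r | l r. (l, r) \<in> relations n} \<subseteq> ?K"
    using eval_relation relations_closed free_diff_closed by (fastforce simp: eval_diff)
  ultimately have "relation_ideal n \<subseteq> ?K"
    unfolding relation_ideal_def by (rule ring.genideal_minimal[OF ring_free_algebra])
  then show ?thesis using assms by blast
qed

section \<open>Weights and strictness of the chain\<close>

definition weight :: "nat \<Rightarrow> (nat \<Rightarrow> bool) \<Rightarrow> int" where
  "weight n x = (\<Sum>j<n. if x j then - 1 else 1)"

text \<open>The weight counts even minus odd factors among the first \<open>n\<close>. A crossing
  permutes factors and a cup-cap replaces one opposite pair by another, so these spaces are
  invariant.\<close>

definition weight_space :: "nat \<Rightarrow> int \<Rightarrow> ((nat \<Rightarrow> bool) \<Rightarrow> complex) set" where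
  "weight_space n k = {f. \<forall>x. f x \<noteq> 0 \<longrightarrow> weight n x = k}"

lemma weight_split:
  assumes "i + 1 < n"
  shows "weight n x = (\<Sum>j\<in>{..<n} - {i, i + 1}. if x j then - 1 else 1)
    + (if x i then - 1 else 1) + (if x (i + 1) then - 1 else 1)"
proof -
  have "{..<n} = insert i (insert (i + 1) ({..<n} - {i, i + 1}))" using assms by auto
  then have "weight n x = sum (\<lambda>j. if x j then - 1 else 1) (insert i (insert (i + 1) ({..<n} - {i, i + 1})))"
    unfolding weight_def by metis
  also have "\<dots> = (\<Sum>j\<in>{..<n} - {i, i + 1}. if x j then - 1 else 1)
    + (if x i then - 1 else 1) + (if x (i + 1) then - 1 else 1)"
    by (subst sum.insert; simp)+
  finally show ?thesis .
qed

lemma weight_update: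
  assumes "i + 1 < n"
  shows "weight n (x(i := p, i + 1 := q)) = weight n x
    + (if p then - 1 else 1) + (if q then - 1 else 1) - (if x i then - 1 else 1) - (if x (i + 1) then - 1 else 1)"
proof -
  have "(\<Sum>j\<in>{..<n} - {i, i + 1}. if (x(i := p, i + 1 := q)) j then - 1 else 1 :: int)
      = (\<Sum>j\<in>{..<n} - {i, i + 1}. if x j then - 1 else 1)"
    by (intro sum.cong) auto
  then show ?thesis using weight_split[OF assms, of "x(i := p, i + 1 := q)"] weight_split[OF assms, of x] by simp
qed

definition preserves :: "nat \<Rightarrow> int \<Rightarrow> (nat \<Rightarrow> bool) linop \<Rightarrow> bool" where
  "preserves n k T \<longleftrightarrow> (\<forall>f\<in>weight_space n k. app T f \<in> weight_space n k)"

lemma preserves_algebra: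
  "preserves n k 0" "preserves n k 1" "preserves n k (scalar c)"
  "preserves n k S \<Longrightarrow> preserves n k T \<Longrightarrow> preserves n k (S + T)"
  "preserves n k S \<Longrightarrow> preserves n k T \<Longrightarrow> preserves n k (S * T)"
proof -
  show "preserves n k 0" "preserves n k 1" "preserves n k (scalar c)"
    by (auto simp: preserves_def weight_space_def app_simps)
  assume S: "preserves n k S" and T: "preserves n k T"
  show "preserves n k (S * T)" using S T by (simp add: preserves_def app_simps)
  show "preserves n k (S + T)"
    unfolding preserves_def
  proof
    fix f assume f: "f \<in> weight_space n k"
    have "app S f \<in> weight_space n k" "app T f \<in> weight_space n k" using S T f by (auto simp: preserves_def)
    then have "weight n x = k" if "app S f x + app T f x \<noteq> 0" for x
      using that by (cases "app S f x = 0") (auto simp: weight_space_def)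
    then show "app (S + T) f \<in> weight_space n k" by (auto simp: weight_space_def app_simps)
  qed
qed

lemma preserves_cross:
  assumes "i + 1 < n"
  shows "preserves n k (cross_op i)"
proof -
  have "weight n (x(i := x (i + 1), i + 1 := x i)) = weight n x" for x
    using weight_update[OF assms, of x "x (i + 1)" "x i"] by simp
  then show ?thesis unfolding preserves_def weight_space_def
    by (simp add: op_simps) metis
qed

lemma preserves_cupcap:
  assumes "i + 1 < n"
  shows "preserves n k (cupcap_op i)"
  unfolding preserves_def weight_space_def
proof (intro ballI CollectI allI impI)
  fix f x assume f: "f \<in> {f. \<forall>x. f x \<noteq> 0 \<longrightarrow> weight n x = k}" and nz: "app (cupcap_op i) f x \<noteq> 0"
  then have ne: "x i \<noteq> x (i + 1)" by (cases "x i = x (i + 1)") (simp_all add: op_simps)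
  then have w: "weight n (x(i := p, i + 1 := \<not> p)) = weight n x" for p
    using weight_update[OF assms, of x p "\<not> p"] by auto
  have "f (x(i := False, i + 1 := True)) \<noteq> 0 \<or> f (x(i := True, i + 1 := False)) \<noteq> 0"
    using nz ne by (auto simp: op_simps)
  then show "weight n x = k" using f w[of True] w[of False] by auto
qed

lemma preserves_jm: "i < n \<Longrightarrow> preserves n k (JM.jm i)"
proof (induction i)
  case (Suc i)
  then have "preserves n k (cross_op i)" "preserves n k (cupcap_op i)" "preserves n k (JM.jm i)"
    using preserves_cross preserves_cupcap by auto
  then show ?case by (auto intro!: preserves_algebra)
qed (simp add: preserves_algebra)

lemma preserves_gen: "gen_ok n g \<Longrightarrow> preserves n k (gen_op g)"
  by (cases g) (auto intro!: preserves_cross preserves_cupcap preserves_jm)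

lemma preserves_word: "word_ok n w \<Longrightarrow> preserves n k (word_op w)"
  by (induction w) (auto simp: word_op_def intro!: preserves_algebra preserves_gen)

lemma preserves_eval:
  assumes "f \<in> carrier (free_algebra n)"
  shows "preserves n k (eval_op f)"
proof -
  have "finite A \<Longrightarrow> A \<subseteq> Poly_Mapping.keys f \<Longrightarrow>
    preserves n k (\<Sum>w\<in>A. scalar (Poly_Mapping.lookup f w) * word_op (letters w))" for A
  proof (induction A rule: finite_induct)
    case (insert w A)
    then have "word_ok n (letters w)" using assms by (auto simp: carrier_free_algebra)
    then show ?case using insert by (auto intro!: preserves_algebra preserves_word)
  qed (simp add: preserves_algebra)
  then show ?thesis unfolding eval_op_def by simp
qed

text \<open>Each cup-cap forces opposite entries at its two positions and leaves all other positions
  alone. The part about \<open>y\<close> serves to compute a nonzero coefficient in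
  \<open>cup_word_survives\<close>.\<close>

lemma word_op_cups_nonzero:
  assumes "app (word_op (map (\<lambda>k. CupCap (2 * k + 1)) ks)) f x \<noteq> 0"
  shows "(\<forall>k\<in>set ks. x (2 * k) \<noteq> x (2 * k + 1)) \<and>
    (\<exists>y. f y \<noteq> 0 \<and> (\<forall>j. (\<forall>k\<in>set ks. j \<noteq> 2 * k \<and> j \<noteq> 2 * k + 1) \<longrightarrow> x j = y j))"
  using assms
proof (induction ks arbitrary: x)
  case Nil
  then show ?case by (auto simp: word_op_def app_simps)
next
  case (Cons k ks)
  let ?g = "app (word_op (map (\<lambda>k. CupCap (2 * k + 1)) ks)) f"
  have nz: "app (cupcap_op (2 * k)) ?g x \<noteq> 0" using Cons.prems by (simp add: word_op_def app_simps)
  then have ne: "x (2 * k) \<noteq> x (2 * k + 1)" by (cases "x (2 * k) = x (2 * k + 1)") (simp_all add: op_simps)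
  have "?g (x(2 * k := False, 2 * k + 1 := \<not> False)) \<noteq> 0 \<or> ?g (x(2 * k := True, 2 * k + 1 := \<not> True)) \<noteq> 0"
    using nz ne by (auto simp: op_simps)
  then obtain p where p: "?g (x(2 * k := p, 2 * k + 1 := \<not> p)) \<noteq> 0" by blast
  let ?x = "x(2 * k := p, 2 * k + 1 := \<not> p)"
  from Cons.IH[OF p] obtain y where IH: "\<forall>l\<in>set ks. ?x (2 * l) \<noteq> ?x (2 * l + 1)"
    "f y \<noteq> 0" "\<forall>j. (\<forall>l\<in>set ks. j \<noteq> 2 * l \<and> j \<noteq> 2 * l + 1) \<longrightarrow> ?x j = y j" by blast
  have "x (2 * l) \<noteq> x (2 * l + 1)" if "l \<in> set ks" for l
  proof (cases "l = k")
    case False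
    then have "2 * l \<noteq> 2 * k" "2 * l \<noteq> 2 * k + 1" "2 * l + 1 \<noteq> 2 * k" "2 * l + 1 \<noteq> 2 * k + 1" by presburger+
    then show ?thesis using IH(1) that by auto
  qed (use ne in simp)
  moreover have "x j = y j" if "\<forall>l\<in>set (k # ks). j \<noteq> 2 * l \<and> j \<noteq> 2 * l + 1" for j
    using IH(3)[rule_format, of j] that by simp
  ultimately show ?case using ne IH(2) by (intro conjI exI[of _ y]) auto
qed

text \<open>Each opposite pair contributes 0 and each remaining position at most 1.\<close>

lemma weight_bound:
  assumes "2 * r \<le> n" "\<forall>k<r. x (2 * k) \<noteq> x (2 * k + 1)"
  shows "weight n x \<le> int n - 2 * int r"
  using assms
proof (induction n arbitrary: r rule: less_induct)
  case (less n)
  show ?case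
  proof (cases r)
    case 0
    have "weight n x \<le> (\<Sum>j<n. 1)" unfolding weight_def by (intro sum_mono) auto
    then show ?thesis using 0 by simp
  next
    case (Suc q)
    show ?thesis
    proof (cases "n = 2 * r")
      case True
      then have n: "n = Suc (Suc (2 * q))" using Suc by simp
      have "weight (2 * q) x \<le> int (2 * q) - 2 * int q"
        using less.IH[of "2 * q" q] less.prems Suc n by auto
      moreover have "x (2 * q) \<noteq> x (Suc (2 * q))" using less.prems(2)[rule_format, of q] Suc by (simp add: One_nat_def)
      ultimately show ?thesis unfolding n Suc by (auto simp: weight_def)
    next
      case False
      then obtain n' where n': "n = Suc n'" "2 * r \<le> n'" using less.prems Suc by (cases n) auto
      then have "weight n' x \<le> int n' - 2 * int r" using less by auto
      then show ?thesis unfolding n' by (auto simp: weight_def)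
    qed
  qed
qed

lemma cup_word_kills:
  assumes "2 * (r + 1) \<le> n" "f \<in> weight_space n (int n - 2 * int r)"
  shows "app (word_op (cup_word (r + 1))) f = (\<lambda>x. 0)"
proof (rule ext, rule ccontr)
  fix x assume nz: "app (word_op (cup_word (r + 1))) f x \<noteq> 0"
  then have "\<forall>k<r + 1. x (2 * k) \<noteq> x (2 * k + 1)"
    using word_op_cups_nonzero[of "[0..<r + 1]" f x] unfolding cup_word_def by auto
  then have "weight n x \<le> int n - 2 * int (r + 1)" using weight_bound[OF assms(1)] by blast
  moreover have "weight n x = int n - 2 * int r"
    using preserves_word[OF cup_word_ok[OF assms(1)]] assms(2) nz
    unfolding preserves_def weight_space_def by blast
  ultimately show False by simp
qed

lemma cup_word_survives:
  assumes "2 * r \<le> n"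
  shows "\<exists>f\<in>weight_space n (int n - 2 * int r). app (word_op (cup_word r)) f \<noteq> (\<lambda>x. 0)"
proof -
  \<comment> \<open>The basis tensor with \<open>r\<close> pairs even-odd followed by even factors
    only; \<open>f\<close> is its indicator function, and the coefficient of the image at
    \<open>z\<close> itself turns out to be 1.\<close>
  define z where "z j \<longleftrightarrow> odd j \<and> j < 2 * r" for j :: nat
  define f where "f x = (if x = z then 1 else 0 :: complex)" for x
  have "2 * m \<le> n \<Longrightarrow> weight n (\<lambda>j. odd j \<and> j < 2 * m) = int n - 2 * int m" for m n
  proof (induction n arbitrary: m rule: less_induct)
    case (less n)
    show ?case
    proof (cases m)
      case (Suc q)
      show ?thesis
      proof (cases "n = 2 * m")
        case True
        then have n: "n = Suc (Suc (2 * q))" using Suc by simp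
        have "weight (2 * q) (\<lambda>j. odd j \<and> j < 2 * m) = weight (2 * q) (\<lambda>j. odd j \<and> j < 2 * q)"
          unfolding weight_def Suc by (intro sum.cong) auto
        also have "\<dots> = 0" using less.IH[of "2 * q" q] n by simp
        finally show ?thesis unfolding n Suc by (simp add: weight_def)
      next
        case False
        then obtain n' where n': "n = Suc n'" "2 * m \<le> n'" using less.prems Suc by (cases n) auto
        then have "weight n' (\<lambda>j. odd j \<and> j < 2 * m) = int n' - 2 * int m" using less by auto
        then show ?thesis using n'(2) unfolding n'(1) by (simp add: weight_def)
      qed
    qed (simp add: weight_def)
  qed
  from this[OF assms] have f: "f \<in> weight_space n (int n - 2 * int r)"
    by (auto simp: weight_space_def f_def z_def[abs_def])
  have "set ks \<subseteq> {..<r} \<Longrightarrow> distinct ks \<Longrightarrow> app (word_op (map (\<lambda>k. CupCap (2 * k + 1)) ks)) f z = 1" for ks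
  proof (induction ks)
    case Nil
    then show ?case by (simp add: word_op_def app_simps f_def)
  next
    case (Cons k ks)
    let ?g = "app (word_op (map (\<lambda>k. CupCap (2 * k + 1)) ks)) f"
    have zk: "\<not> z (2 * k)" "z (2 * k + 1)" using Cons.prems by (auto simp: z_def)
    \<comment> \<open>Of the two terms of the cup-cap only the one that restores \<open>z\<close>
      survives: the remaining cup-caps do not touch position \<open>2 * k\<close>, so the other term
      would need an odd factor of \<open>z\<close> there.\<close>
    have "?g (z(2 * k := True, 2 * k + 1 := False)) = 0"
    proof (rule ccontr)
      assume "?g (z(2 * k := True, 2 * k + 1 := False)) \<noteq> 0"
      from word_op_cups_nonzero[OF this] obtain y where y: "f y \<noteq> 0"
        "\<forall>j. (\<forall>l\<in>set ks. j \<noteq> 2 * l \<and> j \<noteq> 2 * l + 1) \<longrightarrow> (z(2 * k := True, 2 * k + 1 := False)) j = y j" by blast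
      have "2 * k \<noteq> 2 * l + 1" for l by presburger
      then have "\<forall>l\<in>set ks. 2 * k \<noteq> 2 * l \<and> 2 * k \<noteq> 2 * l + 1" using Cons.prems(2) by auto
      then have "y (2 * k)" using y(2)[rule_format, of "2 * k"] by simp
      moreover have "y = z" using y(1) by (simp add: f_def split: if_splits)
      ultimately show False using zk by simp
    qed
    moreover have "z(2 * k := False, 2 * k + 1 := True) = z" by (rule ext) (use zk in simp)
    ultimately have "app (cupcap_op (2 * k)) ?g z = 1"
      using Cons zk by (simp add: op_simps)
    then show ?case by (simp add: word_op_def app_simps)
  qed
  from this[of "[0..<r]"] have "app (word_op (cup_word r)) f z = 1"
    by (simp add: cup_word_def atLeast0LessThan)
  then show ?thesis using f by (intro bexI[OF _ f]) auto
qed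

lemma app_zero_fun: "app T (\<lambda>y. 0) = (\<lambda>x. 0)"
  by (rule ext) (rule app_zero)

text \<open>\<open>K\<close> consists of the elements that annihilate the weight space of weight
  \<open>n - 2 * r\<close>. It is two-sided because the whole algebra preserves this space. It
  contains \<open>cup_word (r + 1)\<close> if that product exists, but not
  \<open>cup_word r\<close>.\<close>

lemma II_proper:
  assumes r: "2 * r \<le> n"
  shows "VV_word n (cup_word r) \<notin> II n (r + 1)"
proof
  let ?W = "weight_space n (int n - 2 * int r)"
  define K where "K = {f \<in> carrier (free_algebra n). \<forall>\<phi>\<in>?W. app (eval_op f) \<phi> = (\<lambda>x. 0)}"
  have ideal: "ideal (VV_class n ` K) (VV n)"
  proof (rule VV_class_ideal)
    show "K \<subseteq> carrier (free_algebra n)" by (auto simp: K_def)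
    show "0 \<in> K" by (auto simp: K_def free_zero_closed eval_zero app_simps)
    show "f + g \<in> K" if "f \<in> K" "g \<in> K" for f g
      using that by (auto simp: K_def free_add_closed eval_add app_simps)
    fix f h assume f: "f \<in> K" and h: "h \<in> carrier (free_algebra n)"
    show "h * f \<in> K" using f h by (auto simp: K_def free_mult_closed eval_mult app_simps app_zero_fun)
    show "f * h \<in> K" using f h preserves_eval[OF h, of "int n - 2 * int r"]
      by (auto simp: K_def free_mult_closed eval_mult app_simps preserves_def)
  qed
  have sub: "II n (r + 1) \<subseteq> VV_class n ` K"
  proof (cases "2 * (r + 1) \<le> n")
    case True
    have "free_word (cup_word (r + 1)) \<in> K"
      using free_word_closed[OF cup_word_ok[OF True]] cup_word_kills[OF True] by (simp add: K_def eval_word)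
    then have "{VV_word n (cup_word (r + 1))} \<subseteq> VV_class n ` K" by (simp add: VV_word_def)
    then show ?thesis using II_cup[of "r + 1" n] True ring.genideal_minimal[OF ring_VV ideal] by simp
  next
    case False
    then have "\<not> r + 1 \<le> n div 2" by presburger
    then have "II n (r + 1) = {\<zero>\<^bsub>VV n\<^esub>}" by (simp add: II_def)
    then show ?thesis using additive_subgroup.zero_closed[OF ideal.axioms(1)[OF ideal]] by simp
  qed
  assume "VV_word n (cup_word r) \<in> II n (r + 1)"
  then obtain f where f: "f \<in> K" "VV_word n (cup_word r) = VV_class n f" using sub by blast
  have "free_word (cup_word r) - f \<in> relation_ideal n"
    by (rule VV_class_eqD) (use f free_word_closed[OF cup_word_ok[OF r]] in \<open>auto simp: K_def VV_word_def\<close>)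
  then have "word_op (cup_word r) = eval_op f" 
    using eval_relation_ideal[of "free_word (cup_word r) - f" n] by (simp add: eval_diff eval_word)
  moreover obtain \<phi> where "\<phi> \<in> ?W" "app (word_op (cup_word r)) \<phi> \<noteq> (\<lambda>x. 0)" using cup_word_survives[OF r] by blast
  ultimately show False using f(1) by (simp add: K_def)
qed

text \<open>The two ends of the chain fit in: for \<open>r = 0\<close> the product
  \<open>cup_word r\<close> is empty and represents the unit, and for \<open>r = n div 2\<close> the
  smaller ideal is zero.\<close>

lemma II_decreasing:
  assumes r: "r \<le> n div 2"
  shows "II n (r + 1) \<subset> II n r"
proof -
  have r2: "2 * r \<le> n" using r by linarith
  have id: "ideal (II n r) (VV n)" and mem: "VV_word n (cup_word r) \<in> II n r"
  proof -
    show "ideal (II n r) (VV n)"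
    proof (cases "r = 0")
      case True
      then show ?thesis using ring.oneideal[OF ring_VV] by (simp add: II_def)
    qed (use II_ideal r2 in simp)
    show "VV_word n (cup_word r) \<in> II n r"
    proof (cases "r = 0")
      case True
      then show ?thesis using VV_word_closed[OF cup_word_ok[OF r2]] by (simp add: II_def)
    qed (use cup_in_II r2 in simp)
  qed
  have "II n (r + 1) \<subseteq> II n r"
  proof (cases "r + 1 \<le> n div 2")
    case True
    then have r3: "2 * (r + 1) \<le> n" by presburger
    have "cup_word (r + 1) = cup_word r @ [CupCap (2 * r + 1)]" by (metis Suc_eq_plus1 cup_word_simps(2))
    then have "VV_word n (cup_word (r + 1)) \<in> II n r"
      using VV_word_ideal_eqv[OF id, of "cup_word (r + 1)" "[]" "cup_word r" "[CupCap (2 * r + 1)]"] mem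
        cup_word_ok[OF r2] r3 VV_words.refl by simp
    then show ?thesis unfolding II_cup[of "r + 1" n, OF _ r3, simplified]
      by (intro ring.genideal_minimal[OF ring_VV id]) simp
  next
    case False
    then show ?thesis using additive_subgroup.zero_closed[OF ideal.axioms(1)[OF id]] by (simp add: II_def)
  qed
  then show ?thesis using mem II_proper[OF r2] by blast
qed

theorem lemma14:
  fixes n p :: nat
  assumes "n \<ge> 2" and "p = n div 2"
  shows
    "(\<forall>r\<in>{1..p}.
        (\<forall>m. monomial_choice n m \<longrightarrow>
           II n r = linear_combinations n (normal_diagrams n m (n - 2 * r))) \<and>
        (\<forall>js. length js = r \<and> set js \<subseteq> {1..n - 1} \<and>
              (\<forall>j<r. \<forall>k<r. j \<noteq> k \<longrightarrow> \<bar>int (js ! j) - int (js ! k)\<bar> > 1) \<longrightarrow>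
           II n r = Idl\<^bsub>VV n\<^esub> {e_product n js})) \<and>
     (\<forall>r\<le>p + 1. ideal (II n r) (VV n)) \<and>
     II n (p + 1) = {\<zero>\<^bsub>VV n\<^esub>} \<and>
     (\<forall>r\<le>p. II n (r + 1) \<subset> II n r) \<and>
     (\<forall>r\<in>{1..p}. II n r = Idl\<^bsub>VV n\<^esub> {odd_e_product n r}) \<and>
     II n 0 = carrier (VV n)"
proof (intro conjI ballI allI impI)
  show "ideal (II n r) (VV n)" for r
  proof -
    consider "r = 0" | "1 \<le> r" "2 * r \<le> n" | "r \<noteq> 0" "\<not> r \<le> n div 2" by linarith
    then show ?thesis
    proof cases
      case 1
      then show ?thesis using ring.oneideal[OF ring_VV] by (simp add: II_def)
    next
      case 2
      then show ?thesis by (rule II_ideal)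
    next
      case 3
      then show ?thesis using ring.zeroideal[OF ring_VV] by (simp add: II_def)
    qed
  qed
  show "II n (r + 1) \<subset> II n r" if "r \<le> p" for r
    using II_decreasing that assms(2) by blast
next
  fix r assume "r \<in> {1..p}"
  then have r: "1 \<le> r" "2 * r \<le> n" using assms by auto
  show "II n r = linear_combinations n (normal_diagrams n m (n - 2 * r))" if "monomial_choice n m" for m
    using II_normal[OF r that] .
  show "II n r = Idl\<^bsub>VV n\<^esub> {e_product n js}"
    if "length js = r \<and> set js \<subseteq> {1..n - 1} \<and> (\<forall>j<r. \<forall>k<r. j \<noteq> k \<longrightarrow> \<bar>int (js ! j) - int (js ! k)\<bar> > 1)" for js
    using II_spaced[OF r] that by blast
  show "II n r = Idl\<^bsub>VV n\<^esub> {odd_e_product n r}"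
    using II_cup[OF r] by (simp add: odd_e_product_cup)
qed (use assms in \<open>simp_all add: II_def\<close>)

end
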